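(* Let $m\ge 2$ be even and $n\ge 1$, let $\mathcal{A}\in\mathbb{R}^{[n,m]}$ be a real symmetric tensor of order $m$ and dimension $n$, and put $d=n(m-1)^{n-1}$. Suppose that the $d$ eigenvalues of $\mathcal{A}$ (counted with multiplicity) are all real and positive, ordered as $\lambda_1\ge\lambda_2\ge\cdots\ge\lambda_d>0$. Let $k,l$ be integers with $1\le k\le l\le d-1$. Then (with the convention $0^0=1$ when $k=1$) $$\left[\left(\frac{k-1}{(m-1)^{n-1}\operatorname{tr}(\mathcal{A})}\right)^{k-1}\det(\mathcal{A})\right]^{1/(d-k+1)}\le(\lambda_k\cdots\lambda_l)^{1/(l-k+1)}\le\frac{\lambda_k+\cdots+\lambda_l}{l-k+1}$$ and $$\frac{\lambda_k+\cdots+\lambda_l}{l-k+1}\le\frac{(m-1)^{n-1}\operatorname{tr}(\mathcal{A})}{l}-\left(\frac{d}{l}-1\right)\left[\left(\frac{l}{(m-1)^{n-1}\operatorname{tr}(\mathcal{A})}\right)^{l}\det(\mathcal{A})\right]^{1/(d-l)}.$$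
   Context: $\mathbb{R}^{[n,m]}$ is the set of real tensors $\mathcal{A}=(a_{i_1\cdots i_m})_{1\le i_1,\dots,i_m\le n}$ of order $m$ and dimension $n$. $\mathcal{A}$ is symmetric if its entries are invariant under every permutation of the indices. For a vector $x$, $\mathcal{A}x^{m-1}$ is the vector with $i$-th component $\sum_{i_2,\dots,i_m=1}^n a_{i i_2\cdots i_m}x_{i_2}\cdots x_{i_m}$. The identity tensor $\mathcal{I}$ has entry $1$ when $i_1=\cdots=i_m$ and $0$ otherwise. The trace $\operatorname{tr}(\mathcal{A})=\sum_{i=1}^n a_{ii\cdots i}$ is the sum of the diagonal entries. The resultant of $n$ homogeneous polynomials $f_1,\dots,f_n$ in $n$ variables of degrees $d_1,\dots,d_n$ is the unique polynomial in their coefficients such that (1) it vanishes if and only if $f_1=\cdots=f_n=0$ has a nonzero (complex) solution; (2) it equals $1$ when $f_i=x_i^{d_i}$ for all $i$; (3) it is irreducible when the coefficients are viewed as independent variables. The determinant $\det(\mathcal{A})$ is the resultant of the ordered system of $n$ homogeneous polynomials of degree $m-1$ given by the components of $\mathcal{A}x^{m-1}$. The eigenvalues of $\mathcal{A}$ are the complex roots of the characteristic polynomial $\phi(\lambda)=\det(\mathcal{A}-\lambda\mathcal{I})$, which has degree $d=n(m-1)^{n-1}$; counted with multiplicity there are $d$ of them. *)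

theory Defs
  imports
    Complex_Main
    "HOL-Library.Poly_Mapping"
    "HOL-Computational_Algebra.Polynomial"
    "HOL-Combinatorics.Permutations"
begin

section \<open>Multivariate polynomials\<close>

text \<open>
  A polynomial over \<open>'a\<close> in variables from \<open>'v\<close> maps each monomial, given by its exponent
  vector of type \<open>'v \<Rightarrow>\<^sub>0 nat\<close>, to its coefficient. The product on \<^type>\<open>poly_mapping\<close> is the
  convolution product, so the ring operations, \<^const>\<open>Rings.dvd\<close> and \<^const>\<open>irreducible\<close>
  are those of the polynomial ring \<open>'a['v]\<close>.
\<close>

type_synonym 'v monomial = "'v \<Rightarrow>\<^sub>0 nat"

type_synonym ('v, 'a) mpoly = "'v monomial \<Rightarrow>\<^sub>0 'a"

definition monomial_degree :: "'v monomial \<Rightarrow> nat" where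
  "monomial_degree \<alpha> = (\<Sum>v\<in>Poly_Mapping.keys \<alpha>. Poly_Mapping.lookup \<alpha> v)"

definition monomial_eval :: "('v \<Rightarrow> 'a) \<Rightarrow> 'v monomial \<Rightarrow> 'a::comm_semiring_1" where
  "monomial_eval x \<alpha> = (\<Prod>v\<in>Poly_Mapping.keys \<alpha>. x v ^ Poly_Mapping.lookup \<alpha> v)"

definition mpoly_eval :: "('v \<Rightarrow> 'a) \<Rightarrow> ('v, 'a) mpoly \<Rightarrow> 'a::comm_semiring_1" where
  "mpoly_eval x p = (\<Sum>\<alpha>\<in>Poly_Mapping.keys p. Poly_Mapping.lookup p \<alpha> * monomial_eval x \<alpha>)"

definition mpoly_vars :: "('v, 'a::zero) mpoly \<Rightarrow> 'v set" where
  "mpoly_vars p = (\<Union>\<alpha>\<in>Poly_Mapping.keys p. Poly_Mapping.keys \<alpha>)"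

text \<open>The zero polynomial is a form of every degree.\<close>

definition is_form :: "nat \<Rightarrow> nat \<Rightarrow> (nat, complex) mpoly \<Rightarrow> bool" where
  "is_form n e f \<longleftrightarrow> (\<forall>\<alpha>\<in>Poly_Mapping.keys f. Poly_Mapping.keys \<alpha> \<subseteq> {1..n} \<and> monomial_degree \<alpha> = e)"


section \<open>The resultant\<close>

text \<open>
  The resultant of forms \<open>f\<^sub>1, \<dots>, f\<^sub>n\<close> of degrees \<open>e 1, \<dots>, e n\<close> in the variables \<open>1, \<dots>, n\<close> is a
  polynomial in one independent variable for each potential coefficient: the variable \<open>(i, \<alpha>)\<close>
  stands for the coefficient of the monomial \<open>\<alpha>\<close> in \<open>f\<^sub>i\<close>.
\<close>

type_synonym coeff_var = "nat \<times> nat monomial"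

definition coeff_vars :: "nat \<Rightarrow> (nat \<Rightarrow> nat) \<Rightarrow> coeff_var set" where
  "coeff_vars n e =
     {(i, \<alpha>). i \<in> {1..n} \<and> Poly_Mapping.keys \<alpha> \<subseteq> {1..n} \<and> monomial_degree \<alpha> = e i}"

definition eval_at_coeffs ::
    "(coeff_var, complex) mpoly \<Rightarrow> (nat \<Rightarrow> (nat, complex) mpoly) \<Rightarrow> complex" where
  "eval_at_coeffs R f = mpoly_eval (\<lambda>(i, \<alpha>). Poly_Mapping.lookup (f i) \<alpha>) R"

definition has_nontrivial_zero :: "nat \<Rightarrow> (nat \<Rightarrow> (nat, complex) mpoly) \<Rightarrow> bool" where
  "has_nontrivial_zero n f \<longleftrightarrow>
     (\<exists>x. (\<exists>i\<in>{1..n}. x i \<noteq> 0) \<and> (\<forall>i\<in>{1..n}. mpoly_eval x (f i) = 0))"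

text \<open>
  Irreducibility is over \<open>\<complex>\<close>. It is expressed in the polynomial ring in all variables of type
  \<^typ>\<open>coeff_var\<close>, which for a polynomial involving only variables from \<^term>\<open>coeff_vars n e\<close> is the
  same as irreducibility in the polynomial ring in those variables.
\<close>

definition is_resultant :: "nat \<Rightarrow> (nat \<Rightarrow> nat) \<Rightarrow> (coeff_var, complex) mpoly \<Rightarrow> bool" where
  "is_resultant n e R \<longleftrightarrow>
     mpoly_vars R \<subseteq> coeff_vars n e \<and>
     (\<forall>f. (\<forall>i\<in>{1..n}. is_form n (e i) (f i)) \<longrightarrow>
        (eval_at_coeffs R f = 0 \<longleftrightarrow> has_nontrivial_zero n f)) \<and>
     eval_at_coeffs R (\<lambda>i. Poly_Mapping.single (Poly_Mapping.single i (e i)) 1) = 1 \<and>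
     irreducible R"

definition resultant_mpoly :: "nat \<Rightarrow> (nat \<Rightarrow> nat) \<Rightarrow> (coeff_var, complex) mpoly" where
  "resultant_mpoly n e = (THE R. is_resultant n e R)"

definition resultant :: "nat \<Rightarrow> (nat \<Rightarrow> nat) \<Rightarrow> (nat \<Rightarrow> (nat, complex) mpoly) \<Rightarrow> complex" where
  "resultant n e f = eval_at_coeffs (resultant_mpoly n e) f"


section \<open>Tensors\<close>

text \<open>
  A tensor of order \<open>m\<close> and dimension \<open>n\<close> is a function on multi-indices. Only its values on
  \<open>multi_indices n m\<close>, the lists \<open>[i\<^sub>1, \<dots>, i\<^sub>m]\<close> with entries in \<open>{1..n}\<close>, are relevant.
\<close>

type_synonym 'a tensor = "nat list \<Rightarrow> 'a"

definition multi_indices :: "nat \<Rightarrow> nat \<Rightarrow> nat list set" where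
  "multi_indices n m = {js. set js \<subseteq> {1..n} \<and> length js = m}"

definition symmetric_tensor :: "nat \<Rightarrow> nat \<Rightarrow> 'a tensor \<Rightarrow> bool" where
  "symmetric_tensor n m A \<longleftrightarrow>
     (\<forall>js\<in>multi_indices n m. \<forall>\<pi>. \<pi> permutes {..<m} \<longrightarrow> A (permute_list \<pi> js) = A js)"

definition identity_tensor :: "'a::zero_neq_one tensor" where
  "identity_tensor js = (if \<forall>i\<in>set js. \<forall>j\<in>set js. i = j then 1 else 0)"

definition tensor_trace :: "nat \<Rightarrow> nat \<Rightarrow> 'a::comm_monoid_add tensor \<Rightarrow> 'a" where
  "tensor_trace n m A = (\<Sum>i=1..n. A (replicate m i))"

definition index_monomial :: "nat list \<Rightarrow> nat monomial" where
  "index_monomial js = sum_list (map (\<lambda>j. Poly_Mapping.single j 1) js)"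

text \<open>
  The \<open>i\<close>-th component of \<open>A x\<^sup>m\<^sup>-\<^sup>1\<close> as a polynomial in \<open>x\<close>; see \<open>mpoly_eval_tensor_form\<close> below
  for its values.
\<close>

definition tensor_form :: "nat \<Rightarrow> nat \<Rightarrow> complex tensor \<Rightarrow> nat \<Rightarrow> (nat, complex) mpoly" where
  "tensor_form n m A i =
     (\<Sum>js\<in>multi_indices n (m - 1). Poly_Mapping.single (index_monomial js) (A (i # js)))"

definition tensor_det :: "nat \<Rightarrow> nat \<Rightarrow> complex tensor \<Rightarrow> complex" where
  "tensor_det n m A = resultant n (\<lambda>_. m - 1) (tensor_form n m A)"

definition char_poly :: "nat \<Rightarrow> nat \<Rightarrow> complex tensor \<Rightarrow> complex poly" where
  "char_poly n m A =
     (THE p. \<forall>z. poly p z = tensor_det n m (\<lambda>js. A js - z * identity_tensor js))"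

definition tensor_eigenvalues :: "nat \<Rightarrow> nat \<Rightarrow> complex tensor \<Rightarrow> complex multiset" where
  "tensor_eigenvalues n m A = proots (char_poly n m A)"

definition complex_tensor :: "real tensor \<Rightarrow> complex tensor" where
  "complex_tensor A = (\<lambda>js. complex_of_real (A js))"


section \<open>Basic facts about the definitions\<close>

lemma finite_multi_indices: "finite (multi_indices n m)"
  unfolding multi_indices_def by (rule finite_lists_length_eq) simp

lemma monomial_eval_superset:
  assumes "finite S" "Poly_Mapping.keys \<alpha> \<subseteq> S"
  shows "monomial_eval x \<alpha> = (\<Prod>v\<in>S. x v ^ Poly_Mapping.lookup \<alpha> v)"
  unfolding monomial_eval_def
  by (rule prod.mono_neutral_left) (use assms in \<open>auto simp: in_keys_iff\<close>)

lemma monomial_eval_add: "monomial_eval x (\<alpha> + \<beta>) = monomial_eval x \<alpha> * monomial_eval x \<beta>"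
proof -
  let ?S = "Poly_Mapping.keys \<alpha> \<union> Poly_Mapping.keys \<beta>"
  have "monomial_eval x \<gamma> = (\<Prod>v\<in>?S. x v ^ Poly_Mapping.lookup \<gamma> v)" if "\<gamma> \<in> {\<alpha>, \<beta>, \<alpha> + \<beta>}" for \<gamma>
    by (rule monomial_eval_superset) (use that keys_add[of \<alpha> \<beta>] in auto)
  then show ?thesis
    by (simp add: lookup_add power_add prod.distrib)
qed

lemma monomial_eval_index_monomial: "monomial_eval x (index_monomial js) = (\<Prod>j\<leftarrow>js. x j)"
  by (induction js)
    (simp_all add: index_monomial_def monomial_eval_add, simp_all add: monomial_eval_def)

lemma mpoly_eval_superset:
  assumes "finite S" "Poly_Mapping.keys p \<subseteq> S"
  shows "mpoly_eval x p = (\<Sum>\<alpha>\<in>S. Poly_Mapping.lookup p \<alpha> * monomial_eval x \<alpha>)"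
  unfolding mpoly_eval_def
  by (rule sum.mono_neutral_left) (use assms in \<open>auto simp: in_keys_iff\<close>)

lemma mpoly_eval_add: "mpoly_eval x (p + q) = mpoly_eval x p + mpoly_eval x q"
proof -
  let ?S = "Poly_Mapping.keys p \<union> Poly_Mapping.keys q"
  have "mpoly_eval x r = (\<Sum>\<alpha>\<in>?S. Poly_Mapping.lookup r \<alpha> * monomial_eval x \<alpha>)" if "r \<in> {p, q, p + q}" for r
    by (rule mpoly_eval_superset) (use that keys_add[of p q] in auto)
  then show ?thesis
    by (simp add: lookup_add distrib_right sum.distrib)
qed

lemma mpoly_eval_single: "mpoly_eval x (Poly_Mapping.single \<alpha> c) = c * monomial_eval x \<alpha>"
  by (cases "c = 0") (simp_all add: mpoly_eval_def)

lemma mpoly_eval_sum: "mpoly_eval x (\<Sum>a\<in>S. p a) = (\<Sum>a\<in>S. mpoly_eval x (p a))"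
  by (induction S rule: infinite_finite_induct)
    (simp_all add: mpoly_eval_add, simp_all add: mpoly_eval_def)

lemma mpoly_eval_tensor_form:
  "mpoly_eval x (tensor_form n m A i) =
     (\<Sum>js\<in>multi_indices n (m - 1). A (i # js) * (\<Prod>j\<leftarrow>js. x j))"
  by (simp add: tensor_form_def mpoly_eval_sum mpoly_eval_single monomial_eval_index_monomial)

lemma poly_char_poly:
  "poly (char_poly n m A) z = tensor_det n m (\<lambda>js. A js - z * identity_tensor js)"
proof -
  define R where "R = resultant_mpoly n (\<lambda>_. m - 1)"
  define c where "c i \<alpha> = (\<Sum>js\<in>multi_indices n (m - 1).
      if index_monomial js = \<alpha> then [:A (i # js), - identity_tensor (i # js):] else 0)" for i \<alpha>
  define p where "p = (\<Sum>\<mu>\<in>Poly_Mapping.keys R. smult (Poly_Mapping.lookup R \<mu>)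
      (\<Prod>v\<in>Poly_Mapping.keys \<mu>. (case v of (i, \<alpha>) \<Rightarrow> c i \<alpha>) ^ Poly_Mapping.lookup \<mu> v))"
  have c: "poly (c i \<alpha>) z =
      Poly_Mapping.lookup (tensor_form n m (\<lambda>js. A js - z * identity_tensor js) i) \<alpha>" for i \<alpha> z
    unfolding c_def tensor_form_def poly_sum lookup_sum
    by (rule sum.cong) (auto simp: lookup_single)
  have "poly p z = tensor_det n m (\<lambda>js. A js - z * identity_tensor js)" for z
    unfolding tensor_det_def resultant_def eval_at_coeffs_def R_def[symmetric] mpoly_eval_def
      monomial_eval_def p_def poly_sum
    by (auto simp: poly_prod c intro!: sum.cong prod.cong)
  then have "\<exists>!p. \<forall>z. poly p z = tensor_det n m (\<lambda>js. A js - z * identity_tensor js)"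
    by (metis poly_eq_poly_eq_iff ext)
  from theI'[OF this] show ?thesis
    unfolding char_poly_def by blast
qed

end

theory Submission
  imports
    Defs
    "HOL-Library.Product_Lexorder"
    "HOL-Analysis.Continuum_Not_Denumerable"
    "HOL-Analysis.Convex"
    "HOL-Computational_Algebra.Fundamental_Theorem_Algebra"
    "Jordan_Normal_Form.Determinant"
begin

text \<open>
  The inequalities follow from the inequality of the arithmetic and geometric means once the
  eigenvalues are known to have product \<open>det(A)\<close> and sum \<open>(m - 1)\<^sup>n\<^sup>-\<^sup>1 tr(A)\<close>.

  The systems of forms with a nontrivial zero are the image of an affine space under a polynomial
  map, so their vanishing ideal is prime. It contains no nonzero polynomial free of the coefficient
  of \<open>x\<^sub>n\<^sup>e\<close> in the last form; by unique factorization it is generated by one irreducible element, and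
  by the Nullstellensatz every system without a nontrivial zero is separated from it by a Macaulay
  determinant. Hence the resultant exists and generates this ideal.

  A symmetry of the set of systems with a nontrivial zero therefore multiplies the resultant by a
  constant. Scaling single forms and single variables shows that every monomial of the resultant other
  than the diagonal one has at least two off-diagonal factors, so that \<open>det(A - z I)\<close> agrees with
  \<open>\<Prod>\<^sub>i (a\<^sub>i\<^sub>.\<^sub>.\<^sub>i - z)\<^sup>D\<close> in its two leading coefficients. The value of \<open>D\<close> is read off from the
  number of eigenvalues.
\<close>

section \<open>Substitution and the univariate view\<close>

text \<open>A prime ideal need not be principal. Suppose an irreducible member \<open>R\<close>
  involves the excluded coefficient and does not divide a member \<open>Q\<close>. Then
  \<open>R\<close> and \<open>Q\<close> are coprime as polynomials in that coefficient over the
  fraction field of the others. Clearing denominators in a Bezout identity gives a nonzero member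
  without that coefficient, which is impossible. This is what unique factorization is for; it is
  built by adjoining one variable at a time.

  In the inequalities, the first \<open>a\<close> eigenvalues have sum at most the total sum
  \<open>T\<close>, so their product is at most \<open>(T / a) ^ a\<close>, and the product of the
  others is at least \<open>(a / T) ^ a\<close> times the determinant. The two brackets are the
  cases \<open>a = k - 1\<close> and \<open>a = l\<close>. The order of the eigenvalues enters by
  comparing means: the block \<open>k..l\<close> has a geometric mean at least that of
  \<open>k..d\<close> and an arithmetic mean at most that of \<open>1..l\<close>.\<close>

abbreviation Const :: "'a::zero \<Rightarrow> ('v, 'a) mpoly" where
  "Const c \<equiv> Poly_Mapping.single 0 c"

definition Var :: "'v \<Rightarrow> ('v, 'a::zero_neq_one) mpoly" where
  "Var v = Poly_Mapping.single (Poly_Mapping.single v 1) 1"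

text \<open>Coefficients and variables are sent to the target ring independently, so that
  evaluation, change of variables and the univariate view are instances of one homomorphism.\<close>

definition psubst :: "('a::zero \<Rightarrow> 'b) \<Rightarrow> ('v \<Rightarrow> 'b) \<Rightarrow> ('v, 'a) mpoly \<Rightarrow> 'b::comm_semiring_1" where
  "psubst h x p = (\<Sum>\<alpha>\<in>Poly_Mapping.keys p. h (Poly_Mapping.lookup p \<alpha>) * monomial_eval x \<alpha>)"

lemma mpoly_eval_eq_psubst: "mpoly_eval x p = psubst (\<lambda>c. c) x p"
  by (simp add: mpoly_eval_def psubst_def)

lemma sum_single_keys:
  "(\<Sum>\<alpha>\<in>Poly_Mapping.keys p. Poly_Mapping.single \<alpha> (Poly_Mapping.lookup p \<alpha>)) = p"
  by (rule poly_mapping_eqI) (auto simp: lookup_sum lookup_single when_def in_keys_iff)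

lemma comm_ring_hom_Const: "comm_ring_hom (Const :: 'a::comm_ring_1 \<Rightarrow> ('v, 'a) mpoly)"
  by unfold_locales (simp_all add: single_add mult_single)

lemma monomial_eval_0 [simp]: "monomial_eval x 0 = 1"
  by (simp add: monomial_eval_def)

lemma monomial_eval_single: "monomial_eval x (Poly_Mapping.single v k) = x v ^ k"
  by (simp add: monomial_eval_def)

lemma monomial_eval_hom:
  assumes "comm_ring_hom h"
  shows "h (monomial_eval x \<alpha>) = monomial_eval (\<lambda>v. h (x v)) \<alpha>"
proof -
  interpret comm_ring_hom h by fact
  show ?thesis by (simp add: monomial_eval_def hom_prod hom_power)
qed

locale coeff_hom = comm_ring_hom h for h :: "'a::comm_ring_1 \<Rightarrow> 'b::comm_ring_1"
begin

lemma psubst_superset: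
  assumes "finite S" "Poly_Mapping.keys p \<subseteq> S"
  shows "psubst h x p = (\<Sum>\<alpha>\<in>S. h (Poly_Mapping.lookup p \<alpha>) * monomial_eval x \<alpha>)"
  unfolding psubst_def by (rule sum.mono_neutral_left) (use assms in \<open>auto simp: in_keys_iff\<close>)

lemma psubst_add: "psubst h x (p + q) = psubst h x p + psubst h x q"
proof -
  let ?S = "Poly_Mapping.keys p \<union> Poly_Mapping.keys q"
  have "psubst h x r = (\<Sum>\<alpha>\<in>?S. h (Poly_Mapping.lookup r \<alpha>) * monomial_eval x \<alpha>)"
    if "r \<in> {p, q, p + q}" for r
    by (rule psubst_superset) (use that keys_add[of p q] in auto)
  then show ?thesis
    by (simp add: lookup_add hom_add distrib_right sum.distrib)
qed

lemma psubst_0 [simp]: "psubst h x 0 = 0"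
  by (simp add: psubst_def)

lemma psubst_sum: "psubst h x (\<Sum>a\<in>S. p a) = (\<Sum>a\<in>S. psubst h x (p a))"
  by (induction S rule: infinite_finite_induct) (simp_all add: psubst_add)

lemma psubst_single: "psubst h x (Poly_Mapping.single \<alpha> c) = h c * monomial_eval x \<alpha>"
  by (cases "c = 0") (simp_all add: psubst_def)

lemma psubst_Const [simp]: "psubst h x (Const c) = h c"
  by (simp add: psubst_single)

lemma psubst_1 [simp]: "psubst h x 1 = 1"
  using psubst_Const[of x 1] by simp

lemma psubst_Var [simp]: "psubst h x (Var v) = x v"
  by (simp add: Var_def psubst_single monomial_eval_single)

lemma psubst_mult: "psubst h x (p * q) = psubst h x p * psubst h x q"
proof -
  let ?s = "\<lambda>p \<alpha>. Poly_Mapping.single \<alpha> (Poly_Mapping.lookup p \<alpha>)"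
  have "p * q = (\<Sum>\<alpha>\<in>Poly_Mapping.keys p. ?s p \<alpha>) * (\<Sum>\<beta>\<in>Poly_Mapping.keys q. ?s q \<beta>)"
    by (simp only: sum_single_keys)
  also have "psubst h x \<dots> = psubst h x p * psubst h x q"
    by (simp add: sum_product psubst_sum mult_single psubst_single monomial_eval_add hom_mult)
       (simp add: psubst_def sum_product mult_ac)
  finally show ?thesis .
qed

lemma psubst_hom: "comm_ring_hom (psubst h x)"
  by unfold_locales (simp_all add: psubst_add psubst_mult)

end

lemma coeff_homI: "comm_ring_hom h \<Longrightarrow> coeff_hom h"
  by (simp add: coeff_hom_def)

lemma psubst_compose:
  assumes "comm_ring_hom g"
  shows "g (psubst h x p) = psubst (\<lambda>c. g (h c)) (\<lambda>v. g (x v)) p"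
proof -
  interpret comm_ring_hom g by fact
  show ?thesis by (simp add: psubst_def hom_sum hom_mult monomial_eval_hom[OF assms])
qed

text \<open>Together with \<open>psubst_compose\<close> this reduces identities between homomorphic
  images to constants and variables, in place of an induction over polynomials.\<close>

lemma psubst_Const_Var [simp]: "psubst Const Var p = (p :: ('v, 'a::comm_ring_1) mpoly)"
proof -
  have V: "Var v ^ k = Poly_Mapping.single (Poly_Mapping.single v k) (1::'a)" for v :: 'v and k
  proof (induction k)
    case (Suc k)
    have "(Var v :: ('v, 'a) mpoly) ^ Suc k = Var v * Poly_Mapping.single (Poly_Mapping.single v k) 1"
      using Suc by simp
    also have "\<dots> = Poly_Mapping.single (Poly_Mapping.single v (Suc k)) 1"
      unfolding Var_def mult_single by (simp flip: single_add)
    finally show ?case .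
  qed simp
  have S: "(\<Sum>v\<in>Poly_Mapping.keys \<alpha>. Poly_Mapping.single v (Poly_Mapping.lookup \<alpha> v)) = \<alpha>" for \<alpha> :: "'v monomial"
    by (rule poly_mapping_eqI) (auto simp: lookup_sum lookup_single when_def in_keys_iff)
  have P: "(\<Prod>v\<in>A. Poly_Mapping.single (f v) (1::'a)) = Poly_Mapping.single (\<Sum>v\<in>A. f v) 1"
    for f :: "'v \<Rightarrow> 'v monomial" and A
    by (induction A rule: infinite_finite_induct) (simp_all add: mult_single)
  have "monomial_eval Var \<alpha> = Poly_Mapping.single \<alpha> (1::'a)" for \<alpha> :: "'v monomial"
    unfolding monomial_eval_def V P S ..
  then show ?thesis
    by (simp add: psubst_def mult_single sum_single_keys)
qed

lemma psubst_cong: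
  assumes "\<And>v. v \<in> mpoly_vars p \<Longrightarrow> x v = y v"
  shows "psubst h x p = psubst h y p"
proof -
  have "monomial_eval x \<alpha> = monomial_eval y \<alpha>" if "\<alpha> \<in> Poly_Mapping.keys p" for \<alpha>
    unfolding monomial_eval_def by (rule prod.cong) (use assms that in \<open>force simp: mpoly_vars_def\<close>)+
  then show ?thesis by (simp add: psubst_def)
qed

lemma coeff_hom_id: "coeff_hom (\<lambda>c. c :: 'a::comm_ring_1)"
  by (simp add: coeff_hom_def) (unfold_locales, simp_all)

lemma mpoly_eval_hom: "comm_ring_hom (mpoly_eval x :: ('v, 'a::comm_ring_1) mpoly \<Rightarrow> 'a)"
  using coeff_hom.psubst_hom[OF coeff_hom_id, of x] by (simp add: mpoly_eval_eq_psubst[abs_def])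

interpretation ev: comm_ring_hom "mpoly_eval x :: ('v, 'a::comm_ring_1) mpoly \<Rightarrow> 'a" for x
  by (rule mpoly_eval_hom)

lemma mpoly_eval_Const [simp]: "mpoly_eval x (Const c) = (c :: 'a::comm_ring_1)"
  by (simp only: mpoly_eval_single monomial_eval_0 mult_1_right)

lemma mpoly_eval_Var [simp]: "mpoly_eval x (Var v) = (x v :: 'a::comm_ring_1)"
  by (simp add: Var_def mpoly_eval_single monomial_eval_single)

text \<open>Subrings of one global ring take the place of a separate ring for each set of variables,
  so an induction on the number of variables merely enlarges \<open>T\<close>.\<close>

definition polys :: "'v set \<Rightarrow> ('v, 'a::zero) mpoly set" where
  "polys T = {p. mpoly_vars p \<subseteq> T}"

lemma polys_iff: "p \<in> polys T \<longleftrightarrow> (\<forall>\<alpha>\<in>Poly_Mapping.keys p. Poly_Mapping.keys \<alpha> \<subseteq> T)"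
  by (auto simp: polys_def mpoly_vars_def)

lemma polys_mono: "S \<subseteq> T \<Longrightarrow> p \<in> polys S \<Longrightarrow> p \<in> polys T"
  by (auto simp: polys_def)

lemma polys_0 [simp]: "0 \<in> polys T"
  by (simp add: polys_def mpoly_vars_def)

lemma polys_single: "Poly_Mapping.keys \<alpha> \<subseteq> T \<Longrightarrow> Poly_Mapping.single \<alpha> c \<in> polys T"
  by (auto simp: polys_def mpoly_vars_def)

lemma polys_Const [simp]: "Const c \<in> polys T"
  by (simp add: polys_single)

lemma polys_1 [simp]: "(1 :: ('v, 'a::zero_neq_one) mpoly) \<in> polys T"
  using polys_Const[of "1::'a" T] by (simp only: single_one)

lemma polys_Var: "v \<in> T \<Longrightarrow> Var v \<in> polys T"
  by (auto simp: Var_def intro: polys_single)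

lemma polys_add: "p \<in> polys T \<Longrightarrow> q \<in> polys T \<Longrightarrow> p + q \<in> polys T"
  unfolding polys_iff using keys_add[of p q] by (metis UnE subsetD)

lemma polys_mult: "p \<in> polys T \<Longrightarrow> q \<in> polys T \<Longrightarrow> p * q \<in> polys T"
proof -
  assume pq: "p \<in> polys T" "q \<in> polys T"
  have "Poly_Mapping.keys \<gamma> \<subseteq> T" if \<gamma>: "\<gamma> \<in> Poly_Mapping.keys (p * q)" for \<gamma>
  proof -
    obtain \<alpha> \<beta> where "\<gamma> = \<alpha> + \<beta>" "\<alpha> \<in> Poly_Mapping.keys p" "\<beta> \<in> Poly_Mapping.keys q"
      using \<gamma> keys_mult[of p q] by auto
    then show ?thesis
      using pq keys_add[of \<alpha> \<beta>] unfolding polys_iff by (metis UnE subsetD subsetI)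
  qed
  then show ?thesis by (simp add: polys_iff)
qed

lemma polys_uminus: "p \<in> polys T \<Longrightarrow> - p \<in> polys T" for p :: "('v, 'a::comm_ring_1) mpoly"
proof -
  have "- p = Const (- 1) * p"
    unfolding single_uminus single_one by (rule mult_minus1[symmetric])
  then show "p \<in> polys T \<Longrightarrow> - p \<in> polys T" by (metis polys_mult polys_Const)
qed

lemma polys_diff: "p \<in> polys T \<Longrightarrow> q \<in> polys T \<Longrightarrow> p - q \<in> polys T" for p :: "('v, 'a::comm_ring_1) mpoly"
  using polys_add[of p T "- q"] polys_uminus[of q T] by simp

lemma polys_sum: "(\<And>a. a \<in> S \<Longrightarrow> p a \<in> polys T) \<Longrightarrow> (\<Sum>a\<in>S. p a) \<in> polys T"
  by (induction S rule: infinite_finite_induct) (auto intro: polys_add)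

lemma polys_prod: "(\<And>a. a \<in> S \<Longrightarrow> p a \<in> polys T) \<Longrightarrow> (\<Prod>a\<in>S. p a) \<in> polys T"
  by (induction S rule: infinite_finite_induct) (auto intro: polys_mult)

lemma polys_empty: "p \<in> polys {} \<Longrightarrow> \<exists>c. p = Const c"
proof -
  assume p: "p \<in> polys {}"
  have "Poly_Mapping.keys p \<subseteq> {0}"
    using p by (auto simp: polys_def mpoly_vars_def in_keys_iff intro!: poly_mapping_eqI)
  then have "p = Const (Poly_Mapping.lookup p 0)"
    by (intro poly_mapping_eqI) (auto simp: lookup_single when_def in_keys_iff)
  then show ?thesis ..
qed

section \<open>Polynomials in one distinguished variable\<close>

definition univar :: "'v \<Rightarrow> ('v, 'a) mpoly \<Rightarrow> ('v, 'a::comm_ring_1) mpoly poly" where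
  "univar x = psubst (\<lambda>c. [:Const c:]) (\<lambda>v. if v = x then [:0, 1:] else [:Var v:])"

lemma comm_ring_hom_pCst: "comm_ring_hom (\<lambda>c::'a::comm_ring_1. [:Const c :: ('v,'a) mpoly:])"
proof -
  interpret c: comm_ring_hom "Const :: 'a \<Rightarrow> ('v, 'a) mpoly" by (rule comm_ring_hom_Const)
  show ?thesis
    by unfold_locales (simp_all only: c.hom_add c.hom_mult c.hom_zero c.hom_one add_pCons mult_pCons_left
        mult_pCons_right smult_pCons smult_0_right mult_zero_left mult_zero_right pCons_0_0 add_0_right add_0_left one_pCons mult.commute)
qed

lemmas sp_psubst_hom = coeff_hom.psubst_hom[OF coeff_homI[OF comm_ring_hom_pCst]]
  and sp_psubst_Const = coeff_hom.psubst_Const[OF coeff_homI[OF comm_ring_hom_pCst]]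
  and sp_psubst_Var = coeff_hom.psubst_Var[OF coeff_homI[OF comm_ring_hom_pCst]]
  and sp_psubst_single = coeff_hom.psubst_single[OF coeff_homI[OF comm_ring_hom_pCst]]

lemma univar_hom: "comm_ring_hom (univar x)"
  unfolding univar_def by (rule sp_psubst_hom)

interpretation univar: comm_ring_hom "univar x :: ('v, 'a::comm_ring_1) mpoly \<Rightarrow> _" for x
  by (rule univar_hom)

lemma univar_Const [simp]: "univar x (Const c) = [:Const c:]"
  by (simp add: univar_def sp_psubst_Const)

lemma univar_Var: "univar x (Var v) = (if v = x then [:0, 1:] else [:Var v:])"
  by (simp add: univar_def sp_psubst_Var)

lemma comm_ring_hom_poly: "comm_ring_hom (\<lambda>p. poly p (a::'a::comm_ring_1))"
  by unfold_locales simp_all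

text \<open>The coefficients of \<open>univar x p\<close> lie in the same ring as \<open>p\<close>,
  so \<open>Var x\<close> can be substituted for the indeterminate. Hence \<open>univar x\<close> is
  injective and degrees and leading coefficients in \<open>x\<close> can be taken from the
  univariate theory.\<close>

lemma poly_univar:
  fixes p :: "('v, 'a::comm_ring_1) mpoly"
  shows "poly (univar x p) (Var x) = p"
proof -
  have "(\<lambda>v. poly (if v = x then [:0, 1:] else [:Var v :: ('v, 'a) mpoly:]) (Var x)) = Var"
    by (rule ext) simp
  then have "poly (univar x p) (Var x) = psubst Const Var p"
    unfolding univar_def psubst_compose[OF comm_ring_hom_poly] by simp
  then show ?thesis by simp
qed

lemma univar_eq_iff: "univar x p = univar x q \<longleftrightarrow> p = q"
  using poly_univar by metis

lemma univar_eq_0_iff [simp]: "univar x p = 0 \<longleftrightarrow> p = 0"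
  using univar_eq_iff[of x p 0] by simp

lemma univar_no_var:
  fixes p :: "('v, 'a::comm_ring_1) mpoly"
  assumes "x \<notin> mpoly_vars p"
  shows "univar x p = [:p:]"
proof -
  have h: "comm_ring_hom (\<lambda>q::('v,'a) mpoly. [:q:])"
    by unfold_locales simp_all
  have "univar x p = psubst (\<lambda>c. [:Const c:]) (\<lambda>v. [:Var v:]) p"
    unfolding univar_def by (rule psubst_cong) (use assms in auto)
  also have "\<dots> = [:psubst Const Var p:]"
    by (simp only: psubst_compose[OF h])
  finally show ?thesis by simp
qed

definition coeffs_in :: "'v set \<Rightarrow> ('v, 'a::comm_ring_1) mpoly poly \<Rightarrow> bool" where
  "coeffs_in T P \<longleftrightarrow> (\<forall>k. coeff P k \<in> polys T)"

lemma coeffs_in_mult: "coeffs_in T P \<Longrightarrow> coeffs_in T Q \<Longrightarrow> coeffs_in T (P * Q)"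
  by (simp add: coeffs_in_def coeff_mult polys_sum polys_mult)

lemma coeffs_in_1: "coeffs_in T 1"
  by (simp add: coeffs_in_def coeff_1)

lemma coeffs_in_power: "coeffs_in T P \<Longrightarrow> coeffs_in T (P ^ k)"
  by (induction k) (simp_all add: coeffs_in_1 coeffs_in_mult)

lemma coeffs_in_prod: "(\<And>a. a \<in> S \<Longrightarrow> coeffs_in T (P a)) \<Longrightarrow> coeffs_in T (\<Prod>a\<in>S. P a)"
  by (induction S rule: infinite_finite_induct) (simp_all add: coeffs_in_1 coeffs_in_mult)

lemma coeffs_in_pCons: "p \<in> polys T \<Longrightarrow> coeffs_in T P \<Longrightarrow> coeffs_in T (pCons p P)"
  by (simp add: coeffs_in_def coeff_pCons split: nat.split)

lemma coeffs_in_0: "coeffs_in T 0"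
  by (simp add: coeffs_in_def)

lemma coeff_univar_single:
  "coeff (univar x (Poly_Mapping.single \<alpha> c)) k \<in> polys (Poly_Mapping.keys \<alpha> - {x})"
proof -
  let ?X = "\<lambda>v. if v = x then [:0, 1:] else [:Var v:]"
  have "univar x (Poly_Mapping.single \<alpha> c) = [:Const c:] * (\<Prod>v\<in>Poly_Mapping.keys \<alpha>. ?X v ^ Poly_Mapping.lookup \<alpha> v)"
    by (simp add: univar_def sp_psubst_single monomial_eval_def)
  moreover have "coeffs_in (Poly_Mapping.keys \<alpha> - {x}) (?X v)" if "v \<in> Poly_Mapping.keys \<alpha>" for v
    using that by (simp add: coeffs_in_pCons coeffs_in_0 polys_Var)
  ultimately have "coeffs_in (Poly_Mapping.keys \<alpha> - {x}) (univar x (Poly_Mapping.single \<alpha> c))"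
    by (auto intro!: coeffs_in_mult coeffs_in_prod coeffs_in_power coeffs_in_pCons coeffs_in_0 polys_Const simp del: mult_pCons_left split del: if_split)
  then show ?thesis by (simp add: coeffs_in_def)
qed

lemma coeff_univar_polys:
  assumes "p \<in> polys T"
  shows "coeff (univar x p) k \<in> polys (T - {x})"
proof -
  have "coeff (univar x p) k = (\<Sum>\<alpha>\<in>Poly_Mapping.keys p. coeff (univar x (Poly_Mapping.single \<alpha> (Poly_Mapping.lookup p \<alpha>))) k)"
    by (subst (1) sum_single_keys[of p, symmetric]) (simp add: univar.hom_sum coeff_sum)
  also have "\<dots> \<in> polys (T - {x})"
    using assms by (intro polys_sum polys_mono[OF _ coeff_univar_single]) (auto simp: polys_def mpoly_vars_def)
  finally show ?thesis .
qed

definition deg_in :: "'v \<Rightarrow> ('v, 'a::comm_ring_1) mpoly \<Rightarrow> nat" where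
  "deg_in x p = degree (univar x p)"

lemma deg_in_no_var: "x \<notin> mpoly_vars p \<Longrightarrow> deg_in x p = 0"
  by (simp add: deg_in_def univar_no_var)

lemma deg_in_0_polys:
  assumes "p \<in> polys T" "deg_in x p = 0"
  shows "p \<in> polys (T - {x})"
proof -
  obtain q where q: "univar x p = [:q:]"
    using assms(2) unfolding deg_in_def by (metis degree_eq_zeroE)
  then have "p = q" using poly_univar[of x p] by simp
  moreover have "q \<in> polys (T - {x})"
    using coeff_univar_polys[OF assms(1), of x 0] q by simp
  ultimately show ?thesis by simp
qed

lemma deg_in_eq_0_iff: "deg_in x p = 0 \<longleftrightarrow> x \<notin> mpoly_vars p"
  using deg_in_0_polys[of p "mpoly_vars p" x] deg_in_no_var[of x p] by (auto simp: polys_def)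

text \<open>The linear order of the variables induces one on the monomials, through which the ring
  is recognised as a domain. Leading coefficients in \<open>x\<close> therefore do not
  cancel.\<close>

lemma deg_in_mult:
  fixes p q :: "('v::linorder, 'a::idom) mpoly"
  assumes "p \<noteq> 0" "q \<noteq> 0"
  shows "deg_in x (p * q) = deg_in x p + deg_in x q"
  using assms by (simp add: deg_in_def univar.hom_mult degree_mult_eq)

lemma mpoly_vars_mult:
  fixes p q :: "('v::linorder, 'a::idom) mpoly"
  assumes "p \<noteq> 0" "q \<noteq> 0"
  shows "mpoly_vars (p * q) = mpoly_vars p \<union> mpoly_vars q"
proof (rule Set.set_eqI)
  fix x
  show "x \<in> mpoly_vars (p * q) \<longleftrightarrow> x \<in> mpoly_vars p \<union> mpoly_vars q"
    using deg_in_mult[OF assms, of x] deg_in_eq_0_iff[of x p] deg_in_eq_0_iff[of x q] deg_in_eq_0_iff[of x "p * q"] by auto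
qed

text \<open>This makes irreducibility in the ring of all variables agree with irreducibility inside
  \<open>polys T\<close>.\<close>

lemma polys_factor:
  fixes p q :: "('v::linorder, 'a::idom) mpoly"
  assumes "p * q \<in> polys T" "p * q \<noteq> 0"
  shows "p \<in> polys T" "q \<in> polys T"
  using assms mpoly_vars_mult[of p q] by (auto simp: polys_def)

lemma mpoly_eval_cong:
  fixes p :: "('v, 'a::comm_ring_1) mpoly"
  assumes "p \<in> polys T" "\<And>v. v \<in> T \<Longrightarrow> x v = y v"
  shows "mpoly_eval x p = mpoly_eval y p"
  unfolding mpoly_eval_eq_psubst by (rule psubst_cong) (use assms in \<open>auto simp: polys_def\<close>)

lemma polys_vars: "p \<in> polys (mpoly_vars p)"
  by (simp add: polys_def)

lemma mpoly_eval_univar: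
  fixes p :: "('v, 'a::comm_ring_1) mpoly"
  shows "mpoly_eval (y(x := z)) p = (\<Sum>k\<le>deg_in x p. mpoly_eval y (coeff (univar x p) k) * z ^ k)"
proof -
  have "mpoly_eval (y(x := z)) (coeff (univar x p) k) = mpoly_eval y (coeff (univar x p) k)" for k
    by (rule mpoly_eval_cong[OF coeff_univar_polys[OF polys_vars]]) auto
  moreover have "p = (\<Sum>k\<le>deg_in x p. coeff (univar x p) k * Var x ^ k)"
    using poly_univar[of x p] by (simp only: poly_altdef deg_in_def)
  then have "mpoly_eval (y(x := z)) p = mpoly_eval (y(x := z)) (\<Sum>k\<le>deg_in x p. coeff (univar x p) k * Var x ^ k)"
    by (rule arg_cong)
  ultimately show ?thesis
    by (simp add: ev.hom_sum ev.hom_mult ev.hom_power)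
qed

text \<open>By induction the other variables can be given values at which some coefficient in
  \<open>x\<close> survives. The resulting univariate polynomial has finitely many roots, whereas a
  domain of characteristic zero is infinite.\<close>

lemma ex_mpoly_eval_nonzero:
  fixes p :: "('v, 'a::{idom, ring_char_0}) mpoly"
  assumes "finite T" "p \<in> polys T" "p \<noteq> 0"
  shows "\<exists>y. mpoly_eval y p \<noteq> 0"
  using assms
proof (induction T arbitrary: p rule: finite_induct)
  case empty
  then obtain c where "p = Const c" using polys_empty by blast
  then show ?case using empty by auto
next
  case (insert x T)
  obtain k where k: "coeff (univar x p) k \<noteq> 0"
    using insert.prems by (metis univar_eq_0_iff leading_coeff_0_iff)
  have "coeff (univar x p) k \<in> polys T"
    by (rule polys_mono[OF _ coeff_univar_polys[OF insert.prems(1)]]) auto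
  then obtain y where y: "mpoly_eval y (coeff (univar x p) k) \<noteq> 0"
    using insert.IH k by blast
  have kd: "k \<le> deg_in x p" using k by (simp add: deg_in_def le_degree)
  let ?q = "\<Sum>k\<le>deg_in x p. monom (mpoly_eval y (coeff (univar x p) k)) k"
  have "coeff ?q k \<noteq> 0" using y kd by (simp add: coeff_sum)
  then have "?q \<noteq> 0" by force
  then have "finite {t. poly ?q t = 0}" by (rule poly_roots_finite)
  then obtain t where t: "poly ?q t \<noteq> 0"
    using infinite_UNIV_char_0 by (metis (mono_tags, lifting) UNIV_I ex_new_if_finite mem_Collect_eq)
  have "mpoly_eval (y(x := t)) p = poly ?q t"
    by (simp add: mpoly_eval_univar poly_sum poly_monom)
  then show ?case using t by metis
qed

lemma finite_mpoly_vars: "finite (mpoly_vars p)"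
  by (simp add: mpoly_vars_def)

lemma mpoly_eqI:
  fixes p q :: "('v, 'a::{idom, ring_char_0}) mpoly"
  assumes "\<And>y. mpoly_eval y p = mpoly_eval y q"
  shows "p = q"
proof (rule ccontr)
  assume "p \<noteq> q"
  then have "p - q \<noteq> 0" by simp
  moreover have "p - q \<in> polys (mpoly_vars (p - q))" by (simp add: polys_def)
  ultimately obtain y where "mpoly_eval y (p - q) \<noteq> 0"
    using ex_mpoly_eval_nonzero[OF finite_mpoly_vars] by blast
  then show False using assms by (simp add: ev.hom_minus)
qed

section \<open>Unique factorization\<close>

definition lc :: "'v \<Rightarrow> ('v, 'a::comm_ring_1) mpoly \<Rightarrow> ('v, 'a) mpoly" where
  "lc x p = lead_coeff (univar x p)"

lemma lc_polys: "p \<in> polys T \<Longrightarrow> lc x p \<in> polys (T - {x})"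
  unfolding lc_def by (rule coeff_univar_polys)

lemma lc_nonzero: "p \<noteq> 0 \<Longrightarrow> lc x p \<noteq> 0"
  by (simp add: lc_def)

lemma deg_in_0_lc:
  fixes p :: "('v, 'a::comm_ring_1) mpoly"
  assumes "deg_in x p = 0"
  shows "lc x p = p"
proof -
  obtain q where "univar x p = [:q:]" using assms unfolding deg_in_def by (rule degree_eq_zeroE)
  then show ?thesis using poly_univar[of x p] by (simp add: lc_def)
qed

lemma univar_polys_no_var:
  fixes p :: "('v, 'a::comm_ring_1) mpoly"
  shows "p \<in> polys T \<Longrightarrow> x \<notin> T \<Longrightarrow> univar x p = [:p:]"
  by (rule univar_no_var) (auto simp: polys_def)

lemma deg_in_polys_no_var: "p \<in> polys T \<Longrightarrow> x \<notin> T \<Longrightarrow> deg_in x p = 0"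
  by (rule deg_in_no_var) (auto simp: polys_def)

lemma is_unit_mpoly:
  fixes p :: "('v::linorder, 'a::field) mpoly"
  assumes "p \<in> polys {}" "p \<noteq> 0"
  shows "p dvd 1"
proof -
  obtain c where c: "p = Const c" using polys_empty assms by blast
  then have "c \<noteq> 0" using assms by auto
  then have "p * Const (inverse c) = 1" using c by (simp add: mult_single)
  then show ?thesis by (metis dvdI)
qed

lemma mpoly_unit_polys:
  fixes p :: "('v::linorder, 'a::idom) mpoly"
  assumes "p dvd 1"
  shows "p \<in> polys {}"
proof -
  obtain q where q: "1 = p * q" using assms by auto
  then show ?thesis using polys_factor(1)[of p q "{}"] by (metis polys_1 zero_neq_one)
qed

lemma polys_power: "p \<in> polys T \<Longrightarrow> p ^ k \<in> polys T" for p :: "('v, 'a::comm_ring_1) mpoly"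
  by (induction k) (simp_all add: polys_mult)

text \<open>A substitute for the total degree: its additivity follows from the univariate case, without
  leading forms.\<close>

definition deg_sum :: "('v, 'a::comm_ring_1) mpoly \<Rightarrow> nat" where
  "deg_sum p = (\<Sum>x\<in>mpoly_vars p. deg_in x p)"

lemma deg_sum_superset: "finite T \<Longrightarrow> p \<in> polys T \<Longrightarrow> deg_sum p = (\<Sum>x\<in>T. deg_in x p)"
  unfolding deg_sum_def by (rule sum.mono_neutral_left) (auto simp: polys_def deg_in_eq_0_iff)

lemma deg_sum_mult:
  fixes p q :: "('v::linorder, 'a::idom) mpoly"
  assumes "p \<noteq> 0" "q \<noteq> 0"
  shows "deg_sum (p * q) = deg_sum p + deg_sum q"
proof -
  let ?T = "mpoly_vars p \<union> mpoly_vars q"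
  have "p \<in> polys ?T" "q \<in> polys ?T" "p * q \<in> polys ?T"
    by (auto simp: polys_def mpoly_vars_mult[OF assms])
  moreover have "finite ?T" by (simp add: finite_mpoly_vars)
  ultimately show ?thesis
    by (simp add: deg_sum_superset[of ?T] deg_in_mult[OF assms] sum.distrib)
qed

lemma deg_sum_eq_0: "deg_sum p = 0 \<Longrightarrow> p \<in> polys {}"
  unfolding deg_sum_def using finite_mpoly_vars[of p] deg_in_eq_0_iff[of _ p] by (fastforce simp: polys_def)

text \<open>A factorization into nonunits lowers \<open>deg_sum\<close>, because over a field a
  nonzero polynomial without variables is a unit.\<close>

lemma ex_irreducible_factor:
  fixes p :: "('v::linorder, 'a::field) mpoly"
  assumes "p \<noteq> 0" "\<not> p dvd 1"
  shows "\<exists>q r. p = q * r \<and> irreducible q"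
  using assms
proof (induction "deg_sum p" arbitrary: p rule: less_induct)
  case less
  show ?case
  proof (cases "irreducible p")
    case True
    then show ?thesis by (intro exI[of _ p] exI[of _ 1]) simp
  next
    case False
    then obtain a b where ab: "p = a * b" "\<not> a dvd 1" "\<not> b dvd 1"
      using less.prems unfolding irreducible_def by blast
    then have nz: "a \<noteq> 0" "b \<noteq> 0" using less.prems by auto
    have "deg_sum b > 0" using deg_sum_eq_0 is_unit_mpoly ab nz by blast
    then have "deg_sum a < deg_sum p" using deg_sum_mult[OF nz] ab by simp
    then obtain q r where "a = q * r" "irreducible q" using less.hyps nz ab by blast
    then show ?thesis using ab by (intro exI[of _ q] exI[of _ "r * b"]) (simp add: mult.assoc)
  qed
qed

section \<open>Primes in polynomial subrings and Gauss's lemma\<close>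

definition prime_in :: "'v set \<Rightarrow> ('v, 'a::comm_ring_1) mpoly \<Rightarrow> bool" where
  "prime_in T p \<longleftrightarrow> (\<forall>f\<in>polys T. \<forall>g\<in>polys T. p dvd f * g \<longrightarrow> p dvd f \<or> p dvd g)"

lemma dvd_no_var_iff:
  fixes p :: "('v, 'a::idom) mpoly"
  assumes "x \<notin> mpoly_vars p"
  shows "p dvd f \<longleftrightarrow> (\<forall>k. p dvd coeff (univar x f) k)"
proof
  assume "p dvd f"
  then obtain g where "f = p * g" by auto
  then have "univar x f = [:p:] * univar x g" using assms by (simp add: univar.hom_mult univar_no_var)
  then show "\<forall>k. p dvd coeff (univar x f) k" by simp
next
  assume r: "\<forall>k. p dvd coeff (univar x f) k"
  have "f = (\<Sum>k\<le>deg_in x f. coeff (univar x f) k * Var x ^ k)"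
    using poly_univar[of x f] by (simp only: poly_altdef deg_in_def)
  moreover have "p dvd \<dots>"
    using r by (intro dvd_sum dvd_mult2) auto
  ultimately show "p dvd f" by simp
qed

text \<open>Gauss's lemma. If \<open>i\<close> and \<open>j\<close> are the least indices of
  coefficients of \<open>f\<close> and \<open>g\<close> not divisible by \<open>p\<close>, then the
  coefficient of the product at \<open>i + j\<close> has exactly one summand that \<open>p\<close>
  might fail to divide.\<close>

lemma prime_in_insert:
  fixes p :: "('v, 'a::idom) mpoly"
  assumes "x \<notin> T" "p \<in> polys T" "prime_in T p"
  shows "prime_in (insert x T) p"
  unfolding prime_in_def
proof (intro ballI impI, rule ccontr)
  fix f g assume fg: "f \<in> polys (insert x T)" "g \<in> polys (insert x T)" "p dvd f * g" "\<not> (p dvd f \<or> p dvd g)"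
  have xp: "x \<notin> mpoly_vars p" using assms by (auto simp: polys_def)
  let ?f = "\<lambda>k. coeff (univar x f) k" and ?g = "\<lambda>k. coeff (univar x g) k"
  have T: "?f k \<in> polys T" "?g k \<in> polys T" for k
    using coeff_univar_polys[OF fg(1), of x k] coeff_univar_polys[OF fg(2), of x k]
    by (auto intro: polys_mono[rotated])
  have ex: "\<exists>k. \<not> p dvd ?f k" "\<exists>k. \<not> p dvd ?g k"
    using fg(4) dvd_no_var_iff[OF xp] by blast+
  define i where "i = (LEAST k. \<not> p dvd ?f k)"
  define j where "j = (LEAST k. \<not> p dvd ?g k)"
  have i: "\<not> p dvd ?f i" "\<And>k. k < i \<Longrightarrow> p dvd ?f k"
    unfolding i_def using LeastI_ex[OF ex(1)] not_less_Least by blast+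
  have j: "\<not> p dvd ?g j" "\<And>k. k < j \<Longrightarrow> p dvd ?g k"
    unfolding j_def using LeastI_ex[OF ex(2)] not_less_Least by blast+
  have "p dvd coeff (univar x (f * g)) (i + j)"
    using fg(3) dvd_no_var_iff[OF xp] by blast
  also have "coeff (univar x (f * g)) (i + j) = (\<Sum>k\<le>i + j. ?f k * ?g (i + j - k))"
    by (simp add: univar.hom_mult coeff_mult)
  also have "\<dots> = ?f i * ?g j + (\<Sum>k\<in>{..i + j} - {i}. ?f k * ?g (i + j - k))"
    by (subst sum.remove[of _ i]) auto
  finally have "p dvd ?f i * ?g j + (\<Sum>k\<in>{..i + j} - {i}. ?f k * ?g (i + j - k))" .
  moreover have "p dvd (\<Sum>k\<in>{..i + j} - {i}. ?f k * ?g (i + j - k))"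
  proof (rule dvd_sum)
    fix k assume k: "k \<in> {..i + j} - {i}"
    show "p dvd ?f k * ?g (i + j - k)"
    proof (cases "k < i")
      case True
      then show ?thesis using i(2) by (intro dvd_mult2)
    next
      case False
      then have "i + j - k < j" using k by auto
      then show ?thesis using j(2) by (intro dvd_mult)
    qed
  qed
  ultimately have "p dvd ?f i * ?g j" by (simp add: dvd_add_left_iff)
  then show False using assms(3) T i j unfolding prime_in_def by blast
qed

text \<open>Uniqueness of factorization is recorded as irreducible implies prime; existence is
  \<open>ex_irreducible_factor\<close>. The \<open>itself\<close> argument fixes the coefficient
  field, which \<open>T\<close> does not determine.\<close>

definition ufd_in :: "'v set \<Rightarrow> ('v, 'a::comm_ring_1) mpoly itself \<Rightarrow> bool" where
  "ufd_in T _ \<longleftrightarrow> (\<forall>p\<in>polys T. irreducible (p :: ('v, 'a) mpoly) \<longrightarrow> prime_in T p)"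

text \<open>Irreducible factors are peeled off \<open>a\<close>. Each is prime for \<open>T\<close>,
  remains so with \<open>x\<close> adjoined by Gauss's lemma, and so divides \<open>f\<close> or
  \<open>g\<close>. This does the work of contents and primitive parts.\<close>

lemma split_divisor:
  fixes a f g h :: "('v::linorder, 'a::field) mpoly"
  assumes "ufd_in T TYPE(('v, 'a) mpoly)" "x \<notin> T" "a \<in> polys T" "a \<noteq> 0"
    and "f \<in> polys (insert x T)" "g \<in> polys (insert x T)" "a * h = f * g"
  shows "\<exists>a1 a2 f' g'. a = a1 * a2 \<and> f = a1 * f' \<and> g = a2 * g'"
  using assms(3-)
proof (induction "deg_sum a" arbitrary: a f g h rule: less_induct)
  case less
  show ?case
  proof (cases "a dvd 1")
    case True
    then obtain b where b: "a * b = 1" by auto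
    have "a * (b * f) = f" using b by (simp flip: mult.assoc)
    then show ?thesis
      by (intro exI[of _ a] exI[of _ 1] exI[of _ "b * f"] exI[of _ g]) simp
  next
    case False
    then obtain q r where qr: "a = q * r" "irreducible q" using ex_irreducible_factor less.prems by blast
    have nz: "q \<noteq> 0" "r \<noteq> 0" using qr less.prems by auto
    have qT: "q \<in> polys T" and rT: "r \<in> polys T"
      using polys_factor[of q r T] qr less.prems by auto
    have "prime_in T q" using assms(1) qr qT unfolding ufd_in_def by blast
    then have pq: "prime_in (insert x T) q" using prime_in_insert[OF assms(2) qT] by simp
    have "\<not> q dvd 1" using qr(2) by (simp add: irreducible_def)
    then have "deg_sum q > 0" using deg_sum_eq_0[of q] is_unit_mpoly[of q] nz by auto
    then have lt: "deg_sum r < deg_sum a" using deg_sum_mult[OF nz] qr by simp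
    have "f * g = q * (r * h)" using less.prems(5) qr(1) by (simp add: mult.assoc)
    then have "q dvd f * g" by (rule dvdI)
    then consider "q dvd f" | "q dvd g" using pq less.prems(3,4) unfolding prime_in_def by meson
    then show ?thesis
    proof cases
      case 1
      then obtain f1 where f1: "f = q * f1" by auto
      have "r * h = f1 * g" using less.prems(5) qr f1 nz by (simp add: mult.assoc)
      moreover have "f1 \<in> polys (insert x T)"
        using less.prems(3) f1 polys_factor(2)[of q f1] by (cases "f1 = 0") (auto simp: nz)
      ultimately obtain a1 a2 f' g' where "r = a1 * a2" "f1 = a1 * f'" "g = a2 * g'"
        using less.hyps[OF lt rT nz(2)] less.prems by blast
      then show ?thesis using qr f1
        by (intro exI[of _ "q * a1"] exI[of _ a2] exI[of _ f'] exI[of _ g']) (simp add: mult_ac)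
    next
      case 2
      then obtain g1 where g1: "g = q * g1" by auto
      have "r * h = f * g1" using less.prems(5) qr g1 nz by (simp add: mult.left_commute mult.assoc)
      moreover have "g1 \<in> polys (insert x T)"
        using less.prems(4) g1 polys_factor(2)[of q g1] by (cases "g1 = 0") (auto simp: nz)
      ultimately obtain a1 a2 f' g' where "r = a1 * a2" "f = a1 * f'" "g1 = a2 * g'"
        using less.hyps[OF lt rT nz(2)] less.prems by blast
      then show ?thesis using qr g1
        by (intro exI[of _ a1] exI[of _ "q * a2"] exI[of _ f'] exI[of _ g']) (simp add: mult_ac)
    qed
  qed
qed

text \<open>The factors of \<open>a\<close> are distributed over \<open>f\<close> and its cofactor.
  The share of \<open>f\<close> must be a unit, since the rest of \<open>f\<close> keeps positive
  degree in \<open>x\<close> and \<open>f\<close> is irreducible.\<close>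

lemma irreducible_dvd_cancel:
  fixes a f g :: "('v::linorder, 'a::field) mpoly"
  assumes "ufd_in T TYPE(('v, 'a) mpoly)" "x \<notin> T" "a \<in> polys T" "a \<noteq> 0"
    and "f \<in> polys (insert x T)" "g \<in> polys (insert x T)" "irreducible f" "deg_in x f > 0" "f dvd a * g"
  shows "f dvd g"
proof (cases "g = 0")
  case False
  obtain h where h: "a * g = f * h" using assms by auto
  have nz: "f \<noteq> 0" "h \<noteq> 0" using h assms False by auto
  have "a * g \<in> polys (insert x T)" by (rule polys_mult[OF polys_mono[OF _ assms(3)] assms(6)]) auto
  then have hT: "h \<in> polys (insert x T)" using polys_factor(2)[of f h] h nz by (metis mult_eq_0_iff)
  obtain a1 a2 f' h' where s: "a = a1 * a2" "f = a1 * f'" "h = a2 * h'"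
    using split_divisor[OF assms(1-5) hT h] by blast
  have "a1 \<in> polys T" using polys_factor(1)[of a1 a2] s assms by auto
  then have "deg_in x a1 = 0" using deg_in_polys_no_var assms(2) by metis
  moreover have "f' \<noteq> 0" "a1 \<noteq> 0" using s nz by auto
  ultimately have "deg_in x f' > 0" using assms(8) s deg_in_mult[of a1 f' x] by simp
  then have "\<not> f' dvd 1"
    using mpoly_unit_polys[of f'] deg_in_polys_no_var[of f' "{}" x] by auto
  then have "a1 dvd 1" using assms(7) s unfolding irreducible_def by metis
  then obtain b where b: "1 = a1 * b" by auto
  have "a2 \<noteq> 0" using s assms by auto
  have "a2 * (a1 * g) = a2 * (f * h')" using h s by (simp add: mult_ac)
  then have "a1 * g = f * h'" using \<open>a2 \<noteq> 0\<close> by simp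
  have "g = b * (a1 * g)" using b by (simp flip: mult.assoc add: mult.commute)
  then have "g = f * (h' * b)" using \<open>a1 * g = f * h'\<close> by (simp add: mult_ac)
  then show ?thesis by (rule dvdI)
qed simp

text \<open>Euclidean division in \<open>x\<close> with denominators cleared: the factor
  \<open>a\<close> collects leading coefficients of \<open>s\<close>. Remainders stay in
  \<open>J\<close>, and by minimality of \<open>s\<close> the process can only end at zero.\<close>

lemma pseudo_divide:
  fixes s :: "('v::linorder, 'a::field) mpoly"
  assumes J: "\<And>p q. p \<in> J \<Longrightarrow> q \<in> J \<Longrightarrow> p - q \<in> J" "\<And>p q. p \<in> J \<Longrightarrow> q \<in> polys T \<Longrightarrow> q * p \<in> J"
      "J \<subseteq> polys T"
    and s: "s \<in> J" "s \<noteq> 0" "\<And>p. p \<in> J \<Longrightarrow> p \<noteq> 0 \<Longrightarrow> deg_in x s \<le> deg_in x p"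
    and x: "x \<in> T" and h: "h \<in> J"
  shows "\<exists>a q. a \<in> polys (T - {x}) \<and> a \<noteq> 0 \<and> q \<in> polys T \<and> a * h = q * s"
  using h
proof (induction "deg_in x h" arbitrary: h rule: less_induct)
  case less
  show ?case
  proof (cases "h = 0")
    case True
    then show ?thesis by (intro exI[of _ 1] exI[of _ 0]) simp
  next
    case False
    define k where "k = deg_in x h - deg_in x s"
    have dk: "deg_in x h = k + deg_in x s" using s(3)[OF less.prems False] by (simp add: k_def)
    have T: "s \<in> polys T" "h \<in> polys T" using s J less.prems by auto
    have l: "lc x s \<in> polys (T - {x})" "lc x h \<in> polys (T - {x})" by (rule lc_polys[OF T(1)], rule lc_polys[OF T(2)])
    have l': "lc x s \<in> polys T" "lc x h \<in> polys T" using l by (auto intro: polys_mono[rotated])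
    define q where "q = lc x h * Var x ^ k"
    have VT: "(Var x :: ('v, 'a) mpoly) ^ k \<in> polys T" for k by (rule polys_power[OF polys_Var[OF x]])
    have qT: "q \<in> polys T" unfolding q_def by (rule polys_mult[OF l'(2) VT])
    define h' where "h' = lc x s * h - q * s"
    have h'J: "h' \<in> J" unfolding h'_def by (rule J(1)[OF J(2)[OF less.prems l'(1)] J(2)[OF s(1) qT]])
    \<comment> \<open>In degree zero the degree cannot drop any further, but there \<open>h\<close>
      and \<open>s\<close> are their own leading coefficients and the difference \<open>h'\<close>
      is zero.\<close>
    have "h' = 0 \<or> deg_in x h' < deg_in x h"
    proof (cases "deg_in x h = 0")
      case True
      then have "k = 0" "deg_in x s = 0" using dk by auto
      then have "lc x h = h" "lc x s = s" using True by (simp_all add: deg_in_0_lc)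
      then have "h' = 0" unfolding h'_def q_def using \<open>k = 0\<close> by simp
      then show ?thesis ..
    next
      case False
      have sx: "univar x (lc x s) = [:lc x s:]" "univar x (lc x h) = [:lc x h:]"
        by (rule univar_polys_no_var[OF l(1)], simp, rule univar_polys_no_var[OF l(2)], simp)
      have Xk: "[:0, 1 :: ('v, 'a) mpoly:] ^ k = monom 1 k" by (simp add: monom_altdef)
      have e: "univar x h' = Polynomial.smult (lc x s) (univar x h) - monom (lc x h) k * univar x s"
        unfolding h'_def q_def by (simp add: univar.hom_minus univar.hom_mult univar.hom_power sx univar_Var Xk smult_monom)
      have "degree (univar x h') \<le> deg_in x h"
        unfolding e using dk lc_nonzero[OF s(2), of x]
        by (intro degree_diff_le order_trans[OF degree_mult_le])
           (auto simp: deg_in_def degree_monom_le intro: order_trans[OF degree_smult_le])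
      moreover have "coeff (univar x h') (deg_in x h) = 0"
        unfolding e using dk by (simp add: coeff_monom_mult lc_def deg_in_def)
      moreover have "degree (univar x h') \<noteq> deg_in x h" if "coeff (univar x h') (deg_in x h) = 0"
      proof
        assume d: "degree (univar x h') = deg_in x h"
        then have "univar x h' = 0" using that by (metis leading_coeff_0_iff)
        then show False using d False by simp
      qed
      ultimately have "deg_in x h' < deg_in x h" by (simp add: deg_in_def)
      then show ?thesis ..
    qed
    then have "\<exists>a q. a \<in> polys (T - {x}) \<and> a \<noteq> 0 \<and> q \<in> polys T \<and> a * h' = q * s"
    proof
      assume "h' = 0" then show ?thesis by (intro exI[of _ 1] exI[of _ 0]) simp
    next
      assume "deg_in x h' < deg_in x h" then show ?thesis using less.hyps h'J by blast
    qed
    then obtain a q' where a: "a \<in> polys (T - {x})" "a \<noteq> 0" "q' \<in> polys T" "a * h' = q' * s" by blast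
    show ?thesis
    proof (intro exI conjI)
      show "a * lc x s \<in> polys (T - {x})" by (rule polys_mult[OF a(1) l(1)])
      show "a * lc x s \<noteq> 0" using a lc_nonzero[OF s(2)] by simp
      have "a \<in> polys T" using a(1) by (auto intro: polys_mono[rotated])
      then show "q' + a * q \<in> polys T" by (rule polys_add[OF a(3) polys_mult[OF _ qT]])
      show "(a * lc x s) * h = (q' + a * q) * s"
        using a(4) unfolding h'_def by (simp add: algebra_simps)
    qed
  qed
qed

text \<open>The ideal generated by \<open>f\<close> and \<open>g\<close> either has a nonzero element free of \<open>x\<close>, or a nonzero
  element \<open>s\<close> of least positive degree in \<open>x\<close>. In the second case pseudo-division shows that \<open>s\<close>, up
  to factors free of \<open>x\<close>, divides both \<open>f\<close> and \<open>g\<close>.\<close>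

lemma irreducible_dvd_or_bezout:
  fixes f g :: "('v::linorder, 'a::field) mpoly"
  assumes U: "ufd_in T TYPE(('v, 'a) mpoly)" and xT: "x \<notin> T"
    and f: "f \<in> polys (insert x T)" "irreducible f" "deg_in x f > 0" and g: "g \<in> polys (insert x T)"
  shows "f dvd g \<or> (\<exists>a \<alpha> \<beta>. a \<in> polys T \<and> a \<noteq> 0 \<and> \<alpha> \<in> polys (insert x T) \<and> \<beta> \<in> polys (insert x T) \<and> a = \<alpha> * f + \<beta> * g)"
proof -
  let ?T = "insert x T"
  define J where "J = {\<alpha> * f + \<beta> * g | \<alpha> \<beta>. \<alpha> \<in> polys ?T \<and> \<beta> \<in> polys ?T}"
  have f0: "f \<noteq> 0" using f by auto
  have fJ: "f \<in> J" unfolding J_def by (rule CollectI, rule exI[of _ 1], rule exI[of _ 0]) simp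
  have gJ: "g \<in> J" unfolding J_def by (rule CollectI, rule exI[of _ 0], rule exI[of _ 1]) simp
  have J1: "p - q \<in> J" if pq: "p \<in> J" "q \<in> J" for p q
  proof -
    obtain a b c d where "p = a * f + b * g" "q = c * f + d * g" "a \<in> polys ?T" "b \<in> polys ?T" "c \<in> polys ?T" "d \<in> polys ?T"
      using pq unfolding J_def by blast
    then show ?thesis unfolding J_def
      by (intro CollectI exI[of _ "a - c"] exI[of _ "b - d"]) (simp add: algebra_simps polys_diff)
  qed
  have J2: "q * p \<in> J" if pq: "p \<in> J" "q \<in> polys ?T" for p q
  proof -
    obtain a b where "p = a * f + b * g" "a \<in> polys ?T" "b \<in> polys ?T"
      using pq unfolding J_def by blast
    then show ?thesis unfolding J_def using pq
      by (intro CollectI exI[of _ "q * a"] exI[of _ "q * b"]) (simp add: algebra_simps polys_mult)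
  qed
  have J3: "J \<subseteq> polys ?T"
    unfolding J_def using f g by (auto intro!: polys_add polys_mult)
  obtain s where s: "s \<in> J" "s \<noteq> 0" "\<And>p. p \<in> J \<Longrightarrow> p \<noteq> 0 \<Longrightarrow> deg_in x s \<le> deg_in x p"
    using ex_has_least_nat[of "\<lambda>p. p \<in> J \<and> p \<noteq> 0" f "deg_in x"] fJ f0 by blast
  have Tx: "?T - {x} = T" using xT by auto
  show ?thesis
  proof (cases "deg_in x s = 0")
    case True
    then have "s \<in> polys T" using deg_in_0_polys[of s ?T x] J3 s Tx by auto
    moreover obtain \<alpha> \<beta> where "s = \<alpha> * f + \<beta> * g" "\<alpha> \<in> polys ?T" "\<beta> \<in> polys ?T"
      using s(1) unfolding J_def by blast
    ultimately show ?thesis using s(2) by blast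
  next
    case False
    have div: "\<exists>a q. a \<in> polys T \<and> a \<noteq> 0 \<and> q \<in> polys ?T \<and> a * h = q * s" if "h \<in> J" for h
      using pseudo_divide[of J ?T s x, OF J1 J2 J3 s _ that] Tx by auto
    have sT: "s \<in> polys ?T" using s J3 by auto
    obtain a q where a: "a \<in> polys T" "a \<noteq> 0" "q \<in> polys ?T" "a * f = q * s" using div fJ by blast
    \<comment> \<open>The minimal element \<open>s\<close> may carry factors free of
      \<open>x\<close>. Splitting \<open>a\<close> collects them in \<open>a2\<close>, and what
      remains of \<open>s\<close> is an associate of \<open>f\<close>.\<close>
    obtain a1 a2 q1 s1 where d: "a = a1 * a2" "q = a1 * q1" "s = a2 * s1"
      using split_divisor[OF U xT a(1,2,3) sT a(4)] by blast
    have nz: "a1 \<noteq> 0" "a2 \<noteq> 0" "s1 \<noteq> 0" using d a s by auto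
    have "(a1 * a2) * f = (a1 * a2) * (q1 * s1)" using a(4) d by (simp add: mult_ac)
    then have f_eq: "f = q1 * s1" using nz by simp
    have "a2 \<in> polys T" using polys_factor(2)[of a1 a2] a d by auto
    then have "deg_in x a2 = 0" using deg_in_polys_no_var xT by metis
    then have "deg_in x s1 > 0" using False d deg_in_mult[OF nz(2,3), of x] by simp
    then have "\<not> s1 dvd 1" using mpoly_unit_polys[of s1] deg_in_polys_no_var[of s1 "{}" x] by auto
    then have "q1 dvd 1" using f(2) f_eq unfolding irreducible_def by metis
    then obtain r where r: "1 = q1 * r" by auto
    obtain b q' where b: "b \<in> polys T" "b \<noteq> 0" "b * g = q' * s" using div gJ by blast
    have "s1 = q1 * r * s1" using r by simp
    then have "s1 = f * r" using f_eq by (simp add: mult_ac)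
    then have "b * g = f * (q' * a2 * r)" using b d by (simp add: mult_ac)
    then have "f dvd b * g" by (rule dvdI)
    then have "f dvd g" using irreducible_dvd_cancel[OF U xT b(1,2) f(1) g f(2,3)] by blast
    then show ?thesis ..
  qed
qed

text \<open>If \<open>p\<close> involves the new variable and does not divide \<open>g\<close>, a
  nonzero \<open>x\<close>-free combination of \<open>p\<close> and \<open>g\<close> is multiplied
  by \<open>f\<close>, and its \<open>x\<close>-free factor is then cancelled: Euclid's argument
  over the fraction field.\<close>

theorem ufd_in_finite:
  assumes "finite T"
  shows "ufd_in T TYPE(('v::linorder, 'a::field) mpoly)"
  using assms
proof (induction T rule: finite_induct)
  case empty
  show ?case
    unfolding ufd_in_def
  proof (intro ballI impI)
    fix p :: "('v, 'a) mpoly" assume "p \<in> polys {}" "irreducible p"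
    then show "prime_in {} p" using is_unit_mpoly[of p] unfolding irreducible_def by auto
  qed
next
  case (insert x T)
  show ?case
    unfolding ufd_in_def
  proof (intro ballI impI)
    fix p :: "('v, 'a) mpoly" assume p: "p \<in> polys (insert x T)" "irreducible p"
    show "prime_in (insert x T) p"
    proof (cases "deg_in x p = 0")
      case True
      then have pT: "p \<in> polys T" using deg_in_0_polys[OF p(1), of x] insert.hyps by simp
      then have "prime_in T p" using insert.IH p(2) unfolding ufd_in_def by simp
      then show ?thesis by (rule prime_in_insert[OF insert.hyps(2) pT])
    next
      case False
      show ?thesis
        unfolding prime_in_def
      proof (intro ballI impI)
        fix f g assume fg: "f \<in> polys (insert x T)" "g \<in> polys (insert x T)" "p dvd f * g"
        show "p dvd f \<or> p dvd g"
        proof (rule disjCI)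
          assume "\<not> p dvd g"
          then obtain a \<alpha> \<beta> where a: "a \<in> polys T" "a \<noteq> 0" "a = \<alpha> * p + \<beta> * g"
            using irreducible_dvd_or_bezout[OF insert.IH insert.hyps(2) p _ fg(2)] False by blast
          have "a * f = p * (\<alpha> * f) + \<beta> * (f * g)" using a by (simp add: algebra_simps)
          then have "p dvd a * f" using fg(3) by simp
          then show "p dvd f"
            using irreducible_dvd_cancel[OF insert.IH insert.hyps(2) a(1,2) p(1) fg(1) p(2)] False by blast
        qed
      qed
    qed
  qed
qed

section \<open>Systems of forms with a nontrivial zero\<close>

definition monoms :: "nat \<Rightarrow> nat \<Rightarrow> nat monomial set" where
  "monoms n e = {\<alpha>. Poly_Mapping.keys \<alpha> \<subseteq> {1..n} \<and> monomial_degree \<alpha> = e}"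

lemma coeff_vars_eq: "coeff_vars n (\<lambda>_. e) = {1..n} \<times> monoms n e"
  by (auto simp: coeff_vars_def monoms_def)

lemma monomial_degree_superset:
  assumes "finite S" "Poly_Mapping.keys \<alpha> \<subseteq> S"
  shows "monomial_degree \<alpha> = (\<Sum>v\<in>S. Poly_Mapping.lookup \<alpha> v)"
  unfolding monomial_degree_def
  by (rule sum.mono_neutral_left) (use assms in \<open>auto simp: in_keys_iff\<close>)

lemma monomial_degree_add: "monomial_degree (\<alpha> + \<beta>) = monomial_degree \<alpha> + monomial_degree \<beta>"
proof -
  let ?S = "Poly_Mapping.keys \<alpha> \<union> Poly_Mapping.keys \<beta>"
  have "monomial_degree \<gamma> = (\<Sum>v\<in>?S. Poly_Mapping.lookup \<gamma> v)" if "\<gamma> \<in> {\<alpha>, \<beta>, \<alpha> + \<beta>}" for \<gamma>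
    by (rule monomial_degree_superset) (use that keys_add[of \<alpha> \<beta>] in auto)
  then show ?thesis by (simp add: lookup_add sum.distrib)
qed

lemma monomial_degree_single [simp]: "monomial_degree (Poly_Mapping.single v k) = k"
  by (simp add: monomial_degree_def)

lemma lookup_le_degree: "Poly_Mapping.lookup \<alpha> v \<le> monomial_degree \<alpha>"
proof (cases "v \<in> Poly_Mapping.keys \<alpha>")
  case True
  then show ?thesis unfolding monomial_degree_def by (intro member_le_sum) auto
qed (simp add: in_keys_iff)

lemma single_in_monoms: "v \<in> {1..n} \<Longrightarrow> Poly_Mapping.single v k \<in> monoms n k"
  by (auto simp: monoms_def)

lemma add_in_monoms: "\<alpha> \<in> monoms n k \<Longrightarrow> \<beta> \<in> monoms n l \<Longrightarrow> \<alpha> + \<beta> \<in> monoms n (k + l)"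
  using keys_add[of \<alpha> \<beta>] by (auto simp: monoms_def monomial_degree_add)

lemma finite_monoms [simp]: "finite (monoms n e)"
proof -
  have "finite {f. \<forall>x. (x \<in> {1..n} \<longrightarrow> f x \<in> {..e}) \<and> (x \<notin> {1..n} \<longrightarrow> f x = (0::nat))}"
    by (rule finite_set_of_finite_funs) auto
  moreover have "Poly_Mapping.lookup ` monoms n e \<subseteq> \<dots>"
    using lookup_le_degree by (auto simp: monoms_def in_keys_iff subset_iff)
  ultimately have "finite (Poly_Mapping.lookup ` monoms n e)" by (rule rev_finite_subset)
  then show ?thesis by (rule finite_imageD) (rule inj_onI, rule poly_mapping_eqI, simp)
qed

lemma finite_coeff_vars: "finite (coeff_vars n (\<lambda>_. e))"
  by (simp add: coeff_vars_eq)

definition form_eval :: "nat \<Rightarrow> nat \<Rightarrow> (nat monomial \<Rightarrow> complex) \<Rightarrow> (nat \<Rightarrow> complex) \<Rightarrow> complex" where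
  "form_eval n e g x = (\<Sum>\<alpha>\<in>monoms n e. g \<alpha> * monomial_eval x \<alpha>)"

lemma monomial_eval_cong:
  "(\<And>v. v \<in> Poly_Mapping.keys \<alpha> \<Longrightarrow> x v = y v) \<Longrightarrow> monomial_eval x \<alpha> = monomial_eval y \<alpha>"
  unfolding monomial_eval_def by (rule prod.cong) auto

lemma form_eval_cong: "(\<And>v. v \<in> {1..n} \<Longrightarrow> x v = y v) \<Longrightarrow> form_eval n e g x = form_eval n e g y"
  unfolding form_eval_def by (intro sum.cong arg_cong2[where f = "(*)"] monomial_eval_cong) (auto simp: monoms_def)

lemma form_eval_diff: "form_eval n e (\<lambda>\<alpha>. a * g \<alpha> - b * h \<alpha>) x = a * form_eval n e g x - b * form_eval n e h x"
  by (simp add: form_eval_def sum_subtractf sum_distrib_left left_diff_distrib mult.assoc)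

lemma form_eval_0 [simp]: "form_eval n e (\<lambda>_. 0) x = 0"
  by (simp add: form_eval_def)

lemma form_eval_indicator: "\<beta> \<in> monoms n e \<Longrightarrow> form_eval n e (\<lambda>\<alpha>. if \<alpha> = \<beta> then a else 0) x = a * monomial_eval x \<beta>"
  by (simp add: form_eval_def if_distrib if_distribR sum.If_cases cong: if_cong)

lemma monomial_eval_zero:
  assumes "\<alpha> \<in> monoms n e" "e \<ge> 1" "\<And>i. i \<in> {1..n} \<Longrightarrow> x i = 0"
  shows "monomial_eval x \<alpha> = (0::complex)"
proof -
  have "Poly_Mapping.keys \<alpha> \<noteq> {}" using assms by (auto simp: monoms_def monomial_degree_def)
  then obtain v where v: "v \<in> Poly_Mapping.keys \<alpha>" by blast
  then have "v \<in> {1..n}" using assms(1) unfolding monoms_def by blast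
  then have "x v = 0" by (rule assms(3))
  moreover have "Poly_Mapping.lookup \<alpha> v \<noteq> 0" using v by (simp add: in_keys_iff)
  ultimately have "x v ^ Poly_Mapping.lookup \<alpha> v = 0" by simp
  then show ?thesis unfolding monomial_eval_def using v by (intro prod_zero) auto
qed

text \<open>A system is coded by its coefficient function, a point of an affine space, so that
  polynomials in the coefficient variables are functions on systems.\<close>

definition solvable :: "nat \<Rightarrow> nat \<Rightarrow> (coeff_var \<Rightarrow> complex) set" where
  "solvable n e = {c. \<exists>x. (\<exists>i\<in>{1..n}. x i \<noteq> 0) \<and> (\<forall>i\<in>{1..n}. form_eval n e (\<lambda>\<alpha>. c (i, \<alpha>)) x = 0)}"

lemma solvable_cong:
  assumes "\<And>v. v \<in> coeff_vars n (\<lambda>_. e) \<Longrightarrow> c v = c' v"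
  shows "c \<in> solvable n e \<longleftrightarrow> c' \<in> solvable n e"
proof -
  have "form_eval n e (\<lambda>\<alpha>. c (i, \<alpha>)) x = form_eval n e (\<lambda>\<alpha>. c' (i, \<alpha>)) x" if "i \<in> {1..n}" for i x
    unfolding form_eval_def by (rule sum.cong) (use assms that in \<open>auto simp: coeff_vars_eq\<close>)
  then show ?thesis by (simp add: solvable_def cong: conj_cong)
qed

section \<open>Polynomial curves and the vanishing ideal\<close>

definition polyfun :: "(complex \<Rightarrow> complex) \<Rightarrow> bool" where
  "polyfun f \<longleftrightarrow> (\<exists>p. \<forall>t. f t = poly p t)"

lemma polyfun_const: "polyfun (\<lambda>t. a)"
  unfolding polyfun_def by (rule exI[of _ "[:a:]"]) simp

lemma polyfun_id: "polyfun (\<lambda>t. t)"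
  unfolding polyfun_def by (rule exI[of _ "[:0, 1:]"]) simp

lemma polyfun_add: "polyfun f \<Longrightarrow> polyfun g \<Longrightarrow> polyfun (\<lambda>t. f t + g t)"
  unfolding polyfun_def by (metis poly_add)

lemma polyfun_diff: "polyfun f \<Longrightarrow> polyfun g \<Longrightarrow> polyfun (\<lambda>t. f t - g t)"
  unfolding polyfun_def by (metis poly_diff)

lemma polyfun_mult: "polyfun f \<Longrightarrow> polyfun g \<Longrightarrow> polyfun (\<lambda>t. f t * g t)"
  unfolding polyfun_def by (metis poly_mult)

lemma polyfun_power: "polyfun f \<Longrightarrow> polyfun (\<lambda>t. f t ^ k)"
  unfolding polyfun_def by (metis poly_power)

lemma polyfun_sum: "(\<And>a. a \<in> S \<Longrightarrow> polyfun (f a)) \<Longrightarrow> polyfun (\<lambda>t. \<Sum>a\<in>S. f a t)"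
  by (induction S rule: infinite_finite_induct) (simp_all add: polyfun_const polyfun_add)

lemma polyfun_prod: "(\<And>a. a \<in> S \<Longrightarrow> polyfun (f a)) \<Longrightarrow> polyfun (\<lambda>t. \<Prod>a\<in>S. f a t)"
  by (induction S rule: infinite_finite_induct) (simp_all add: polyfun_const polyfun_mult)

lemma polyfun_mpoly_eval: "(\<And>v. polyfun (\<lambda>t. c t v)) \<Longrightarrow> polyfun (\<lambda>t. mpoly_eval (c t) P)"
  unfolding mpoly_eval_def monomial_eval_def
  by (intro polyfun_sum polyfun_mult polyfun_const polyfun_prod polyfun_power)

lemma polyfun_form_eval: "(\<And>\<alpha>. polyfun (\<lambda>t. g t \<alpha>)) \<Longrightarrow> (\<And>v. polyfun (\<lambda>t. x t v)) \<Longrightarrow> polyfun (\<lambda>t. form_eval n e (g t) (x t))"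
  unfolding form_eval_def monomial_eval_def
  by (intro polyfun_sum polyfun_mult polyfun_prod polyfun_power)

lemma polyfun_no_zero_divisors:
  assumes "polyfun f" "polyfun g" "\<And>t. f t * g t = 0"
  shows "(\<forall>t. f t = 0) \<or> (\<forall>t. g t = 0)"
proof -
  obtain p q where pq: "\<And>t. f t = poly p t" "\<And>t. g t = poly q t"
    using assms unfolding polyfun_def by blast
  then have "poly (p * q) t = 0" for t using assms(3) by simp
  then have "p * q = 0" using poly_all_0_iff_0 by blast
  then show ?thesis using pq by auto
qed

text \<open>Every system with a nontrivial zero \<open>x\<close> has the form \<open>q(x) g\<^sub>i - g\<^sub>i(x) q\<close>, so the set of these
  systems is the image of an affine space under a polynomial map. This is why its vanishing ideal
  is prime.\<close>

definition zpar :: "nat \<Rightarrow> nat \<Rightarrow> (coeff_var \<Rightarrow> complex) \<Rightarrow> (nat monomial \<Rightarrow> complex) \<Rightarrow> (nat \<Rightarrow> complex) \<Rightarrow> coeff_var \<Rightarrow> complex" where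
  "zpar n e g q x = (\<lambda>(i, \<alpha>). form_eval n e q x * g (i, \<alpha>) - form_eval n e (\<lambda>\<alpha>. g (i, \<alpha>)) x * q \<alpha>)"

text \<open>Either \<open>x\<close> is itself a nontrivial zero, or all forms of positive degree
  vanish at \<open>x\<close> and the formula yields the zero system. So the parameters may range
  over all values.\<close>

lemma zpar_in_solvable:
  assumes "n \<ge> 1" "e \<ge> 1"
  shows "zpar n e g q x \<in> solvable n e"
proof (cases "\<exists>i\<in>{1..n}. x i \<noteq> 0")
  case True
  moreover have "form_eval n e (\<lambda>\<alpha>. zpar n e g q x (i, \<alpha>)) x = 0" for i
    by (simp add: zpar_def form_eval_diff)
  ultimately show ?thesis by (auto simp: solvable_def)
next
  case False
  then have "monomial_eval x \<alpha> = 0" if "\<alpha> \<in> monoms n e" for \<alpha>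
    using monomial_eval_zero[OF that assms(2)] by blast
  then have "form_eval n e h x = 0" for h
    by (simp add: form_eval_def)
  then have "zpar n e g q x = (\<lambda>_. 0)" by (auto simp: zpar_def)
  then show ?thesis using assms by (auto simp: solvable_def intro!: exI[of _ "\<lambda>_. 1"] bexI[of _ 1])
qed

lemma solvable_eq_zpar:
  assumes "c \<in> solvable n e"
  shows "\<exists>q x. \<forall>v\<in>coeff_vars n (\<lambda>_. e). c v = zpar n e c q x v"
proof -
  obtain x j where x: "j \<in> {1..n}" "x j \<noteq> 0" "\<And>i. i \<in> {1..n} \<Longrightarrow> form_eval n e (\<lambda>\<alpha>. c (i, \<alpha>)) x = 0"
    using assms by (auto simp: solvable_def)
  \<comment> \<open>A form with value 1 at the zero \<open>x\<close>: the power of a nonvanishing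
    coordinate, normalised. With it and \<open>g = c\<close>, the formula returns
    \<open>c\<close>.\<close>
  let ?q = "\<lambda>\<alpha>. if \<alpha> = Poly_Mapping.single j e then inverse (x j ^ e) else 0"
  have "form_eval n e ?q x = 1"
    using x by (subst form_eval_indicator) (auto simp: single_in_monoms monomial_eval_single)
  then show ?thesis
    using x by (intro exI[of _ ?q] exI[of _ x]) (auto simp: zpar_def coeff_vars_eq)
qed

definition vanishing :: "nat \<Rightarrow> nat \<Rightarrow> (coeff_var, complex) mpoly set" where
  "vanishing n e = {P \<in> polys (coeff_vars n (\<lambda>_. e)). \<forall>c\<in>solvable n e. mpoly_eval c P = 0}"

text \<open>A solvable system where \<open>P\<close> is nonzero and one where \<open>Q\<close> is
  nonzero are joined by a curve of solvable systems, the image of a segment in parameter space. On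
  it \<open>P\<close> and \<open>Q\<close> become univariate polynomials whose product is
  zero.\<close>

lemma vanishing_prime:
  assumes "n \<ge> 1" "e \<ge> 1" and P: "P \<in> polys (coeff_vars n (\<lambda>_. e))" and Q: "Q \<in> polys (coeff_vars n (\<lambda>_. e))"
    and PQ: "P * Q \<in> vanishing n e"
  shows "P \<in> vanishing n e \<or> Q \<in> vanishing n e"
proof (rule ccontr)
  assume "\<not> ?thesis"
  then obtain c c' where c: "c \<in> solvable n e" "mpoly_eval c P \<noteq> 0" and c': "c' \<in> solvable n e" "mpoly_eval c' Q \<noteq> 0"
    using P Q by (auto simp: vanishing_def)
  obtain q x where q: "\<And>v. v \<in> coeff_vars n (\<lambda>_. e) \<Longrightarrow> c v = zpar n e c q x v" using solvable_eq_zpar[OF c(1)] by blast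
  obtain q' x' where q': "\<And>v. v \<in> coeff_vars n (\<lambda>_. e) \<Longrightarrow> c' v = zpar n e c' q' x' v" using solvable_eq_zpar[OF c'(1)] by blast
  define l where "l t = zpar n e (\<lambda>v. (1 - t) * c v + t * c' v) (\<lambda>\<alpha>. (1 - t) * q \<alpha> + t * q' \<alpha>)
    (\<lambda>i. (1 - t) * x i + t * x' i)" for t
  have l0: "mpoly_eval (l 0) P \<noteq> 0"
    using mpoly_eval_cong[OF P q] c(2) by (simp add: l_def)
  have l1: "mpoly_eval (l 1) Q \<noteq> 0"
    using mpoly_eval_cong[OF Q q'] c'(2) by (simp add: l_def)
  have lin: "polyfun (\<lambda>t. (1 - t) * a + t * b)" for a b
    by (intro polyfun_add polyfun_mult polyfun_diff polyfun_const polyfun_id)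
  have pl: "polyfun (\<lambda>t. l t v)" for v
    unfolding l_def zpar_def case_prod_unfold
    by (intro polyfun_diff polyfun_mult polyfun_form_eval lin)
  have "mpoly_eval (l t) P * mpoly_eval (l t) Q = 0" for t
    using PQ zpar_in_solvable[OF assms(1,2)] by (auto simp: vanishing_def l_def ev.hom_mult)
  then show False
    using polyfun_no_zero_divisors[OF polyfun_mpoly_eval[of l P, OF pl] polyfun_mpoly_eval[of l Q, OF pl]] l0 l1
    by blast
qed

text \<open>After multiplication by \<open>s ^ w\<close> the hypothesis is polynomial in
  \<open>s\<close>, and its value at \<open>s = 0\<close> is the part of weight \<open>w\<close>.
  The term \<open>s * z v\<close> disappears in this limit, which leaves room to correct a system so
  that it becomes solvable.\<close>

lemma weighted_limit:
  fixes P :: "('v, complex) mpoly" and wt :: "'v \<Rightarrow> nat" and y z :: "'v \<Rightarrow> complex"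
  assumes w: "\<And>\<mu>. \<mu> \<in> Poly_Mapping.keys P \<Longrightarrow> (\<Sum>v\<in>Poly_Mapping.keys \<mu>. wt v * Poly_Mapping.lookup \<mu> v) \<le> w"
    and 0: "\<And>s. s \<noteq> 0 \<Longrightarrow> mpoly_eval (\<lambda>v. (y v + s * z v) / s ^ wt v) P = 0"
  shows "(\<Sum>\<mu> | \<mu> \<in> Poly_Mapping.keys P \<and> (\<Sum>v\<in>Poly_Mapping.keys \<mu>. wt v * Poly_Mapping.lookup \<mu> v) = w.
     Poly_Mapping.lookup P \<mu> * monomial_eval y \<mu>) = 0"
proof -
  define wd where "wd \<mu> = (\<Sum>v\<in>Poly_Mapping.keys \<mu>. wt v * Poly_Mapping.lookup \<mu> v)" for \<mu>
  define f where "f s = (\<Sum>\<mu>\<in>Poly_Mapping.keys P. Poly_Mapping.lookup P \<mu> * s ^ (w - wd \<mu>) *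
    monomial_eval (\<lambda>v. y v + s * z v) \<mu>)" for s
  have f0: "f s = 0" if s: "s \<noteq> 0" for s
  proof -
    have "s ^ w * (Poly_Mapping.lookup P \<mu> * monomial_eval (\<lambda>v. (y v + s * z v) / s ^ wt v) \<mu>) =
       Poly_Mapping.lookup P \<mu> * s ^ (w - wd \<mu>) * monomial_eval (\<lambda>v. y v + s * z v) \<mu>"
      if "\<mu> \<in> Poly_Mapping.keys P" for \<mu>
    proof -
      have "s ^ w = s ^ (w - wd \<mu>) * s ^ wd \<mu>"
        using w[OF that] by (simp add: wd_def flip: power_add)
      moreover have "s ^ wd \<mu> * monomial_eval (\<lambda>v. (y v + s * z v) / s ^ wt v) \<mu> = monomial_eval (\<lambda>v. y v + s * z v) \<mu>"
        using s by (simp add: monomial_eval_def wd_def power_sum power_divide prod_dividef power_mult)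
      ultimately show ?thesis by (simp add: mult_ac)
    qed
    then have "f s = s ^ w * mpoly_eval (\<lambda>v. (y v + s * z v) / s ^ wt v) P"
      unfolding f_def mpoly_eval_def sum_distrib_left by (intro sum.cong refl) (simp only:)
    then show ?thesis using 0[OF s] by simp
  qed
  have "polyfun f"
    unfolding f_def monomial_eval_def
    by (intro polyfun_sum polyfun_mult polyfun_prod polyfun_power polyfun_const polyfun_id polyfun_add)
  \<comment> \<open>The product \<open>f s * s\<close> vanishes for every \<open>s\<close>, so
    \<open>f\<close> vanishes also at the origin.\<close>
  moreover have "polyfun (\<lambda>s. s)" by (rule polyfun_id)
  ultimately have "(\<forall>s. f s = 0) \<or> (\<forall>s::complex. s = 0)"
    by (rule polyfun_no_zero_divisors) (use f0 in auto)
  then have "f 0 = 0" by (metis one_neq_zero)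
  also have "f 0 = (\<Sum>\<mu>\<in>Poly_Mapping.keys P. if wd \<mu> = w then Poly_Mapping.lookup P \<mu> * monomial_eval y \<mu> else 0)"
    unfolding f_def
  proof (rule sum.cong[OF refl])
    fix \<mu> assume "\<mu> \<in> Poly_Mapping.keys P"
    then have "wd \<mu> \<le> w" using w by (simp add: wd_def)
    then show "Poly_Mapping.lookup P \<mu> * 0 ^ (w - wd \<mu>) * monomial_eval (\<lambda>v. y v + 0 * z v) \<mu> =
      (if wd \<mu> = w then Poly_Mapping.lookup P \<mu> * monomial_eval y \<mu> else 0)"
      by (auto simp: zero_power_eq)
  qed
  also have "\<dots> = (\<Sum>\<mu> | \<mu> \<in> Poly_Mapping.keys P \<and> wd \<mu> = w. Poly_Mapping.lookup P \<mu> * monomial_eval y \<mu>)"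
    by (simp add: sum.If_cases Int_def)
  finally show ?thesis by (simp add: wd_def)
qed

lemma Var_nonzero: "Var v \<noteq> (0 :: ('v, 'a::zero_neq_one) mpoly)"
proof
  assume "Var v = (0 :: ('v, 'a) mpoly)"
  then have "Poly_Mapping.lookup (Var v :: ('v, 'a) mpoly) (Poly_Mapping.single v 1) = 0" by simp
  then show False by (simp add: Var_def)
qed

lemma ex_complex_root:
  assumes "k \<ge> 1"
  shows "\<exists>x::complex. x ^ k = a"
  using nth_root_exists[of k a] assms by auto

text \<open>Give weight 1 to the coefficients of \<open>x\<^sub>i\<^sup>e\<close> and \<open>x\<^sub>n\<^sup>e\<close> in the form \<open>f\<^sub>i\<close>, \<open>i < n\<close>. When these
  coefficients dominate, the first \<open>n - 1\<close> equations decouple into \<open>a\<^sub>i x\<^sub>i\<^sup>e + b\<^sub>i x\<^sub>n\<^sup>e = 0\<close> with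
  arbitrary \<open>a\<^sub>i\<close> and \<open>b\<^sub>i\<close>, and the last equation only determines the excluded variable. So the part
  of top weight of \<open>P\<close> vanishes identically.\<close>

lemma vanishing_uses_last:
  assumes n: "n \<ge> 1" and e: "e \<ge> 1" and P: "P \<in> vanishing n e"
    and polys: "P \<in> polys (coeff_vars n (\<lambda>_. e) - {(n, Poly_Mapping.single n e)})"
  shows "P = 0"
proof (rule ccontr)
  assume P0: "P \<noteq> 0"
  let ?V = "coeff_vars n (\<lambda>_. e)"
  define \<delta> where "\<delta> i = Poly_Mapping.single i e" for i :: nat
  have \<delta>_monoms: "\<delta> i \<in> monoms n e" if "i \<in> {1..n}" for i using that by (simp add: \<delta>_def single_in_monoms)
  have \<delta>_inj: "\<delta> i = \<delta> j \<longleftrightarrow> i = j" for i j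
  proof
    assume "\<delta> i = \<delta> j"
    then have "Poly_Mapping.lookup (\<delta> i) i = Poly_Mapping.lookup (\<delta> j) i" by simp
    then show "i = j" using e by (simp add: \<delta>_def lookup_single when_def split: if_splits)
  qed simp
  define wt :: "coeff_var \<Rightarrow> nat" where
    "wt v = (if fst v < n \<and> (snd v = \<delta> (fst v) \<or> snd v = \<delta> n) then 1 else 0)" for v
  define wd where "wd \<mu> = (\<Sum>v\<in>Poly_Mapping.keys \<mu>. wt v * Poly_Mapping.lookup \<mu> v)" for \<mu>
  define w where "w = Max (wd ` Poly_Mapping.keys P)"
  have w_le: "wd \<mu> \<le> w" if "\<mu> \<in> Poly_Mapping.keys P" for \<mu>
    unfolding w_def using that by (intro Max_ge) auto
  define K where "K = {\<mu> \<in> Poly_Mapping.keys P. wd \<mu> = w}"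
  have "Poly_Mapping.keys P \<noteq> {}" using P0 by auto
  then have "w \<in> wd ` Poly_Mapping.keys P" unfolding w_def by (intro Max_in) auto
  then have K: "K \<noteq> {}" "finite K" by (auto simp: K_def)
  define Q where "Q = (\<Sum>\<mu>\<in>K. Poly_Mapping.single \<mu> (Poly_Mapping.lookup P \<mu>))"
  obtain \<mu>0 where \<mu>0: "\<mu>0 \<in> K" using K by blast
  have "Poly_Mapping.lookup Q \<mu>0 = Poly_Mapping.lookup P \<mu>0"
    using K \<mu>0 by (simp add: Q_def lookup_sum lookup_single when_def)
  moreover have "Poly_Mapping.lookup P \<mu>0 \<noteq> 0" using \<mu>0 by (simp add: K_def in_keys_iff)
  ultimately have Q0: "Q \<noteq> 0" by auto
  have QPV: "Q \<in> polys ?V"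
    unfolding Q_def using polys by (intro polys_sum polys_single) (auto simp: K_def polys_iff)
  have Qev: "mpoly_eval y Q = (\<Sum>\<mu>\<in>K. Poly_Mapping.lookup P \<mu> * monomial_eval y \<mu>)" for y
    by (simp add: Q_def mpoly_eval_sum mpoly_eval_single)
  \<comment> \<open>The factor \<open>A\<close> forces the chosen point to have nonzero pure power
    coefficients, by which the decoupled equations are divided.\<close>
  define A where "A = (\<Prod>i\<in>{1..<n}. Var (i, \<delta> i) :: (coeff_var, complex) mpoly)"
  have "A \<in> polys ?V"
    unfolding A_def using \<delta>_monoms by (intro polys_prod polys_Var) (auto simp: coeff_vars_eq)
  then have "Q * A \<in> polys ?V" using QPV by (intro polys_mult)
  moreover have "A \<noteq> 0"
    by (simp add: A_def Var_nonzero)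
  then have "Q * A \<noteq> 0" using Q0 by simp
  ultimately obtain y where y: "mpoly_eval y (Q * A) \<noteq> 0"
    using ex_mpoly_eval_nonzero[OF finite_coeff_vars] by blast
  have yQ: "mpoly_eval y Q \<noteq> 0" using y by (auto simp: ev.hom_mult)
  have "(\<Prod>i\<in>{1..<n}. y (i, \<delta> i)) \<noteq> 0" using y by (auto simp: ev.hom_mult A_def ev.hom_prod)
  then have ya: "y (i, \<delta> i) \<noteq> 0" if "i \<in> {1..<n}" for i using that by auto
  have "\<exists>x. \<forall>i\<in>{1..<n}. x i ^ e = - y (i, \<delta> n) / y (i, \<delta> i)"
    using ex_complex_root[OF e] by (intro bchoice ballI) blast
  then obtain x0 where x0: "\<And>i. i \<in> {1..<n} \<Longrightarrow> x0 i ^ e = - y (i, \<delta> n) / y (i, \<delta> i)" by blast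
  define x where "x i = (if i \<in> {1..<n} then x0 i else 1)" for i
  define r where "r i = (\<Sum>\<alpha>\<in>monoms n e - {\<delta> i, \<delta> n}. y (i, \<alpha>) * monomial_eval x \<alpha>)" for i
  \<comment> \<open>The correction of first order in \<open>s\<close>. Divided by \<open>s\<close>,
    it cancels exactly the contribution \<open>r\<close> of the monomials of weight zero.\<close>
  define z where "z v = (if snd v = \<delta> n \<and> fst v < n then - r (fst v) else 0)" for v :: coeff_var
  define c where "c s v = (if v = (n, \<delta> n) then - r n else (y v + s * z v) / s ^ wt v)" for s v
  have cZ: "c s \<in> solvable n e" if s: "s \<noteq> 0" for s
  proof -
    have "form_eval n e (\<lambda>\<alpha>. c s (i, \<alpha>)) x = 0" if i: "i \<in> {1..n}" for i
    proof (cases "i = n")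
      case True
      have "form_eval n e (\<lambda>\<alpha>. c s (i, \<alpha>)) x = c s (n, \<delta> n) * monomial_eval x (\<delta> n) +
         (\<Sum>\<alpha>\<in>monoms n e - {\<delta> n}. c s (n, \<alpha>) * monomial_eval x \<alpha>)"
        unfolding form_eval_def True using \<delta>_monoms n by (subst sum.remove[of _ "\<delta> n"]) auto
      also have "(\<Sum>\<alpha>\<in>monoms n e - {\<delta> n}. c s (n, \<alpha>) * monomial_eval x \<alpha>) = r n"
        unfolding r_def by (rule sum.cong) (auto simp: c_def z_def wt_def)
      also have "monomial_eval x (\<delta> n) = 1" by (simp add: \<delta>_def monomial_eval_single x_def)
      finally show ?thesis by (simp add: c_def)
    next
      case False
      then have i': "i \<in> {1..<n}" using i by auto
      have "form_eval n e (\<lambda>\<alpha>. c s (i, \<alpha>)) x = c s (i, \<delta> n) * monomial_eval x (\<delta> n) +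
         (c s (i, \<delta> i) * monomial_eval x (\<delta> i) +
         (\<Sum>\<alpha>\<in>monoms n e - {\<delta> n} - {\<delta> i}. c s (i, \<alpha>) * monomial_eval x \<alpha>))"
        unfolding form_eval_def using \<delta>_monoms[of n] \<delta>_monoms[OF i] n False
        by (subst sum.remove[of _ "\<delta> n"], simp, simp, subst sum.remove[of _ "\<delta> i"]) (auto simp: \<delta>_inj)
      also have "(\<Sum>\<alpha>\<in>monoms n e - {\<delta> n} - {\<delta> i}. c s (i, \<alpha>) * monomial_eval x \<alpha>) = r i"
        unfolding r_def using False by (intro sum.cong) (auto simp: c_def z_def wt_def)
      also have "monomial_eval x (\<delta> n) = 1" by (simp add: \<delta>_def monomial_eval_single x_def)
      also have "monomial_eval x (\<delta> i) = - y (i, \<delta> n) / y (i, \<delta> i)"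
        using x0[OF i'] i' by (simp add: \<delta>_def monomial_eval_single x_def)
      finally show ?thesis
        using False i' s ya[OF i'] by (simp add: c_def z_def wt_def \<delta>_inj field_simps)
    qed
    moreover have "x n \<noteq> 0" by (simp add: x_def)
    moreover have "n \<in> {1..n}" using n by simp
    ultimately show ?thesis unfolding solvable_def by blast
  qed
  have "(\<Sum>\<mu> | \<mu> \<in> Poly_Mapping.keys P \<and> (\<Sum>v\<in>Poly_Mapping.keys \<mu>. wt v * Poly_Mapping.lookup \<mu> v) = w.
     Poly_Mapping.lookup P \<mu> * monomial_eval y \<mu>) = 0"
  proof (rule weighted_limit[where z = z])
    fix s :: complex assume s: "s \<noteq> 0"
    have "mpoly_eval (\<lambda>v. (y v + s * z v) / s ^ wt v) P = mpoly_eval (c s) P"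
      by (rule mpoly_eval_cong[OF polys]) (auto simp: c_def \<delta>_def)
    then show "mpoly_eval (\<lambda>v. (y v + s * z v) / s ^ wt v) P = 0"
      using P cZ[OF s] by (simp add: vanishing_def)
  qed (use w_le in \<open>simp add: wd_def\<close>)
  then have "mpoly_eval y Q = 0" by (simp add: Qev K_def wd_def)
  then show False using yQ by simp
qed

section \<open>The Nullstellensatz and the elimination theorem\<close>

definition is_ideal :: "'a::comm_ring_1 set \<Rightarrow> bool" where
  "is_ideal J \<longleftrightarrow> 0 \<in> J \<and> (\<forall>a\<in>J. \<forall>b\<in>J. a + b \<in> J) \<and> (\<forall>a\<in>J. \<forall>r. r * a \<in> J)"

lemma is_ideal_0: "is_ideal J \<Longrightarrow> 0 \<in> J"
  and is_ideal_add: "is_ideal J \<Longrightarrow> a \<in> J \<Longrightarrow> b \<in> J \<Longrightarrow> a + b \<in> J"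
  and is_ideal_mult: "is_ideal J \<Longrightarrow> a \<in> J \<Longrightarrow> r * a \<in> J"
  by (simp_all add: is_ideal_def)

lemma is_ideal_diff: "is_ideal J \<Longrightarrow> a \<in> J \<Longrightarrow> b \<in> J \<Longrightarrow> a - b \<in> J"
  using is_ideal_add[of J a "(-1) * b"] is_ideal_mult[of J b "-1"] by simp

lemma is_ideal_sum: "is_ideal J \<Longrightarrow> (\<And>s. s \<in> S \<Longrightarrow> f s \<in> J) \<Longrightarrow> (\<Sum>s\<in>S. f s) \<in> J"
  by (induction S rule: infinite_finite_induct) (simp_all add: is_ideal_0 is_ideal_add)

definition is_ideal_plus :: "'a::comm_ring_1 set \<Rightarrow> 'a \<Rightarrow> 'a set" where
  "is_ideal_plus J y = {a + r * y | a r. a \<in> J}"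

lemma is_ideal_plusI: "a \<in> J \<Longrightarrow> z = a + r * y \<Longrightarrow> z \<in> is_ideal_plus J y"
  unfolding is_ideal_plus_def by blast

lemma is_ideal_plus:
  assumes "is_ideal J"
  shows "is_ideal (is_ideal_plus J y)" "J \<subseteq> is_ideal_plus J y" "y \<in> is_ideal_plus J y"
proof -
  show "is_ideal (is_ideal_plus J y)"
    unfolding is_ideal_def
  proof (intro conjI ballI allI)
    show "0 \<in> is_ideal_plus J y" by (rule is_ideal_plusI[OF is_ideal_0[OF assms], of _ 0]) simp
  next
    fix a b assume "a \<in> is_ideal_plus J y" "b \<in> is_ideal_plus J y"
    then obtain p q r s where *: "a = p + r * y" "b = q + s * y" "p \<in> J" "q \<in> J" unfolding is_ideal_plus_def by blast
    show "a + b \<in> is_ideal_plus J y"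
      by (rule is_ideal_plusI[OF is_ideal_add[OF assms *(3,4)], of _ "r + s"]) (simp add: * algebra_simps)
  next
    fix a t assume "a \<in> is_ideal_plus J y"
    then obtain p r where *: "a = p + r * y" "p \<in> J" unfolding is_ideal_plus_def by blast
    show "t * a \<in> is_ideal_plus J y"
      by (rule is_ideal_plusI[OF is_ideal_mult[OF assms *(2), of t], of _ "t * r"]) (simp add: * algebra_simps)
  qed
  show "J \<subseteq> is_ideal_plus J y"
  proof
    fix a assume "a \<in> J"
    then show "a \<in> is_ideal_plus J y" by (rule is_ideal_plusI[of _ _ _ 0]) simp
  qed
  show "y \<in> is_ideal_plus J y" by (rule is_ideal_plusI[OF is_ideal_0[OF assms], of _ 1]) simp
qed

text \<open>Gaussian elimination of the coordinate \<open>k\<close> with pivot \<open>b\<close>. The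
  vectors are arbitrary families, so coefficient families of polynomials can be inserted
  directly.\<close>

lemma linear_dependence:
  fixes f :: "'a \<Rightarrow> 'k \<Rightarrow> 'b::field"
  assumes "finite K" "finite S" "card K < card S"
  shows "\<exists>w. (\<exists>a\<in>S. w a \<noteq> 0) \<and> (\<forall>k\<in>K. (\<Sum>a\<in>S. w a * f a k) = 0)"
  using assms
proof (induction K arbitrary: S f rule: finite_induct)
  case empty
  then have "S \<noteq> {}" by auto
  then show ?case by (auto intro!: exI[of _ "\<lambda>_. 1"])
next
  case (insert k K)
  show ?case
  proof (cases "\<forall>a\<in>S. f a k = 0")
    case True
    have "card K < card S" using insert by simp
    then obtain w where "\<exists>a\<in>S. w a \<noteq> 0" "\<forall>k\<in>K. (\<Sum>a\<in>S. w a * f a k) = 0"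
      using insert.IH[OF insert.prems(1)] by blast
    then show ?thesis using True by (intro exI[of _ w]) simp
  next
    case False
    then obtain b where b: "b \<in> S" "f b k \<noteq> 0" by blast
    define g where "g a j = f a j - f a k / f b k * f b j" for a j
    have "finite (S - {b})" "card K < card (S - {b})" using insert b by simp_all
    then obtain w where w: "\<exists>a\<in>S - {b}. w a \<noteq> 0" "\<forall>j\<in>K. (\<Sum>a\<in>S - {b}. w a * g a j) = 0"
      using insert.IH[of "S - {b}" g] by blast
    define w' where "w' a = (if a = b then - (\<Sum>a\<in>S - {b}. w a * (f a k / f b k)) else w a)" for a
    have e: "(\<Sum>a\<in>S. w' a * f a j) = (\<Sum>a\<in>S - {b}. w a * g a j)" for j
    proof -
      have "(\<Sum>a\<in>S. w' a * f a j) = w' b * f b j + (\<Sum>a\<in>S - {b}. w' a * f a j)"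
        using b insert.prems by (subst sum.remove[of _ b]) auto
      also have "(\<Sum>a\<in>S - {b}. w' a * f a j) = (\<Sum>a\<in>S - {b}. w a * f a j)"
        by (rule sum.cong) (auto simp: w'_def)
      also have "w' b * f b j + \<dots> = (\<Sum>a\<in>S - {b}. w a * g a j)"
        by (simp add: w'_def g_def sum_distrib_right right_diff_distrib sum_subtractf mult.assoc)
      finally show ?thesis .
    qed
    have "(\<Sum>a\<in>S. w' a * f a j) = 0" if "j \<in> insert k K" for j
      using that w(2) b by (auto simp: e g_def)
    moreover have "\<exists>a\<in>S. w' a \<noteq> 0" using w(1) by (auto simp: w'_def)
    ultimately show ?thesis by blast
  qed
qed

text \<open>For a counting argument: there are only countably many finite sets that can be the
  support of a polynomial, but uncountably many complex scalars.\<close>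

lemma countable_monomials: "countable (UNIV :: ('v::countable) monomial set)"
proof -
  define gr where "gr \<alpha> = (\<lambda>v. (v, Poly_Mapping.lookup \<alpha> v)) ` Poly_Mapping.keys \<alpha>" for \<alpha> :: "'v monomial"
  have "inj gr"
  proof (rule injI)
    fix \<alpha> \<beta> assume eq: "gr \<alpha> = gr \<beta>"
    have m: "(v, k) \<in> gr \<gamma> \<longleftrightarrow> k \<noteq> 0 \<and> Poly_Mapping.lookup \<gamma> v = k" for v k \<gamma>
      by (auto simp: gr_def in_keys_iff)
    show "\<alpha> = \<beta>"
    proof (rule poly_mapping_eqI)
      fix v
      show "Poly_Mapping.lookup \<alpha> v = Poly_Mapping.lookup \<beta> v"
        using m[of v "Poly_Mapping.lookup \<alpha> v" \<alpha>] m[of v "Poly_Mapping.lookup \<alpha> v" \<beta>]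
          m[of v "Poly_Mapping.lookup \<beta> v" \<alpha>] m[of v "Poly_Mapping.lookup \<beta> v" \<beta>] eq by metis
    qed
  qed
  moreover have "countable (range gr)"
    by (rule countable_subset[OF _ countable_Collect_finite]) (auto simp: gr_def)
  ultimately show ?thesis by (rule countable_image_inj_on[rotated])
qed

lemma lookup_Const_mult: "Poly_Mapping.lookup (Const c * p) k = (c :: 'a::comm_semiring_1) * Poly_Mapping.lookup p k"
  unfolding mult_map_scale_conv_mult[symmetric] by (simp add: Poly_Mapping.map.rep_eq when_def)

definition usub :: "'v \<Rightarrow> complex poly \<Rightarrow> ('v, complex) mpoly" where
  "usub v p = poly (map_poly Const p) (Var v)"

lemma usub_pCons: "usub v (pCons a p) = Const a + Var v * usub v p"
  by (simp add: usub_def map_poly_pCons)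

lemma usub_0 [simp]: "usub v 0 = 0"
  by (simp add: usub_def)

lemma usub_add: "usub v (p + q) = usub v p + usub v q"
  by (induction p q rule: poly_induct2) (simp_all add: usub_pCons single_add algebra_simps)

lemma usub_smult: "usub v (Polynomial.smult c p) = Const c * usub v p"
  by (induction p) (simp_all add: usub_pCons mult_single algebra_simps)

lemma usub_linear_mult: "usub v ([:- r, 1:] * p) = (Var v - Const r) * usub v p"
proof -
  have "[:- r, 1:] * p = Polynomial.smult (- r) p + pCons 0 p" by simp
  then show ?thesis
    by (simp only: usub_add usub_smult usub_pCons) (simp add: single_uminus algebra_simps)
qed

lemma usub_prod: "usub v (\<Prod>b\<in>S. [:- b, 1:]) = (\<Prod>b\<in>S. Var v - Const b)"
proof (induction S rule: infinite_finite_induct)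
  case (insert b S)
  then show ?case unfolding prod.insert[OF insert.hyps] usub_linear_mult by (simp only:)
qed (simp_all add: usub_pCons one_pCons)

lemma usub_sum: "usub v (\<Sum>a\<in>S. p a) = (\<Sum>a\<in>S. usub v (p a))"
  by (induction S rule: infinite_finite_induct) (simp_all add: usub_add)

text \<open>If every \<open>X - a\<close> were invertible modulo the ideal, the uncountably many inverses would be
  linearly dependent, which yields a nonzero univariate polynomial in the ideal.\<close>

lemma is_ideal_extend:
  fixes J :: "(nat, complex) mpoly set"
  assumes J: "is_ideal J" "1 \<notin> J"
  shows "\<exists>a. 1 \<notin> is_ideal_plus J (Var v - Const a)"
proof (rule ccontr)
  assume "\<not> ?thesis"
  then have *: "\<forall>a. \<exists>j r. j \<in> J \<and> 1 = j + r * (Var v - Const a)" unfolding is_ideal_plus_def by blast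
  have "\<forall>a. \<exists>r. r * (Var v - Const a) - 1 \<in> J"
  proof (intro allI)
    fix a
    obtain j r where jr: "j \<in> J" "1 = j + r * (Var v - Const a)" using * by blast
    have "(- 1) * j \<in> J" by (rule is_ideal_mult[OF J(1) jr(1)])
    moreover have "(- 1) * j = r * (Var v - Const a) - 1" using jr(2) by (simp add: algebra_simps)
    ultimately have "r * (Var v - Const a) - 1 \<in> J" by simp
    then show "\<exists>r. r * (Var v - Const a) - 1 \<in> J" ..
  qed
  then obtain q where q: "\<And>a. q a * (Var v - Const a) - 1 \<in> J" by metis
  \<comment> \<open>Countably many supports cannot each occur for only finitely many of the
    uncountably many \<open>a\<close>. So infinitely many inverses lie in one space of dimension
    \<open>card K\<close>.\<close>
  have "\<exists>K. infinite {a. Poly_Mapping.keys (q a) = K}"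
  proof (rule ccontr)
    assume "\<nexists>K. infinite {a. Poly_Mapping.keys (q a) = K}"
    then have f: "countable {a. Poly_Mapping.keys (q a) = K}" for K by (simp add: countable_finite)
    have "countable (\<Union>K\<in>Collect finite. {a. Poly_Mapping.keys (q a) = K})"
    proof (rule countable_UN)
      have "countable {A. finite A \<and> A \<subseteq> (UNIV :: nat monomial set)}"
        by (rule countable_Collect_finite_subset[OF countable_monomials])
      then show "countable (Collect finite :: nat monomial set set)" by simp
    qed (rule f)
    moreover have "(\<Union>K\<in>Collect finite. {a. Poly_Mapping.keys (q a) = K}) = UNIV"
    proof (rule UNIV_eq_I[symmetric])
      fix a
      show "a \<in> (\<Union>K\<in>Collect finite. {a. Poly_Mapping.keys (q a) = K})"
        by (rule UN_I[of "Poly_Mapping.keys (q a)"]) simp_all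
    qed
    ultimately show False using uncountable_UNIV_complex by simp
  qed
  then obtain K where K: "infinite {a. Poly_Mapping.keys (q a) = K}" by blast
  then have "{a. Poly_Mapping.keys (q a) = K} \<noteq> {}" by (metis finite.emptyI)
  then obtain a where "Poly_Mapping.keys (q a) = K" by blast
  then have "finite K" using finite_keys[of "q a"] by simp
  obtain S where S: "S \<subseteq> {a. Poly_Mapping.keys (q a) = K}" "finite S" "card S = Suc (card K)"
    using infinite_arbitrarily_large[OF K, of "Suc (card K)"] by blast
  obtain w where w: "\<exists>a\<in>S. w a \<noteq> 0" "\<forall>k\<in>K. (\<Sum>a\<in>S. w a * Poly_Mapping.lookup (q a) k) = 0"
    using linear_dependence[OF \<open>finite K\<close> S(2), of "\<lambda>a. Poly_Mapping.lookup (q a)"] S(3) by auto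
  have comb: "(\<Sum>a\<in>S. Const (w a) * q a) = 0"
  proof (rule poly_mapping_eqI)
    fix k
    have "Poly_Mapping.lookup (\<Sum>a\<in>S. Const (w a) * q a) k = (\<Sum>a\<in>S. w a * Poly_Mapping.lookup (q a) k)"
      by (simp add: lookup_sum lookup_Const_mult)
    also have "\<dots> = 0"
    proof (cases "k \<in> K")
      case False
      then have "Poly_Mapping.lookup (q a) k = 0" if "a \<in> S" for a using S that by (auto simp: in_keys_iff)
      then show ?thesis by simp
    qed (use w in simp)
    finally show "Poly_Mapping.lookup (\<Sum>a\<in>S. Const (w a) * q a) k = Poly_Mapping.lookup 0 k" by simp
  qed
  define X :: "(nat, complex) mpoly" where "X = Var v"
  \<comment> \<open>Modulo \<open>J\<close> each \<open>q a\<close> is an inverse of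
    \<open>X - a\<close>. Multiplying the dependence by all \<open>X - b\<close> with
    \<open>b\<close> in \<open>S\<close> therefore turns it into \<open>G\<close>, which is nonzero
    at \<open>a0\<close>.\<close>
  define G where "G = (\<Sum>a\<in>S. Polynomial.smult (w a) (\<Prod>b\<in>S - {a}. [:- b, 1:]))"
  obtain a0 where a0: "a0 \<in> S" "w a0 \<noteq> 0" using w by blast
  have "poly G a0 = (\<Sum>a\<in>S. if a = a0 then w a0 * (\<Prod>b\<in>S - {a0}. a0 - b) else 0)"
    unfolding G_def poly_sum
  proof (rule sum.cong[OF refl])
    fix a assume a: "a \<in> S"
    show "poly (Polynomial.smult (w a) (\<Prod>b\<in>S - {a}. [:- b, 1:])) a0 = (if a = a0 then w a0 * (\<Prod>b\<in>S - {a0}. a0 - b) else 0)"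
    proof (cases "a = a0")
      case False
      then have "a0 \<in> S - {a}" using a0 by simp
      then show ?thesis using False S(2) by (auto simp: poly_prod intro!: prod_zero)
    qed (simp add: poly_prod)
  qed
  also have "\<dots> = w a0 * (\<Prod>b\<in>S - {a0}. a0 - b)" using a0 S(2) by simp
  also have "\<dots> \<noteq> 0" using a0 S(2) by auto
  finally have G0: "G \<noteq> 0" by auto
  have GJ: "usub v G \<in> J"
  proof -
    have uG: "usub v G = (\<Sum>a\<in>S. Const (w a) * (\<Prod>b\<in>S - {a}. X - Const b))"
      by (simp add: G_def usub_sum usub_smult usub_prod X_def)
    have "0 = (\<Prod>b\<in>S. X - Const b) * (\<Sum>a\<in>S. Const (w a) * q a)" by (simp add: comb)
    also have "\<dots> = (\<Sum>a\<in>S. Const (w a) * (\<Prod>b\<in>S - {a}. X - Const b) * (q a * (X - Const a)))"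
      unfolding sum_distrib_left
    proof (rule sum.cong[OF refl])
      fix a assume "a \<in> S"
      then have "(\<Prod>b\<in>S. X - Const b) = (X - Const a) * (\<Prod>b\<in>S - {a}. X - Const b)"
        using S(2) by (subst prod.remove[of _ a]) auto
      then show "(\<Prod>b\<in>S. X - Const b) * (Const (w a) * q a) = Const (w a) * (\<Prod>b\<in>S - {a}. X - Const b) * (q a * (X - Const a))"
        by (simp add: mult_ac)
    qed
    finally have "usub v G = usub v G - (\<Sum>a\<in>S. Const (w a) * (\<Prod>b\<in>S - {a}. X - Const b) * (q a * (X - Const a)))" by simp
    also have "\<dots> = (\<Sum>a\<in>S. (- Const (w a) * (\<Prod>b\<in>S - {a}. X - Const b)) * (q a * (X - Const a) - 1))"
      unfolding uG sum_subtractf[symmetric] by (rule sum.cong) (simp_all add: algebra_simps)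
    also have "\<dots> \<in> J"
      using q by (intro is_ideal_sum[OF J(1)] is_ideal_mult[OF J(1)]) (simp add: X_def)
    finally show ?thesis .
  qed
  \<comment> \<open>Over the complex numbers \<open>p\<close> splits into linear factors. Each one
    is cancelled with its inverse modulo \<open>J\<close>, until a nonzero constant is left in
    \<open>J\<close>.\<close>
  have "1 \<in> J" if "p \<noteq> 0" "usub v p \<in> J" for p
    using that
  proof (induction "degree p" arbitrary: p)
    case 0
    then obtain c where c: "p = [:c:]" by (metis degree_eq_zeroE)
    then have "Const (inverse c) * Const c = (1 :: (nat, complex) mpoly)" using 0 by (simp add: mult_single)
    moreover have "usub v p = Const c" using c by (simp add: usub_pCons)
    ultimately show ?case using is_ideal_mult[OF J(1) 0(3), of "Const (inverse c)"] by simp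
  next
    case (Suc k)
    then have "\<not> constant (poly p)" by (simp add: constant_degree)
    then obtain r where "poly p r = 0" using fundamental_theorem_of_algebra by blast
    then obtain p' where p': "p = [:- r, 1:] * p'" by (auto simp: poly_eq_0_iff_dvd)
    have p'0: "p' \<noteq> 0" using p' Suc by auto
    have "degree p = Suc (degree p')" using p' p'0 by (simp add: degree_mult_eq del: mult_pCons_left)
    then have d: "k = degree p'" using Suc by simp
    have "usub v p' = q r * usub v p - usub v p' * (q r * (X - Const r) - 1)"
      unfolding p' usub_linear_mult X_def by (simp add: algebra_simps)
    also have "\<dots> \<in> J"
      by (rule is_ideal_diff[OF J(1) is_ideal_mult[OF J(1) Suc.prems(2)] is_ideal_mult[OF J(1)]]) (simp add: X_def q)
    finally show ?case using Suc.hyps(1)[OF d p'0] by simp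
  qed
  then show False using J G0 GJ by blast
qed

text \<open>A finite substitute for passing to a maximal ideal: the variables of \<open>T\<close>
  receive their values one at a time while the ideal stays proper.\<close>

lemma is_ideal_point:
  fixes J :: "(nat, complex) mpoly set"
  assumes "finite T" "is_ideal J" "1 \<notin> J"
  shows "\<exists>J' x. is_ideal J' \<and> J \<subseteq> J' \<and> 1 \<notin> J' \<and> (\<forall>v\<in>T. Var v - Const (x v) \<in> J')"
  using assms
proof (induction T rule: finite_induct)
  case empty
  then show ?case by blast
next
  case (insert v T)
  then obtain J' x where J': "is_ideal J'" "J \<subseteq> J'" "1 \<notin> J'" "\<forall>v\<in>T. Var v - Const (x v) \<in> J'" by blast
  obtain a where a: "1 \<notin> is_ideal_plus J' (Var v - Const a)" using is_ideal_extend J' by blast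
  let ?J = "is_ideal_plus J' (Var v - Const a)"
  have "\<forall>u\<in>insert v T. Var u - Const ((x(v := a)) u) \<in> ?J"
    using J'(4) is_ideal_plus[OF J'(1)] insert.hyps by auto
  then show ?case using a J'(2) is_ideal_plus[OF J'(1), of "Var v - Const a"] by blast
qed

text \<open>Modulo the enlarged ideal every polynomial in \<open>polys T\<close> equals the constant
  given by its value at \<open>x\<close>. A member with nonzero value would put a unit into that
  proper ideal.\<close>

theorem nullstellensatz:
  fixes J :: "(nat, complex) mpoly set"
  assumes "finite T" "is_ideal J" "1 \<notin> J"
  shows "\<exists>x. \<forall>p\<in>J \<inter> polys T. mpoly_eval x p = 0"
proof -
  obtain J' x where J': "is_ideal J'" "J \<subseteq> J'" "1 \<notin> J'" "\<And>v. v \<in> T \<Longrightarrow> Var v - Const (x v) \<in> J'"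
    using is_ideal_point[OF assms] by blast
  define C where "C p \<longleftrightarrow> p - Const (mpoly_eval x p) \<in> J'" for p
  have C_Const: "C (Const c)" for c using is_ideal_0[OF J'(1)] by (simp add: C_def)
  have C_Var: "C (Var v)" if "v \<in> T" for v using J'(4) that by (simp add: C_def)
  have C_add: "C (p + q)" if "C p" "C q" for p q
    using is_ideal_add[OF J'(1) that[unfolded C_def]] by (simp add: C_def ev.hom_add single_add algebra_simps)
  have C_mult: "C (p * q)" if "C p" "C q" for p q
  proof -
    have "p * q - Const (mpoly_eval x (p * q)) = q * (p - Const (mpoly_eval x p)) + Const (mpoly_eval x p) * (q - Const (mpoly_eval x q))"
      by (simp add: ev.hom_mult algebra_simps mult_single)
    then show ?thesis using is_ideal_add[OF J'(1) is_ideal_mult[OF J'(1)] is_ideal_mult[OF J'(1)]] that unfolding C_def by simp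
  qed
  have C_1: "C 1" using C_Const[of 1] by simp
  have C_0: "C 0" using C_Const[of 0] by simp
  have C_power: "C (p ^ k)" if "C p" for p k
    by (induction k) (simp_all add: C_1 C_mult that)
  have C_prod: "C (\<Prod>a\<in>S. f a)" if "\<And>a. a \<in> S \<Longrightarrow> C (f a)" for S :: "nat set" and f
    using that by (induction S rule: infinite_finite_induct) (simp_all add: C_1 C_mult)
  have C_sum: "C (\<Sum>a\<in>S. f a)" if "\<And>a. a \<in> S \<Longrightarrow> C (f a)" for S :: "nat monomial set" and f
    using that by (induction S rule: infinite_finite_induct) (simp_all add: C_0 C_add)
  have C_all: "C p" if p: "p \<in> polys T" for p
  proof -
    have "C (psubst Const Var p)"
      unfolding psubst_def monomial_eval_def
    proof (intro C_sum C_mult C_Const C_prod C_power C_Var)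
      fix \<alpha> v assume "\<alpha> \<in> Poly_Mapping.keys p" "v \<in> Poly_Mapping.keys \<alpha>"
      then show "v \<in> T" using p by (auto simp: polys_iff)
    qed
    then show ?thesis by simp
  qed
  have "mpoly_eval x p = 0" if p: "p \<in> J" "p \<in> polys T" for p
  proof (rule ccontr)
    assume nz: "mpoly_eval x p \<noteq> 0"
    have "Const (mpoly_eval x p) \<in> J'"
      using is_ideal_diff[OF J'(1) _ C_all[OF p(2), unfolded C_def], of p] p J'(2) by auto
    then have "Const (inverse (mpoly_eval x p)) * Const (mpoly_eval x p) \<in> J'" by (rule is_ideal_mult[OF J'(1)])
    then show False using nz J'(3) by (simp add: mult_single)
  qed
  then show ?thesis by blast
qed

section \<open>Products of forms and homogenization\<close>

definition fmul :: "nat \<Rightarrow> nat \<Rightarrow> nat \<Rightarrow> (nat monomial \<Rightarrow> complex) \<Rightarrow> (nat monomial \<Rightarrow> complex) \<Rightarrow> nat monomial \<Rightarrow> complex" where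
  "fmul n k e h g \<beta> = (\<Sum>\<gamma>\<in>monoms n k. \<Sum>\<alpha>\<in>monoms n e. if \<gamma> + \<alpha> = \<beta> then h \<gamma> * g \<alpha> else 0)"

lemma form_eval_fmul: "form_eval n (k + e) (fmul n k e h g) x = form_eval n k h x * form_eval n e g x"
proof -
  have "form_eval n (k + e) (fmul n k e h g) x =
    (\<Sum>\<beta>\<in>monoms n (k + e). \<Sum>\<gamma>\<in>monoms n k. \<Sum>\<alpha>\<in>monoms n e. if \<gamma> + \<alpha> = \<beta> then h \<gamma> * g \<alpha> * monomial_eval x \<beta> else 0)"
    unfolding form_eval_def fmul_def sum_distrib_right by (intro sum.cong refl) simp
  also have "\<dots> = (\<Sum>\<gamma>\<in>monoms n k. \<Sum>\<alpha>\<in>monoms n e. \<Sum>\<beta>\<in>monoms n (k + e). if \<gamma> + \<alpha> = \<beta> then h \<gamma> * g \<alpha> * monomial_eval x \<beta> else 0)"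
    by (subst sum.swap, rule sum.cong[OF refl], rule sum.swap)
  also have "\<dots> = (\<Sum>\<gamma>\<in>monoms n k. \<Sum>\<alpha>\<in>monoms n e. h \<gamma> * monomial_eval x \<gamma> * (g \<alpha> * monomial_eval x \<alpha>))"
    by (intro sum.cong refl) (simp add: add_in_monoms monomial_eval_add)
  finally show ?thesis by (simp add: form_eval_def sum_product)
qed

text \<open>Multiplication by the variable \<open>j\<close> makes the difference vanish also on the
  hyperplane \<open>x j = 0\<close>. This lets an identity from the chart be read coefficient by
  coefficient.\<close>

lemma form_eval_eqD:
  assumes "\<And>x. x j \<noteq> 0 \<Longrightarrow> form_eval n k g x = form_eval n k g' x" and "\<alpha> \<in> monoms n k"
  shows "g \<alpha> = g' \<alpha>"
proof -
  define P :: "(nat, complex) mpoly" where "P = (\<Sum>\<alpha>\<in>monoms n k. Poly_Mapping.single \<alpha> (g \<alpha> - g' \<alpha>))"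
  have ev: "mpoly_eval x P = form_eval n k g x - form_eval n k g' x" for x
    by (simp add: P_def mpoly_eval_sum mpoly_eval_single form_eval_def sum_subtractf left_diff_distrib)
  have "P * Var j = 0"
  proof (rule mpoly_eqI)
    fix x :: "nat \<Rightarrow> complex"
    show "mpoly_eval x (P * Var j) = mpoly_eval x 0"
      using assms(1)[of x] by (cases "x j = 0") (simp_all add: ev.hom_mult ev)
  qed
  then have "P = 0" by (simp add: Var_nonzero)
  then have "Poly_Mapping.lookup P \<alpha> = 0" by simp
  then show ?thesis using assms(2) by (simp add: P_def lookup_sum lookup_single when_def)
qed

lemma monomial_eval_scale:
  assumes "\<alpha> \<in> monoms n k"
  shows "monomial_eval (\<lambda>v. x v / t) \<alpha> = monomial_eval x \<alpha> / (t::complex) ^ k"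
proof -
  have "monomial_eval (\<lambda>v. x v / t) \<alpha> = monomial_eval x \<alpha> / t ^ monomial_degree \<alpha>"
    by (simp add: monomial_eval_def monomial_degree_def power_divide prod_dividef power_sum)
  then show ?thesis using assms by (simp add: monoms_def)
qed

lemma form_eval_scale: "form_eval n k g (\<lambda>v. x v / t) = form_eval n k g x / t ^ k"
  unfolding form_eval_def sum_divide_distrib by (intro sum.cong refl) (simp add: monomial_eval_scale)

lemma homogenize:
  fixes h :: "(nat, complex) mpoly"
  assumes j: "j \<in> {1..n}" and L: "\<And>\<alpha>. \<alpha> \<in> Poly_Mapping.keys h \<Longrightarrow> monomial_degree \<alpha> \<le> L"
  shows "\<exists>g. \<forall>x. x j \<noteq> 0 \<longrightarrow> form_eval n L g x =
    x j ^ L * mpoly_eval (\<lambda>v. if v \<in> {1..n} then x v / x j else 0) h"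
proof -
  define K where "K = {\<alpha> \<in> Poly_Mapping.keys h. Poly_Mapping.keys \<alpha> \<subseteq> {1..n}}"
  define up where "up \<alpha> = \<alpha> + Poly_Mapping.single j (L - monomial_degree \<alpha>)" for \<alpha>
  define g where "g \<beta> = (\<Sum>\<alpha>\<in>K. if up \<alpha> = \<beta> then Poly_Mapping.lookup h \<alpha> else 0)" for \<beta>
  have up: "up \<alpha> \<in> monoms n L" if "\<alpha> \<in> K" for \<alpha>
  proof -
    have "\<alpha> \<in> monoms n (monomial_degree \<alpha>)" using that by (simp add: K_def monoms_def)
    then have "up \<alpha> \<in> monoms n (monomial_degree \<alpha> + (L - monomial_degree \<alpha>))"
      unfolding up_def by (rule add_in_monoms) (rule single_in_monoms[OF j])
    then show ?thesis using L[of \<alpha>] that by (simp add: K_def)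
  qed
  have "form_eval n L g x = x j ^ L * mpoly_eval (\<lambda>v. if v \<in> {1..n} then x v / x j else 0) h" if xj: "x j \<noteq> 0" for x
  proof -
    let ?y = "\<lambda>v. if v \<in> {1..n} then x v / x j else 0"
    have "form_eval n L g x = (\<Sum>\<beta>\<in>monoms n L. \<Sum>\<alpha>\<in>K. if up \<alpha> = \<beta> then Poly_Mapping.lookup h \<alpha> * monomial_eval x \<beta> else 0)"
      unfolding form_eval_def g_def sum_distrib_right by (intro sum.cong refl) simp
    also have "\<dots> = (\<Sum>\<alpha>\<in>K. \<Sum>\<beta>\<in>monoms n L. if up \<alpha> = \<beta> then Poly_Mapping.lookup h \<alpha> * monomial_eval x \<beta> else 0)"
      by (rule sum.swap)
    also have "\<dots> = (\<Sum>\<alpha>\<in>K. Poly_Mapping.lookup h \<alpha> * monomial_eval x (up \<alpha>))"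
      by (intro sum.cong refl) (simp add: up)
    also have "\<dots> = (\<Sum>\<alpha>\<in>K. x j ^ L * (Poly_Mapping.lookup h \<alpha> * monomial_eval ?y \<alpha>))"
    proof (intro sum.cong refl)
      fix \<alpha> assume \<alpha>: "\<alpha> \<in> K"
      have "monomial_eval ?y \<alpha> = monomial_eval (\<lambda>v. x v / x j) \<alpha>"
        by (rule monomial_eval_cong) (use \<alpha> in \<open>auto simp: K_def\<close>)
      also have "\<dots> = monomial_eval x \<alpha> / x j ^ monomial_degree \<alpha>"
        using \<alpha> by (intro monomial_eval_scale[of _ n]) (simp add: K_def monoms_def)
      finally have m: "monomial_eval ?y \<alpha> = monomial_eval x \<alpha> / x j ^ monomial_degree \<alpha>" .
      have "x j ^ L = x j ^ (L - monomial_degree \<alpha>) * x j ^ monomial_degree \<alpha>"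
        using L[of \<alpha>] \<alpha> by (simp add: K_def flip: power_add)
      then show "Poly_Mapping.lookup h \<alpha> * monomial_eval x (up \<alpha>) =
          x j ^ L * (Poly_Mapping.lookup h \<alpha> * monomial_eval ?y \<alpha>)"
        unfolding m using xj by (simp add: up_def monomial_eval_add monomial_eval_single)
    qed
    also have "\<dots> = x j ^ L * (\<Sum>\<alpha>\<in>Poly_Mapping.keys h. Poly_Mapping.lookup h \<alpha> * monomial_eval ?y \<alpha>)"
      unfolding sum_distrib_left
    proof (rule sum.mono_neutral_left)
      show "\<forall>\<alpha>\<in>Poly_Mapping.keys h - K. x j ^ L * (Poly_Mapping.lookup h \<alpha> * monomial_eval ?y \<alpha>) = 0"
      proof
        fix \<alpha> assume "\<alpha> \<in> Poly_Mapping.keys h - K"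
        then obtain v where v: "v \<in> Poly_Mapping.keys \<alpha>" "v \<notin> {1..n}" unfolding K_def by blast
        have "?y v = 0" by (rule if_not_P[OF v(2)])
        then have "?y v ^ Poly_Mapping.lookup \<alpha> v = 0" using v(1) by (simp only: in_keys_iff power_0_left if_False)
        then have "monomial_eval ?y \<alpha> = 0" unfolding monomial_eval_def using v by (intro prod_zero) auto
        then show "x j ^ L * (Poly_Mapping.lookup h \<alpha> * monomial_eval ?y \<alpha>) = 0" by simp
      qed
    qed (auto simp: K_def)
    finally show ?thesis by (simp add: mpoly_eval_def)
  qed
  then show ?thesis by blast
qed

text \<open>Apply the Nullstellensatz in the chart \<open>x\<^sub>j = 1\<close> and homogenize.\<close>

lemma power_in_ideal:
  assumes c: "c \<notin> solvable n e" and j: "j \<in> {1..n}"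
  shows "\<exists>L0. \<forall>L\<ge>L0. \<exists>h. \<forall>x. x j \<noteq> 0 \<longrightarrow>
    x j ^ (L + e) = (\<Sum>i\<in>{1..n}. form_eval n L (h i) x * form_eval n e (\<lambda>\<alpha>. c (i, \<alpha>)) x)"
proof -
  define F :: "nat \<Rightarrow> (nat, complex) mpoly" where "F i = (\<Sum>\<alpha>\<in>monoms n e. Poly_Mapping.single \<alpha> (c (i, \<alpha>)))" for i
  have evF: "mpoly_eval x (F i) = form_eval n e (\<lambda>\<alpha>. c (i, \<alpha>)) x" for i x
    by (simp add: F_def mpoly_eval_sum mpoly_eval_single form_eval_def)
  \<comment> \<open>Adjoining \<open>x_j - 1\<close> restricts to the chart without leaving the
    ring. A common zero of \<open>J\<close> would be a zero of the system with
    \<open>x j = 1\<close>, hence nontrivial.\<close>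
  define J where "J = {(\<Sum>i\<in>{1..n}. h i * F i) + r * (Var j - Const 1) | h r. True}"
  have JI: "z \<in> J" if "z = (\<Sum>i\<in>{1..n}. h i * F i) + r * (Var j - Const 1)" for z h r
    unfolding J_def by (rule CollectI, rule exI[of _ h], rule exI[of _ r]) (simp only: that)
  have J: "is_ideal J"
    unfolding is_ideal_def
  proof (intro conjI ballI allI)
    show "0 \<in> J" by (rule JI[of _ "\<lambda>_. 0" 0]) simp
  next
    fix a b assume "a \<in> J" "b \<in> J"
    then obtain h r h' r' where "a = (\<Sum>i\<in>{1..n}. h i * F i) + r * (Var j - Const 1)"
      "b = (\<Sum>i\<in>{1..n}. h' i * F i) + r' * (Var j - Const 1)" unfolding J_def by blast
    then have "a + b = (\<Sum>i\<in>{1..n}. (h i + h' i) * F i) + (r + r') * (Var j - Const 1)"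
      by (simp only: distrib_right sum.distrib add_ac)
    then show "a + b \<in> J" by (rule JI)
  next
    fix a t assume "a \<in> J"
    then obtain h r where "a = (\<Sum>i\<in>{1..n}. h i * F i) + r * (Var j - Const 1)" unfolding J_def by blast
    then have "t * a = (\<Sum>i\<in>{1..n}. (t * h i) * F i) + (t * r) * (Var j - Const 1)"
      by (simp only: distrib_left sum_distrib_left mult.assoc)
    then show "t * a \<in> J" by (rule JI)
  qed
  have "1 \<in> J"
  proof (rule ccontr)
    assume "1 \<notin> J"
    then obtain x where x: "\<And>p. p \<in> J \<Longrightarrow> p \<in> polys {1..n} \<Longrightarrow> mpoly_eval x p = 0"
      using nullstellensatz[OF _ J, of "{1..n}"] by auto
    have "Var j - Const 1 \<in> J" by (rule JI[of _ "\<lambda>_. 0" 1]) simp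
    then have "mpoly_eval x (Var j - Const 1) = 0"
      by (rule x) (intro polys_diff polys_Var polys_Const j)
    then have "x j \<noteq> 0" by (simp add: ev.hom_minus)
    moreover have "form_eval n e (\<lambda>\<alpha>. c (i, \<alpha>)) x = 0" if i: "i \<in> {1..n}" for i
    proof -
      have "(\<Sum>k\<in>{1..n}. (if k = i then 1 else 0) * F k) = F i" using i by (simp add: if_distribR if_distrib cong: if_cong)
      then have "F i = (\<Sum>k\<in>{1..n}. (if k = i then 1 else 0) * F k) + 0 * (Var j - Const 1)" by simp
      then have "F i \<in> J" by (rule JI)
      then have "mpoly_eval x (F i) = 0"
        by (rule x) (auto simp: F_def monoms_def intro!: polys_sum polys_single)
      then show ?thesis by (simp add: evF)
    qed
    ultimately show False using c j unfolding solvable_def by blast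
  qed
  then obtain h r where hr: "1 = (\<Sum>i\<in>{1..n}. h i * F i) + r * (Var j - Const 1)"
    unfolding J_def mem_Collect_eq by (elim exE conjE)
  \<comment> \<open>A bound for the degrees of all multipliers; \<open>insert 0\<close> provides a
    maximum when they are all zero.\<close>
  define L0 where "L0 = Max (insert 0 (monomial_degree ` (\<Union>i\<in>{1..n}. Poly_Mapping.keys (h i))))"
  have L0: "monomial_degree \<alpha> \<le> L0" if "i \<in> {1..n}" "\<alpha> \<in> Poly_Mapping.keys (h i)" for i \<alpha>
  proof -
    have "\<alpha> \<in> (\<Union>i\<in>{1..n}. Poly_Mapping.keys (h i))" using that by blast
    then have "monomial_degree \<alpha> \<in> insert 0 (monomial_degree ` (\<Union>i\<in>{1..n}. Poly_Mapping.keys (h i)))"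
      by (intro insertI2 imageI)
    then show ?thesis unfolding L0_def by (rule Max_ge[rotated]) simp
  qed
  have "\<exists>h. \<forall>x. x j \<noteq> 0 \<longrightarrow> x j ^ (L + e) = (\<Sum>i\<in>{1..n}. form_eval n L (h i) x * form_eval n e (\<lambda>\<alpha>. c (i, \<alpha>)) x)"
    if L: "L \<ge> L0" for L
  proof -
    have "\<forall>i\<in>{1..n}. \<exists>g. \<forall>x. x j \<noteq> 0 \<longrightarrow> form_eval n L g x =
        x j ^ L * mpoly_eval (\<lambda>v. if v \<in> {1..n} then x v / x j else 0) (h i)"
    proof (intro ballI homogenize[OF j])
      fix i \<alpha> assume "i \<in> {1..n}" "\<alpha> \<in> Poly_Mapping.keys (h i)"
      then show "monomial_degree \<alpha> \<le> L" using L0[of i \<alpha>] L by simp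
    qed
    from bchoice[OF this] obtain g where g: "\<And>i x. i \<in> {1..n} \<Longrightarrow> x j \<noteq> 0 \<Longrightarrow> form_eval n L (g i) x =
        x j ^ L * mpoly_eval (\<lambda>v. if v \<in> {1..n} then x v / x j else 0) (h i)" by blast
    have "x j ^ (L + e) = (\<Sum>i\<in>{1..n}. form_eval n L (g i) x * form_eval n e (\<lambda>\<alpha>. c (i, \<alpha>)) x)" if xj: "x j \<noteq> 0" for x :: "nat \<Rightarrow> complex"
    proof -
      define y where "y = (\<lambda>v. if v \<in> {1..n} then x v / x j else 0)"
      have yj: "y j = 1" using j xj by (simp add: y_def)
      have fy: "form_eval n e G y = form_eval n e G x / x j ^ e" for G
        unfolding form_eval_scale[symmetric] by (rule form_eval_cong) (simp add: y_def)
      have gy: "form_eval n L (g i) x = x j ^ L * mpoly_eval y (h i)" if "i \<in> {1..n}" for i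
        using g[of i x, OF that xj] by (simp only: y_def)
      have "1 = mpoly_eval y 1" by simp
      also have "\<dots> = (\<Sum>i\<in>{1..n}. mpoly_eval y (h i) * (form_eval n e (\<lambda>\<alpha>. c (i, \<alpha>)) x / x j ^ e))"
        by (subst hr) (simp add: ev.hom_add ev.hom_mult ev.hom_sum ev.hom_minus evF fy yj)
      finally have "x j ^ (L + e) * 1 = x j ^ (L + e) * (\<Sum>i\<in>{1..n}. mpoly_eval y (h i) * (form_eval n e (\<lambda>\<alpha>. c (i, \<alpha>)) x / x j ^ e))" by simp
      also have "\<dots> = (\<Sum>i\<in>{1..n}. form_eval n L (g i) x * form_eval n e (\<lambda>\<alpha>. c (i, \<alpha>)) x)"
        unfolding sum_distrib_left using xj by (intro sum.cong refl) (simp add: gy power_add)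
      finally show ?thesis by simp
    qed
    then show ?thesis by blast
  qed
  then show ?thesis by blast
qed

text \<open>With \<open>k + e = n * (L + e)\<close>, a monomial of degree \<open>k + e\<close> in
  \<open>n\<close> variables has some exponent at least \<open>L + e\<close>. It is thus a multiple
  of a power already known to lie in the ideal.\<close>

lemma monomials_in_ideal:
  assumes c: "c \<notin> solvable n e" and n: "n \<ge> 1" and e: "e \<ge> 1"
  shows "\<exists>k. \<forall>\<beta>\<in>monoms n (k + e). \<exists>h. \<forall>\<beta>'\<in>monoms n (k + e).
    (\<Sum>i\<in>{1..n}. fmul n k e (h i) (\<lambda>\<alpha>. c (i, \<alpha>)) \<beta>') = (if \<beta>' = \<beta> then 1 else 0)"
proof -
  have "\<forall>j\<in>{1..n}. \<exists>L0. \<forall>L\<ge>L0. \<exists>h. \<forall>x. x j \<noteq> 0 \<longrightarrow>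
    x j ^ (L + e) = (\<Sum>i\<in>{1..n}. form_eval n L (h i) x * form_eval n e (\<lambda>\<alpha>. c (i, \<alpha>)) x)"
    using power_in_ideal[OF c] by blast
  from bchoice[OF this] obtain L0 where L0: "\<forall>j\<in>{1..n}. \<forall>L\<ge>L0 j. \<exists>h. \<forall>x. x j \<noteq> 0 \<longrightarrow>
    x j ^ (L + e) = (\<Sum>i\<in>{1..n}. form_eval n L (h i) x * form_eval n e (\<lambda>\<alpha>. c (i, \<alpha>)) x)" ..
  define L where "L = Max (L0 ` {1..n})"
  have L: "L0 j \<le> L" if "j \<in> {1..n}" for j unfolding L_def using that by (intro Max_ge) auto
  define k where "k = n * (L + e) - e"
  have ke: "k + e = n * (L + e)"
  proof -
    have "e \<le> L + e" by simp
    also have "\<dots> \<le> n * (L + e)" using n by simp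
    finally show ?thesis by (simp add: k_def)
  qed
  have "\<exists>h. \<forall>\<beta>'\<in>monoms n (k + e).
    (\<Sum>i\<in>{1..n}. fmul n k e (h i) (\<lambda>\<alpha>. c (i, \<alpha>)) \<beta>') = (if \<beta>' = \<beta> then 1 else 0)" if \<beta>: "\<beta> \<in> monoms n (k + e)" for \<beta>
  proof -
    have "\<exists>j\<in>{1..n}. Poly_Mapping.lookup \<beta> j \<ge> L + e"
    proof (rule ccontr)
      assume "\<not> ?thesis"
      then have "Poly_Mapping.lookup \<beta> j < L + e" if "j \<in> {1..n}" for j
        using that by (meson not_le)
      then have "(\<Sum>j\<in>{1..n}. Poly_Mapping.lookup \<beta> j) < (\<Sum>j\<in>{1..n}. L + e)"
        using n by (intro sum_strict_mono) auto
      moreover have "(\<Sum>j\<in>{1..n}. Poly_Mapping.lookup \<beta> j) = k + e"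
        using \<beta> monomial_degree_superset[of "{1..n}" \<beta>] by (simp add: monoms_def)
      ultimately show False using ke by simp
    qed
    then obtain j where j: "j \<in> {1..n}" "Poly_Mapping.lookup \<beta> j \<ge> L + e" by blast
    define \<delta> where "\<delta> = \<beta> - Poly_Mapping.single j (L + e)"
    have \<delta>: "\<beta> = \<delta> + Poly_Mapping.single j (L + e)"
      by (rule poly_mapping_eqI) (use j in \<open>auto simp: \<delta>_def lookup_add lookup_minus lookup_single when_def\<close>)
    have "\<delta> \<in> monoms n (monomial_degree \<delta>)"
      using \<beta> by (auto simp: monoms_def \<delta>_def in_keys_iff lookup_minus subset_iff)
    moreover have kd: "k = monomial_degree \<delta> + L"
      using \<beta> \<delta> monomial_degree_add[of \<delta> "Poly_Mapping.single j (L + e)"] by (simp add: monoms_def)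
    ultimately have \<delta>m: "\<delta> \<in> monoms n (monomial_degree \<delta>)" by simp
    obtain h where h: "\<And>x. x j \<noteq> 0 \<Longrightarrow>
        x j ^ (L + e) = (\<Sum>i\<in>{1..n}. form_eval n L (h i) x * form_eval n e (\<lambda>\<alpha>. c (i, \<alpha>)) x)"
      using bspec[OF L0 j(1), THEN spec, THEN mp, OF L[OF j(1)]] by blast
    define h' where "h' i = fmul n (monomial_degree \<delta>) L (\<lambda>\<alpha>. if \<alpha> = \<delta> then 1 else 0) (h i)" for i
    have "form_eval n (k + e) (\<lambda>\<beta>'. \<Sum>i\<in>{1..n}. fmul n k e (h' i) (\<lambda>\<alpha>. c (i, \<alpha>)) \<beta>') x =
       form_eval n (k + e) (\<lambda>\<beta>'. if \<beta>' = \<beta> then 1 else 0) x" if xj: "x j \<noteq> 0" for x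
    proof -
      have "form_eval n (k + e) (\<lambda>\<beta>'. \<Sum>i\<in>{1..n}. fmul n k e (h' i) (\<lambda>\<alpha>. c (i, \<alpha>)) \<beta>') x =
        (\<Sum>i\<in>{1..n}. form_eval n (k + e) (fmul n k e (h' i) (\<lambda>\<alpha>. c (i, \<alpha>))) x)"
        unfolding form_eval_def sum_distrib_right by (rule sum.swap)
      also have "\<dots> = (\<Sum>i\<in>{1..n}. monomial_eval x \<delta> * (form_eval n L (h i) x * form_eval n e (\<lambda>\<alpha>. c (i, \<alpha>)) x))"
        unfolding form_eval_fmul
        by (intro sum.cong refl) (simp add: h'_def kd form_eval_fmul form_eval_indicator[OF \<delta>m])
      also have "\<dots> = monomial_eval x \<delta> * x j ^ (L + e)"
        unfolding h[of x, OF xj] sum_distrib_left ..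
      also have "\<dots> = monomial_eval x \<beta>"
        by (subst \<delta>) (simp add: monomial_eval_add monomial_eval_single)
      finally show ?thesis by (simp add: form_eval_indicator[OF \<beta>])
    qed
    from form_eval_eqD[OF this] show ?thesis by (intro exI[of _ h'] ballI)
  qed
  then show ?thesis by blast
qed

text \<open>The witness is a Macaulay determinant: its matrix becomes the identity at \<open>c\<close>, while at a system
  with a nontrivial zero \<open>x\<close> it is annihilated by the vector of all monomials in \<open>x\<close>.\<close>

theorem elimination:
  assumes c: "c \<notin> solvable n e" and n: "n \<ge> 1" and e: "e \<ge> 1"
  shows "\<exists>P\<in>vanishing n e. mpoly_eval c P \<noteq> 0"
proof -
  obtain k where "\<forall>\<beta>\<in>monoms n (k + e). \<exists>h. \<forall>\<beta>'\<in>monoms n (k + e).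
    (\<Sum>i\<in>{1..n}. fmul n k e (h i) (\<lambda>\<alpha>. c (i, \<alpha>)) \<beta>') = (if \<beta>' = \<beta> then 1 else 0)"
    using monomials_in_ideal[OF assms] by (elim exE)
  from bchoice[OF this] obtain H where H: "\<forall>\<beta>\<in>monoms n (k + e). \<forall>\<beta>'\<in>monoms n (k + e).
    (\<Sum>i\<in>{1..n}. fmul n k e (H \<beta> i) (\<lambda>\<alpha>. c (i, \<alpha>)) \<beta>') = (if \<beta>' = \<beta> then 1 else 0)" ..
  define N where "N = card (monoms n (k + e))"
  obtain b where b: "bij_betw b {0..<N} (monoms n (k + e))"
    unfolding N_def using ex_bij_betw_nat_finite[OF finite_monoms] by blast
  have bm: "b r \<in> monoms n (k + e)" if "r < N" for r using b that by (auto simp: bij_betw_def)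
  have b_eq: "b r = b s \<longleftrightarrow> r = s" if "r < N" "s < N" for r s
    using b that by (auto simp: bij_betw_def inj_on_def)
  \<comment> \<open>The multipliers found for the particular system \<open>c\<close> are frozen as
    constants, while the coefficients of the system become variables.\<close>
  define m :: "nat \<Rightarrow> nat \<Rightarrow> (coeff_var, complex) mpoly" where
    "m r s = (\<Sum>i\<in>{1..n}. \<Sum>\<gamma>\<in>monoms n k. \<Sum>\<alpha>\<in>monoms n e.
       if \<gamma> + \<alpha> = b s then Const (H (b r) i \<gamma>) * Var (i, \<alpha>) else 0)" for r s
  define M where "M = mat N N (\<lambda>(r, s). m r s)"
  have M: "M \<in> carrier_mat N N" by (simp add: M_def)
  have ev_m: "mpoly_eval y (m r s) = (\<Sum>i\<in>{1..n}. fmul n k e (H (b r) i) (\<lambda>\<alpha>. y (i, \<alpha>)) (b s))" for y r s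
    unfolding m_def fmul_def ev.hom_sum
    by (intro sum.cong refl) (simp add: ev.hom_mult)
  define A where "A y = mat N N (\<lambda>(r, s). \<Sum>i\<in>{1..n}. fmul n k e (H (b r) i) (\<lambda>\<alpha>. y (i, \<alpha>)) (b s))" for y
  have A: "A y \<in> carrier_mat N N" for y by (simp add: A_def)
  have "map_mat (mpoly_eval y) M = A y" for y
    by (rule eq_matI) (simp_all add: M_def A_def ev_m)
  then have ev_det: "mpoly_eval y (det M) = det (A y)" for y
    by (metis ev.hom_det)
  have "A c = 1\<^sub>m N"
  proof (rule eq_matI)
    fix r s assume rs: "r < dim_row (1\<^sub>m N :: complex mat)" "s < dim_col (1\<^sub>m N :: complex mat)"
    then have "(\<Sum>i\<in>{1..n}. fmul n k e (H (b r) i) (\<lambda>\<alpha>. c (i, \<alpha>)) (b s)) = (if b s = b r then 1 else 0)"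
      using H bm by simp
    then show "A c $$ (r, s) = 1\<^sub>m N $$ (r, s)" using rs b_eq by (auto simp: A_def)
  qed (simp_all add: A_def)
  then have "mpoly_eval c (det M) = 1" by (simp add: ev_det)
  moreover have "mpoly_eval y (det M) = 0" if y: "y \<in> solvable n e" for y
  proof -
    obtain x j where x: "j \<in> {1..n}" "x j \<noteq> 0" "\<And>i. i \<in> {1..n} \<Longrightarrow> form_eval n e (\<lambda>\<alpha>. y (i, \<alpha>)) x = 0"
      using y unfolding solvable_def by blast
    define v where "v = vec N (\<lambda>s. monomial_eval x (b s))"
    have v: "v \<in> carrier_vec N" by (simp add: v_def)
    have "A y *\<^sub>v v = 0\<^sub>v N"
    proof (rule eq_vecI)
      fix r assume "r < dim_vec (0\<^sub>v N :: complex vec)"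
      then have r: "r < N" by simp
      have "(A y *\<^sub>v v) $ r = (\<Sum>s\<in>{0..<N}. (\<Sum>i\<in>{1..n}. fmul n k e (H (b r) i) (\<lambda>\<alpha>. y (i, \<alpha>)) (b s)) * monomial_eval x (b s))"
        using r by (simp add: A_def v_def scalar_prod_def)
      also have "\<dots> = (\<Sum>\<beta>\<in>monoms n (k + e). (\<Sum>i\<in>{1..n}. fmul n k e (H (b r) i) (\<lambda>\<alpha>. y (i, \<alpha>)) \<beta>) * monomial_eval x \<beta>)"
        by (rule sum.reindex_bij_betw[OF b])
      also have "\<dots> = (\<Sum>i\<in>{1..n}. form_eval n (k + e) (fmul n k e (H (b r) i) (\<lambda>\<alpha>. y (i, \<alpha>))) x)"
        unfolding form_eval_def sum_distrib_right by (rule sum.swap)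
      also have "\<dots> = 0" using x(3) by (simp add: form_eval_fmul)
      finally show "(A y *\<^sub>v v) $ r = 0\<^sub>v N $ r" using r by simp
    qed (simp add: A_def)
    moreover have "v \<noteq> 0\<^sub>v N"
    proof
      assume v0: "v = 0\<^sub>v N"
      have "Poly_Mapping.single j (k + e) \<in> monoms n (k + e)" by (rule single_in_monoms[OF x(1)])
      then obtain s where s: "s < N" "b s = Poly_Mapping.single j (k + e)"
        using b unfolding bij_betw_def by (metis atLeastLessThan_iff imageE)
      have "v $ s = x j ^ (k + e)" using s by (simp add: v_def monomial_eval_single)
      then show False using v0 s x(2) by simp
    qed
    ultimately have "det (A y) = 0" using det_0_iff_vec_prod_zero_field[OF A] v by blast
    then show ?thesis by (simp add: ev_det)
  qed
  moreover have "det M \<in> polys (coeff_vars n (\<lambda>_. e))"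
  proof -
    have mPV: "m r s \<in> polys (coeff_vars n (\<lambda>_. e))" for r s
      unfolding m_def by (intro polys_sum) (auto intro!: polys_mult polys_Var simp: coeff_vars_eq)
    have sPV: "(signof p :: (coeff_var, complex) mpoly) \<in> polys (coeff_vars n (\<lambda>_. e))" for p
      by (auto simp: sign_def intro: polys_uminus)
    show ?thesis
      unfolding det_def'[OF M]
    proof (intro polys_sum polys_mult polys_prod sPV)
      fix p i assume "p \<in> {p. p permutes {0..<N}}" "i \<in> {0..<N}"
      then have "i < N" "p i < N" using permutes_in_image[of p "{0..<N}" i] by auto
      then show "M $$ (i, p i) \<in> polys (coeff_vars n (\<lambda>_. e))" using mPV by (simp add: M_def)
    qed
  qed
  ultimately show ?thesis by (auto simp: vanishing_def)
qed

section \<open>Existence and uniqueness of the resultant\<close>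

lemma vanishing_polys: "P \<in> vanishing n e \<Longrightarrow> P \<in> polys (coeff_vars n (\<lambda>_. e))"
  by (simp add: vanishing_def)

lemma vanishing_eval: "P \<in> vanishing n e \<Longrightarrow> c \<in> solvable n e \<Longrightarrow> mpoly_eval c P = 0"
  by (simp add: vanishing_def)

definition generates :: "nat \<Rightarrow> nat \<Rightarrow> (coeff_var, complex) mpoly \<Rightarrow> bool" where
  "generates n e R \<longleftrightarrow> R \<in> vanishing n e \<and> irreducible R \<and> (\<forall>P\<in>vanishing n e. R dvd P)"

definition id_sys :: "nat \<Rightarrow> coeff_var \<Rightarrow> complex" where
  "id_sys e = (\<lambda>(i, \<alpha>). if \<alpha> = Poly_Mapping.single i e then 1 else 0)"

lemma id_sys_notin_solvable:
  assumes "e \<ge> 1"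
  shows "id_sys e \<notin> solvable n e"
proof
  assume "id_sys e \<in> solvable n e"
  then obtain x j where x: "j \<in> {1..n}" "x j \<noteq> 0" "\<And>i. i \<in> {1..n} \<Longrightarrow> form_eval n e (\<lambda>\<alpha>. id_sys e (i, \<alpha>)) x = 0"
    unfolding solvable_def by blast
  have "form_eval n e (\<lambda>\<alpha>. id_sys e (j, \<alpha>)) x = x j ^ e"
    using form_eval_indicator[OF single_in_monoms[OF x(1), of e], of 1 x] by (simp add: id_sys_def monomial_eval_single)
  then show False using x by simp
qed

lemma zero_in_solvable: "n \<ge> 1 \<Longrightarrow> (\<lambda>_. 0) \<in> solvable n e"
  by (auto simp: solvable_def intro!: exI[of _ "\<lambda>_. 1"] bexI[of _ 1])

text \<open>A nonzero member of least \<open>deg_sum\<close> is irreducible: by primality one factor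
  lies in the ideal, and by minimality the other then has no variables.\<close>

lemma ex_generator:
  assumes n: "n \<ge> 1" and e: "e \<ge> 1"
  shows "\<exists>R. generates n e R"
proof -
  let ?V = "coeff_vars n (\<lambda>_. e)"
  obtain P where P: "P \<in> vanishing n e" "mpoly_eval (id_sys e) P \<noteq> 0"
    using elimination[OF id_sys_notin_solvable[OF e] n e] by blast
  then have "P \<noteq> 0" by auto
  then obtain R where R: "R \<in> vanishing n e" "R \<noteq> 0" "\<And>Q. Q \<in> vanishing n e \<Longrightarrow> Q \<noteq> 0 \<Longrightarrow> deg_sum R \<le> deg_sum Q"
    using ex_has_least_nat[of "\<lambda>Q. Q \<in> vanishing n e \<and> Q \<noteq> 0" P deg_sum] P by blast
  have RV: "R \<in> polys ?V" using R(1) by (rule vanishing_polys)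
  have unit: "b dvd 1" if ab: "R = a * b" "a \<in> vanishing n e" for a b
  proof -
    have nz: "a \<noteq> 0" "b \<noteq> 0" using ab R(2) by auto
    have "deg_sum R \<le> deg_sum a" using R(3) ab(2) nz by simp
    then have "deg_sum b = 0" using deg_sum_mult[OF nz] ab(1) by simp
    then show ?thesis using is_unit_mpoly deg_sum_eq_0 nz by metis
  qed
  have irr: "irreducible R"
  proof (rule irreducibleI)
    show "\<not> R dvd 1"
    proof
      assume "R dvd 1"
      then obtain q where "1 = R * q" by auto
      then have "1 = mpoly_eval (\<lambda>_. 0) R * mpoly_eval (\<lambda>_. 0) q" by (metis ev.hom_one ev.hom_mult)
      then show False using vanishing_eval[OF R(1) zero_in_solvable[OF n]] by simp
    qed
  next
    fix a b assume ab: "R = a * b"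
    have abV: "a \<in> polys ?V" "b \<in> polys ?V" using polys_factor[of a b ?V] ab RV R(2) by auto
    have "a \<in> vanishing n e \<or> b \<in> vanishing n e"
      using vanishing_prime[OF n e abV] ab R(1) by simp
    then show "a dvd 1 \<or> b dvd 1"
      using unit[of a b] unit[of b a] ab by (auto simp: mult.commute)
  qed (fact R(2))
  let ?u = "(n, Poly_Mapping.single n e)"
  have u: "?u \<in> ?V" using n by (auto simp: coeff_vars_eq single_in_monoms)
  let ?T = "?V - {?u}"
  have T: "insert ?u ?T = ?V" using u by blast
  have U: "ufd_in ?T TYPE((coeff_var, complex) mpoly)"
    by (rule ufd_in_finite) (simp add: finite_coeff_vars)
  \<comment> \<open>Without the excluded coefficient \<open>R\<close> would be zero. So divisibility
    by \<open>R\<close> can be decided by Euclid's algorithm in this one variable.\<close>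
  have d: "deg_in ?u R > 0"
    using deg_in_0_polys[OF RV, of ?u] vanishing_uses_last[OF n e R(1)] R(2) by auto
  have "R dvd Q" if Q: "Q \<in> vanishing n e" for Q
  proof (rule ccontr)
    assume "\<not> R dvd Q"
    then obtain a \<alpha> \<beta> where a: "a \<in> polys ?T" "a \<noteq> 0" "a = \<alpha> * R + \<beta> * Q"
      using irreducible_dvd_or_bezout[OF U, of ?u R Q] RV irr d vanishing_polys[OF Q] unfolding T by auto
    have "a \<in> vanishing n e"
      using a polys_mono[OF _ a(1), of ?V] vanishing_eval[OF R(1)] vanishing_eval[OF Q]
      by (auto simp: vanishing_def ev.hom_add ev.hom_mult)
    then show False using vanishing_uses_last[OF n e _ a(1)] a(2) by blast
  qed
  then show ?thesis using R irr by (auto simp: generates_def)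
qed

text \<open>Elimination supplies a member of the ideal that is nonzero at an unsolvable
  \<open>c\<close>. It is a multiple of \<open>R\<close>, so \<open>R\<close> is nonzero there
  too.\<close>

lemma generates_zero_iff:
  assumes "n \<ge> 1" "e \<ge> 1" "generates n e R"
  shows "mpoly_eval c R = 0 \<longleftrightarrow> c \<in> solvable n e"
proof
  assume 0: "mpoly_eval c R = 0"
  show "c \<in> solvable n e"
  proof (rule ccontr)
    assume "c \<notin> solvable n e"
    then obtain P where P: "P \<in> vanishing n e" "mpoly_eval c P \<noteq> 0" using elimination assms by blast
    then obtain q where "P = R * q" using assms(3) unfolding generates_def by (meson dvdE)
    then show False using P 0 by (simp add: ev.hom_mult)
  qed
qed (use assms in \<open>auto simp: generates_def vanishing_def\<close>)

lemma Const_unit: "(c::'a::field) \<noteq> 0 \<Longrightarrow> Const c * Const (inverse c) = 1"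
  by (simp add: mult_single)

lemma generates_Const_mult:
  assumes "generates n e R" "c \<noteq> 0"
  shows "generates n e (Const c * R)"
  unfolding generates_def
proof (intro conjI ballI)
  have u: "Const c dvd (1 :: (coeff_var, complex) mpoly)" using Const_unit[OF assms(2)] by (metis dvdI)
  show "Const c * R \<in> vanishing n e"
    using assms by (auto simp: generates_def vanishing_def ev.hom_mult intro: polys_mult)
  show "irreducible (Const c * R)"
    using assms(1) irreducible_mult_unit_left[OF u] by (simp add: generates_def)
  show "Const c * R dvd P" if "P \<in> vanishing n e" for P
    using assms(1) that u by (simp add: generates_def mult_unit_dvd_iff')
qed

lemma generates_unique:
  fixes R Q :: "(coeff_var, complex) mpoly"
  assumes R: "generates n e R" and Q: "Q \<in> vanishing n e" "irreducible Q"
  shows "\<exists>k. k \<noteq> 0 \<and> Q = Const k * R"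
proof -
  obtain t where t: "Q = R * t" using R Q unfolding generates_def by (meson dvdE)
  have "\<not> R dvd 1" using R by (simp add: generates_def irreducible_def)
  then have "t dvd 1" using Q(2) t unfolding irreducible_def by metis
  then obtain k where k: "t = Const k" using mpoly_unit_polys polys_empty by metis
  moreover have "t \<noteq> 0" using t Q(2) by auto
  ultimately have "k \<noteq> 0 \<and> Q = Const k * R" using t by (auto simp: mult.commute)
  then show ?thesis ..
qed

lemma mpoly_eval_form:
  assumes "is_form n e f"
  shows "mpoly_eval x f = form_eval n e (Poly_Mapping.lookup f) x"
  unfolding form_eval_def
  by (intro mpoly_eval_superset finite_monoms) (use assms in \<open>auto simp: is_form_def monoms_def\<close>)

lemma has_nontrivial_zero_iff:
  assumes "\<And>i. i \<in> {1..n} \<Longrightarrow> is_form n e (f i)"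
  shows "has_nontrivial_zero n f \<longleftrightarrow> (\<lambda>(i, \<alpha>). Poly_Mapping.lookup (f i) \<alpha>) \<in> solvable n e"
proof -
  have "(\<forall>i\<in>{1..n}. mpoly_eval x (f i) = 0) \<longleftrightarrow> (\<forall>i\<in>{1..n}. form_eval n e (Poly_Mapping.lookup (f i)) x = 0)" for x
    by (rule ball_cong[OF refl]) (simp only: mpoly_eval_form[OF assms])
  then show ?thesis
    by (simp only: has_nontrivial_zero_def solvable_def mem_Collect_eq case_prod_conv)
qed

lemma eval_at_id:
  "eval_at_coeffs R (\<lambda>i. Poly_Mapping.single (Poly_Mapping.single i e) 1) = mpoly_eval (id_sys e) R"
proof -
  have "(\<lambda>(i, \<alpha>). Poly_Mapping.lookup (Poly_Mapping.single (Poly_Mapping.single i e) 1) \<alpha>) = id_sys e"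
    by (auto simp: id_sys_def lookup_single when_def)
  then show ?thesis by (simp add: eval_at_coeffs_def)
qed

lemma is_resultantI:
  assumes "n \<ge> 1" "e \<ge> 1" "generates n e R" "mpoly_eval (id_sys e) R = 1"
  shows "is_resultant n (\<lambda>_. e) R"
  unfolding is_resultant_def eval_at_id
proof (intro conjI allI impI)
  show "mpoly_vars R \<subseteq> coeff_vars n (\<lambda>_. e)" "irreducible R"
    using assms(3) by (auto simp: generates_def vanishing_def polys_def)
  fix f assume f: "\<forall>i\<in>{1..n}. is_form n e (f i)"
  have "has_nontrivial_zero n f \<longleftrightarrow> (\<lambda>(i, \<alpha>). Poly_Mapping.lookup (f i) \<alpha>) \<in> solvable n e"
    by (rule has_nontrivial_zero_iff, rule bspec[OF f])
  then show "eval_at_coeffs R f = 0 \<longleftrightarrow> has_nontrivial_zero n f"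
    using generates_zero_iff[OF assms(1-3)] by (simp only: eval_at_coeffs_def)
qed (fact assms(4))

text \<open>The defining property speaks of forms. A coefficient function is therefore cut down to
  monomials of degree \<open>e\<close>, which changes neither its solvability nor the value of
  \<open>Q\<close>.\<close>

lemma is_resultantD:
  assumes "n \<ge> 1" "e \<ge> 1" "is_resultant n (\<lambda>_. e) Q"
  shows "Q \<in> vanishing n e" "irreducible Q" "mpoly_eval (id_sys e) Q = 1"
proof -
  show "irreducible Q" "mpoly_eval (id_sys e) Q = 1" using assms(3) by (simp_all add: is_resultant_def eval_at_id)
  have QV: "Q \<in> polys (coeff_vars n (\<lambda>_. e))" using assms(3) by (simp add: is_resultant_def polys_def)
  have "mpoly_eval c Q = 0" if c: "c \<in> solvable n e" for c
  proof -
    define f where "f i = (\<Sum>\<alpha>\<in>monoms n e. Poly_Mapping.single \<alpha> (c (i, \<alpha>)))" for i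
    have lf: "Poly_Mapping.lookup (f i) \<alpha> = (if \<alpha> \<in> monoms n e then c (i, \<alpha>) else 0)" for i \<alpha>
      by (simp add: f_def lookup_sum lookup_single when_def)
    have ff: "is_form n e (f i)" for i
      unfolding is_form_def
    proof
      fix \<alpha> assume "\<alpha> \<in> Poly_Mapping.keys (f i)"
      then have "\<alpha> \<in> monoms n e" by (simp add: in_keys_iff lf split: if_splits)
      then show "Poly_Mapping.keys \<alpha> \<subseteq> {1..n} \<and> monomial_degree \<alpha> = e" by (simp only: monoms_def mem_Collect_eq)
    qed
    let ?c = "\<lambda>(i, \<alpha>). Poly_Mapping.lookup (f i) \<alpha>"
    have eq: "?c v = c v" if "v \<in> coeff_vars n (\<lambda>_. e)" for v
      using that by (auto simp: coeff_vars_eq lf)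
    then have "?c \<in> solvable n e" using solvable_cong[of n e ?c c] c by blast
    then have "has_nontrivial_zero n f" by (rule iffD2[OF has_nontrivial_zero_iff[OF ff]])
    then have "eval_at_coeffs Q f = 0" using assms(3) ff by (simp add: is_resultant_def)
    moreover have "mpoly_eval ?c Q = mpoly_eval c Q" by (rule mpoly_eval_cong[OF QV eq])
    ultimately show ?thesis by (simp add: eval_at_coeffs_def)
  qed
  then show "Q \<in> vanishing n e" using QV by (simp add: vanishing_def)
qed

text \<open>Generators are unique up to a constant. The value at the system of pure powers is
  nonzero, as this system has only the trivial zero, so the normalization fixes the
  constant.\<close>

theorem resultant_mpoly:
  assumes n: "n \<ge> 1" and e: "e \<ge> 1"
  shows "generates n e (resultant_mpoly n (\<lambda>_. e))" "mpoly_eval (id_sys e) (resultant_mpoly n (\<lambda>_. e)) = 1"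
proof -
  obtain R0 where R0: "generates n e R0" using ex_generator[OF assms] by blast
  define R where "R = Const (inverse (mpoly_eval (id_sys e) R0)) * R0"
  have nz: "mpoly_eval (id_sys e) R0 \<noteq> 0" using generates_zero_iff[OF n e R0] id_sys_notin_solvable[OF e] by blast
  then have R: "generates n e R" unfolding R_def by (intro generates_Const_mult[OF R0]) simp
  have R1: "mpoly_eval (id_sys e) R = 1" using nz by (simp add: R_def ev.hom_mult)
  have "resultant_mpoly n (\<lambda>_. e) = R"
    unfolding resultant_mpoly_def
  proof (rule the_equality)
    show "is_resultant n (\<lambda>_. e) R" by (rule is_resultantI[OF n e R R1])
    fix Q assume Q: "is_resultant n (\<lambda>_. e) Q"
    obtain k where k: "Q = Const k * R" using generates_unique[OF R] is_resultantD[OF n e Q] by blast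
    have "k = 1" using is_resultantD(3)[OF n e Q] R1 by (simp add: k ev.hom_mult)
    then show "Q = R" using k by simp
  qed
  then show "generates n e (resultant_mpoly n (\<lambda>_. e))" "mpoly_eval (id_sys e) (resultant_mpoly n (\<lambda>_. e)) = 1"
    using R R1 by simp_all
qed

section \<open>Symmetries of the resultant\<close>

lemma mpoly_eval_psubst:
  "mpoly_eval c (psubst Const \<psi> P) = mpoly_eval (\<lambda>v. mpoly_eval c (\<psi> v)) (P :: ('v, complex) mpoly)"
  by (simp only: psubst_compose[OF mpoly_eval_hom] mpoly_eval_Const) (simp only: mpoly_eval_eq_psubst)

lemma psubst_polys:
  fixes P :: "('v, complex) mpoly"
  assumes "P \<in> polys T" "\<And>v. v \<in> T \<Longrightarrow> \<psi> v \<in> polys T"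
  shows "psubst Const \<psi> P \<in> polys T"
  unfolding psubst_def monomial_eval_def
proof (intro polys_sum polys_mult polys_Const polys_prod polys_power assms(2))
  fix \<alpha> v assume "\<alpha> \<in> Poly_Mapping.keys P" "v \<in> Poly_Mapping.keys \<alpha>"
  then show "v \<in> T" using assms(1) unfolding polys_iff by blast
qed

text \<open>A substitution preserving solvability maps the vanishing ideal into itself, so it sends
  \<open>R\<close> to a multiple of \<open>R\<close>. Applying the inverse substitution shows that
  the cofactor is a unit, hence a constant.\<close>

lemma generates_symmetry:
  fixes R :: "(coeff_var, complex) mpoly"
  assumes R: "generates n e R"
    and \<psi>: "\<And>v. v \<in> coeff_vars n (\<lambda>_. e) \<Longrightarrow> \<psi> v \<in> polys (coeff_vars n (\<lambda>_. e))"
    and \<psi>': "\<And>v. v \<in> coeff_vars n (\<lambda>_. e) \<Longrightarrow> \<psi>' v \<in> polys (coeff_vars n (\<lambda>_. e))"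
    and Z: "\<And>c. c \<in> solvable n e \<Longrightarrow> (\<lambda>v. mpoly_eval c (\<psi> v)) \<in> solvable n e"
    and Z': "\<And>c. c \<in> solvable n e \<Longrightarrow> (\<lambda>v. mpoly_eval c (\<psi>' v)) \<in> solvable n e"
    and inv: "\<And>c v. mpoly_eval (\<lambda>v. mpoly_eval c (\<psi> v)) (\<psi>' v) = c v"
  shows "\<exists>k. \<forall>c. mpoly_eval (\<lambda>v. mpoly_eval c (\<psi> v)) R = k * mpoly_eval c R"
proof -
  let ?V = "coeff_vars n (\<lambda>_. e)"
  have RV: "R \<in> vanishing n e" and R0: "R \<noteq> 0" using R by (auto simp: generates_def)
  have "psubst Const \<psi> R \<in> vanishing n e" "psubst Const \<psi>' R \<in> vanishing n e"
    using psubst_polys[OF vanishing_polys[OF RV]] \<psi> \<psi>' vanishing_eval[OF RV] Z Z'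
    by (simp_all add: vanishing_def mpoly_eval_psubst)
  then obtain q q' where q: "psubst Const \<psi> R = R * q" "psubst Const \<psi>' R = R * q'"
    using R unfolding generates_def by (meson dvdE)
  have "R = R * q * psubst Const \<psi> q'"
  proof (rule mpoly_eqI)
    fix c
    have "mpoly_eval c R = mpoly_eval (\<lambda>v. mpoly_eval c (\<psi> v)) (psubst Const \<psi>' R)"
      by (simp add: mpoly_eval_psubst inv)
    also have "\<dots> = mpoly_eval c (psubst Const \<psi> R) * mpoly_eval c (psubst Const \<psi> q')"
      by (simp add: q(2) ev.hom_mult mpoly_eval_psubst)
    finally show "mpoly_eval c R = mpoly_eval c (R * q * psubst Const \<psi> q')"
      by (simp add: q(1) ev.hom_mult)
  qed
  then have "R * 1 = R * (q * psubst Const \<psi> q')" by (simp add: mult.assoc)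
  then have "q * psubst Const \<psi> q' = 1" using R0 by (metis mult_left_cancel)
  then have "q dvd 1" by (metis dvdI)
  then obtain k where "q = Const k" using mpoly_unit_polys polys_empty by metis
  then have "mpoly_eval (\<lambda>v. mpoly_eval c (\<psi> v)) R = k * mpoly_eval c R" for c
    using arg_cong[OF q(1), of "mpoly_eval c"] by (simp add: mpoly_eval_psubst ev.hom_mult)
  then show ?thesis by blast
qed

section \<open>Diagonal substitutions and weights\<close>

lemma monomial_eval_mult: "monomial_eval (\<lambda>v. x v * y v) \<alpha> = monomial_eval x \<alpha> * monomial_eval y \<alpha>"
  by (simp add: monomial_eval_def power_mult_distrib prod.distrib)

text \<open>A diagonal substitution multiplies every monomial by its own factor and \<open>R\<close>
  as a whole by one constant. Comparing coefficients, all these factors agree.\<close>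

lemma generates_scaling:
  fixes R :: "(coeff_var, complex) mpoly"
  assumes R: "generates n e R" and s: "\<And>v. s v \<noteq> 0"
    and Z: "\<And>c. c \<in> solvable n e \<Longrightarrow> (\<lambda>v. s v * c v) \<in> solvable n e"
    and Z': "\<And>c. c \<in> solvable n e \<Longrightarrow> (\<lambda>v. inverse (s v) * c v) \<in> solvable n e"
  shows "\<exists>k. \<forall>\<mu>\<in>Poly_Mapping.keys R. monomial_eval s \<mu> = k"
proof -
  have "\<exists>k. \<forall>c. mpoly_eval (\<lambda>v. mpoly_eval c (Const (s v) * Var v)) R = k * mpoly_eval c R"
    by (rule generates_symmetry[OF R, of "\<lambda>v. Const (s v) * Var v" "\<lambda>v. Const (inverse (s v)) * Var v"])
      (simp_all add: polys_mult polys_Var ev.hom_mult s Z Z')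
  then obtain k where k: "\<And>c. mpoly_eval (\<lambda>v. s v * c v) R = k * mpoly_eval c R"
    by (auto simp: ev.hom_mult)
  define S where "S = (\<Sum>\<mu>\<in>Poly_Mapping.keys R. Poly_Mapping.single \<mu> (Poly_Mapping.lookup R \<mu> * monomial_eval s \<mu>))"
  have "S = Const k * R"
  proof (rule mpoly_eqI)
    fix c
    have "mpoly_eval c S = mpoly_eval (\<lambda>v. s v * c v) R"
      unfolding mpoly_eval_def[of "\<lambda>v. s v * c v"]
      by (simp add: S_def mpoly_eval_sum mpoly_eval_single monomial_eval_mult mult.assoc)
    then show "mpoly_eval c S = mpoly_eval c (Const k * R)" by (simp add: k ev.hom_mult)
  qed
  then have "Poly_Mapping.lookup S \<mu> = k * Poly_Mapping.lookup R \<mu>" for \<mu> by (simp add: lookup_Const_mult)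
  moreover have "Poly_Mapping.lookup S \<mu> = Poly_Mapping.lookup R \<mu> * monomial_eval s \<mu>" if "\<mu> \<in> Poly_Mapping.keys R" for \<mu>
    using that by (simp add: S_def lookup_sum lookup_single when_def)
  ultimately have "monomial_eval s \<mu> = k" if "\<mu> \<in> Poly_Mapping.keys R" for \<mu>
    using that by (simp add: in_keys_iff)
  then show ?thesis by blast
qed

definition row_deg :: "nat \<Rightarrow> coeff_var monomial \<Rightarrow> nat" where
  "row_deg i \<mu> = (\<Sum>v\<in>Poly_Mapping.keys \<mu>. if fst v = i then Poly_Mapping.lookup \<mu> v else 0)"

lemma monomial_eval_power_scaling:
  "monomial_eval (\<lambda>v. (t::complex) ^ wt v) \<mu> = t ^ (\<Sum>v\<in>Poly_Mapping.keys \<mu>. wt v * Poly_Mapping.lookup \<mu> v)"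
  by (simp add: monomial_eval_def power_sum flip: power_mult)

lemma ex_const_on: "(\<And>x y. x \<in> K \<Longrightarrow> y \<in> K \<Longrightarrow> f x = f y) \<Longrightarrow> \<exists>w. \<forall>x\<in>K. f x = w"
  by blast

text \<open>Scaling by 2 and its inverse is enough, since a power of two determines its
  exponent.\<close>

lemma generates_weight:
  fixes R :: "(coeff_var, complex) mpoly"
  assumes R: "generates n e R"
    and Z: "\<And>c t. c \<in> solvable n e \<Longrightarrow> t \<noteq> 0 \<Longrightarrow> (\<lambda>v. t ^ wt v * c v) \<in> solvable n e"
  shows "\<exists>w. \<forall>\<mu>\<in>Poly_Mapping.keys R. (\<Sum>v\<in>Poly_Mapping.keys \<mu>. wt v * Poly_Mapping.lookup \<mu> v) = w"
proof -
  let ?w = "\<lambda>\<mu>. \<Sum>v\<in>Poly_Mapping.keys \<mu>. wt v * Poly_Mapping.lookup \<mu> v"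
  have "\<exists>k. \<forall>\<mu>\<in>Poly_Mapping.keys R. monomial_eval (\<lambda>v. (2::complex) ^ wt v) \<mu> = k"
  proof (rule generates_scaling[OF R, of "\<lambda>v. 2 ^ wt v"])
    fix c assume c: "c \<in> solvable n e"
    show "(\<lambda>v. 2 ^ wt v * c v) \<in> solvable n e" by (rule Z[OF c]) simp
    show "(\<lambda>v. inverse (2 ^ wt v) * c v) \<in> solvable n e"
      unfolding power_inverse[symmetric] by (rule Z[OF c]) simp
  qed simp
  then obtain k where k: "\<And>\<mu>. \<mu> \<in> Poly_Mapping.keys R \<Longrightarrow> (2::complex) ^ ?w \<mu> = k"
    unfolding monomial_eval_power_scaling by blast
  have "?w \<mu> = ?w \<nu>" if "\<mu> \<in> Poly_Mapping.keys R" "\<nu> \<in> Poly_Mapping.keys R" for \<mu> \<nu>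
  proof -
    have "(2::complex) ^ ?w \<mu> = 2 ^ ?w \<nu>" using k that by simp
    then have "of_nat (2 ^ ?w \<mu>) = (of_nat (2 ^ ?w \<nu>) :: complex)" by simp
    then have "2 ^ ?w \<mu> = (2 ^ ?w \<nu> :: nat)" by (simp only: of_nat_eq_iff)
    then show ?thesis by simp
  qed
  then show ?thesis by (rule ex_const_on)
qed

lemma row_deg_const:
  assumes "generates n e R"
  shows "\<exists>D. \<forall>\<mu>\<in>Poly_Mapping.keys R. row_deg i \<mu> = D"
proof -
  have "\<exists>w. \<forall>\<mu>\<in>Poly_Mapping.keys R. (\<Sum>v\<in>Poly_Mapping.keys \<mu>. (if fst v = i then 1 else 0) * Poly_Mapping.lookup \<mu> v) = w"
  proof (rule generates_weight[OF assms, of "\<lambda>v. if fst v = i then 1 else 0"])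
    fix c t assume c: "c \<in> solvable n e" and t: "(t::complex) \<noteq> 0"
    have "form_eval n e (\<lambda>\<alpha>. t ^ (if fst (k, \<alpha>) = i then 1 else 0) * c (k, \<alpha>)) x =
      t ^ (if k = i then 1 else 0) * form_eval n e (\<lambda>\<alpha>. c (k, \<alpha>)) x" for k x
      by (simp add: form_eval_def sum_distrib_left mult.assoc)
    then show "(\<lambda>v. t ^ (if fst v = i then 1 else 0) * c v) \<in> solvable n e"
      using c unfolding solvable_def by auto
  qed
  moreover have "(\<Sum>v\<in>Poly_Mapping.keys \<mu>. (if fst v = i then 1 else 0) * Poly_Mapping.lookup \<mu> v) = row_deg i \<mu>" for \<mu>
    unfolding row_deg_def by (rule sum.cong) auto
  ultimately show ?thesis by simp
qed

text \<open>Weighting each coefficient by the exponent of \<open>x_j\<close> in its monomial is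
  undone by dividing the coordinate \<open>j\<close> of the zero by \<open>t\<close>.\<close>

lemma torus_weight_const:
  assumes "generates n e R"
  shows "\<exists>w. \<forall>\<mu>\<in>Poly_Mapping.keys R.
    (\<Sum>v\<in>Poly_Mapping.keys \<mu>. Poly_Mapping.lookup (snd v) j * Poly_Mapping.lookup \<mu> v) = w"
proof (rule generates_weight[OF assms, of "\<lambda>v. Poly_Mapping.lookup (snd v) j"])
  fix c t assume c: "c \<in> solvable n e" and t: "(t::complex) \<noteq> 0"
  obtain x k where x: "k \<in> {1..n}" "x k \<noteq> 0" "\<And>i. i \<in> {1..n} \<Longrightarrow> form_eval n e (\<lambda>\<alpha>. c (i, \<alpha>)) x = 0"
    using c unfolding solvable_def by blast
  define y where "y v = (if v = j then x v / t else x v)" for v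
  have m: "t ^ Poly_Mapping.lookup \<alpha> j * monomial_eval y \<alpha> = monomial_eval x \<alpha>" for \<alpha>
  proof (cases "j \<in> Poly_Mapping.keys \<alpha>")
    case True
    have "(\<Prod>v\<in>Poly_Mapping.keys \<alpha> - {j}. y v ^ Poly_Mapping.lookup \<alpha> v) = (\<Prod>v\<in>Poly_Mapping.keys \<alpha> - {j}. x v ^ Poly_Mapping.lookup \<alpha> v)"
      by (rule prod.cong) (auto simp: y_def)
    then show ?thesis
      unfolding monomial_eval_def using True t
      by (simp add: prod.remove[of _ j] y_def power_divide)
  next
    case False
    then have "monomial_eval y \<alpha> = monomial_eval x \<alpha>" by (intro monomial_eval_cong) (auto simp: y_def)
    then show ?thesis using False by (simp add: in_keys_iff)
  qed
  have "form_eval n e (\<lambda>\<alpha>. t ^ Poly_Mapping.lookup (snd (i, \<alpha>)) j * c (i, \<alpha>)) y = form_eval n e (\<lambda>\<alpha>. c (i, \<alpha>)) x" for i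
    unfolding form_eval_def by (rule sum.cong) (simp_all add: mult_ac flip: m)
  then have "\<forall>i\<in>{1..n}. form_eval n e (\<lambda>\<alpha>. t ^ Poly_Mapping.lookup (snd (i, \<alpha>)) j * c (i, \<alpha>)) y = 0"
    using x(3) by simp
  moreover have "y k \<noteq> 0" using x(2) t by (auto simp: y_def)
  ultimately show "(\<lambda>v. t ^ Poly_Mapping.lookup (snd v) j * c v) \<in> solvable n e"
    using x(1) unfolding solvable_def by blast
qed

text \<open>Exchanging two forms is a symmetry that turns scaling the form \<open>i\<close> into
  scaling the form \<open>j\<close>. Comparing both scalings at a system where \<open>R\<close> is
  nonzero gives equal degrees.\<close>

lemma row_deg_symmetric:
  fixes R :: "(coeff_var, complex) mpoly"
  assumes n: "n \<ge> 1" and e: "e \<ge> 1" and R: "generates n e R"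
    and ij: "i \<in> {1..n}" "j \<in> {1..n}"
    and Di: "\<And>\<mu>. \<mu> \<in> Poly_Mapping.keys R \<Longrightarrow> row_deg i \<mu> = Di"
    and Dj: "\<And>\<mu>. \<mu> \<in> Poly_Mapping.keys R \<Longrightarrow> row_deg j \<mu> = Dj"
  shows "Di = Dj"
proof -
  define \<pi> where "\<pi> = Transposition.transpose i j"
  have \<pi>: "\<pi> k \<in> {1..n}" if "k \<in> {1..n}" for k using that ij by (auto simp: \<pi>_def Transposition.transpose_def)
  have \<pi>\<pi>: "\<pi> (\<pi> k) = k" for k by (simp add: \<pi>_def)
  define \<psi> :: "coeff_var \<Rightarrow> (coeff_var, complex) mpoly" where "\<psi> v = Var (\<pi> (fst v), snd v)" for v
  have \<psi>polys: "\<psi> v \<in> polys (coeff_vars n (\<lambda>_. e))" if "v \<in> coeff_vars n (\<lambda>_. e)" for v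
    unfolding \<psi>_def coeff_vars_eq
    by (rule polys_Var, rule SigmaI, rule \<pi>) (use that in \<open>auto simp: coeff_vars_eq\<close>)
  have "(\<lambda>v. mpoly_eval c (\<psi> v)) \<in> solvable n e" if "c \<in> solvable n e" for c
    using that \<pi> by (auto simp: solvable_def \<psi>_def)
  then have "\<exists>k. \<forall>c. mpoly_eval (\<lambda>v. mpoly_eval c (\<psi> v)) R = k * mpoly_eval c R"
    by (intro generates_symmetry[OF R, of \<psi> \<psi>] \<psi>polys) (simp_all add: \<psi>_def \<pi>\<pi>)
  then obtain k where k: "\<And>c. mpoly_eval (\<lambda>v. c (\<pi> (fst v), snd v)) R = k * mpoly_eval c R"
    by (auto simp: \<psi>_def)
  define s where "s l c = (\<lambda>v. (if fst v = l then 2 else 1) * c v)" for l :: nat and c :: "coeff_var \<Rightarrow> complex"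
  have ms: "monomial_eval (s l c) \<mu> = 2 ^ row_deg l \<mu> * monomial_eval c \<mu>" for l c \<mu>
  proof -
    have "monomial_eval (s l c) \<mu> = (\<Prod>v\<in>Poly_Mapping.keys \<mu>. 2 ^ (if fst v = l then Poly_Mapping.lookup \<mu> v else 0) * c v ^ Poly_Mapping.lookup \<mu> v)"
      unfolding monomial_eval_def s_def by (rule prod.cong) (auto simp: power_mult_distrib)
    then show ?thesis by (simp add: prod.distrib row_deg_def power_sum monomial_eval_def)
  qed
  have si: "mpoly_eval (s i c) R = 2 ^ Di * mpoly_eval c R" for c
    by (simp add: mpoly_eval_def ms Di sum_distrib_left mult_ac)
  have sj: "mpoly_eval (s j c) R = 2 ^ Dj * mpoly_eval c R" for c
    by (simp add: mpoly_eval_def ms Dj sum_distrib_left mult_ac)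
  let ?c = "id_sys e"
  have nz: "mpoly_eval ?c R \<noteq> 0" using generates_zero_iff[OF n e R] id_sys_notin_solvable[OF e] by blast
  define pm where "pm c = (\<lambda>v. c (\<pi> (fst v), snd v))" for c :: "coeff_var \<Rightarrow> complex"
  have k: "mpoly_eval (pm c) R = k * mpoly_eval c R" for c
    unfolding pm_def by (rule k)
  have "pm (pm c) = c" for c by (simp add: pm_def \<pi>\<pi>)
  then have "mpoly_eval ?c R = k * mpoly_eval (pm ?c) R" using k[of "pm ?c"] by simp
  then have k0: "k \<noteq> 0" using nz by auto
  have comm: "pm (s i c) = s j (pm c)" for c
    by (auto simp: s_def pm_def \<pi>_def Transposition.transpose_def fun_eq_iff)
  have "k * (2 ^ Di * mpoly_eval ?c R) = k * mpoly_eval (s i ?c) R" by (simp only: si)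
  also have "\<dots> = mpoly_eval (s j (pm ?c)) R" by (simp only: k[symmetric] comm)
  also have "\<dots> = 2 ^ Dj * (k * mpoly_eval ?c R)" by (simp only: sj k)
  finally have "(2::complex) ^ Di = 2 ^ Dj" using k0 nz by simp
  then have "of_nat (2 ^ Di) = (of_nat (2 ^ Dj) :: complex)" by simp
  then have "2 ^ Di = (2 ^ Dj :: nat)" by (simp only: of_nat_eq_iff)
  then show ?thesis by simp
qed

lemma sum_keys_diagonal:
  fixes \<mu> :: "coeff_var monomial" and g :: "coeff_var \<Rightarrow> nat"
  assumes "finite I"
  shows "(\<Sum>u\<in>Poly_Mapping.keys \<mu> \<inter> (\<lambda>i. (i, \<delta> i)) ` I. g u * Poly_Mapping.lookup \<mu> u) =
    (\<Sum>i\<in>I. g (i, \<delta> i) * Poly_Mapping.lookup \<mu> (i, \<delta> i))"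
proof -
  have "(\<Sum>u\<in>Poly_Mapping.keys \<mu> \<inter> (\<lambda>i. (i, \<delta> i)) ` I. g u * Poly_Mapping.lookup \<mu> u) =
    (\<Sum>u\<in>(\<lambda>i. (i, \<delta> i)) ` I. g u * Poly_Mapping.lookup \<mu> u)"
    by (rule sum.mono_neutral_left) (use assms in \<open>auto simp: in_keys_iff\<close>)
  also have "\<dots> = (\<Sum>i\<in>I. g (i, \<delta> i) * Poly_Mapping.lookup \<mu> (i, \<delta> i))"
    by (subst sum.reindex) (auto simp: inj_on_def)
  finally show ?thesis .
qed

lemma sum_indicator_mult:
  fixes f :: "'a \<Rightarrow> nat"
  assumes "finite I" "i \<in> I"
  shows "(\<Sum>j\<in>I. (if j = i then 1 else 0) * f j) = f i"
  using assms by (subst sum.remove[of _ i]) auto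

lemma row_deg_eq: "row_deg i \<mu> = (\<Sum>v\<in>Poly_Mapping.keys \<mu>. (if fst v = i then 1 else 0) * Poly_Mapping.lookup \<mu> v)"
  unfolding row_deg_def by (rule sum.cong) auto

lemma eq_single_if_lookup_eq_degree:
  assumes "\<alpha> \<in> monoms n e" "Poly_Mapping.lookup \<alpha> i = e"
  shows "\<alpha> = Poly_Mapping.single i e"
proof (rule poly_mapping_eqI)
  fix j
  have "Poly_Mapping.lookup \<alpha> j = 0" if "j \<noteq> i"
  proof -
    have "monomial_degree \<alpha> = (\<Sum>v\<in>insert i (insert j (Poly_Mapping.keys \<alpha>)). Poly_Mapping.lookup \<alpha> v)"
      by (rule monomial_degree_superset) auto
    also have "\<dots> \<ge> (\<Sum>v\<in>{i, j}. Poly_Mapping.lookup \<alpha> v)"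
      by (rule sum_mono2) auto
    finally show ?thesis using assms that by (simp add: monoms_def)
  qed
  then show "Poly_Mapping.lookup \<alpha> j = Poly_Mapping.lookup (Poly_Mapping.single i e) j"
    using assms(2) by (auto simp: lookup_single when_def)
qed

text \<open>By the row and torus symmetries a monomial of the resultant that is not purely diagonal contains
  at least two off-diagonal factors. So only the diagonal monomial contributes to the two leading
  coefficients of the characteristic polynomial.\<close>

theorem resultant_shift:
  assumes n: "n \<ge> 1" and e: "e \<ge> 1"
  shows "\<exists>D. \<forall>c. \<exists>E. (\<forall>k. n * D \<le> k + 1 \<longrightarrow> coeff E k = 0) \<and>
    (\<forall>z. mpoly_eval (\<lambda>v. c v - z * id_sys e v) (resultant_mpoly n (\<lambda>_. e)) =
      poly ((\<Prod>i\<in>{1..n}. [:c (i, Poly_Mapping.single i e), -1:] ^ D) + E) z)"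
proof -
  define R where "R = resultant_mpoly n (\<lambda>_. e)"
  have R: "generates n e R" and R1: "mpoly_eval (id_sys e) R = 1"
    using resultant_mpoly[OF n e] by (simp_all add: R_def)
  have RV: "\<And>\<mu>. \<mu> \<in> Poly_Mapping.keys R \<Longrightarrow> Poly_Mapping.keys \<mu> \<subseteq> {1..n} \<times> monoms n e"
    using R unfolding generates_def vanishing_def polys_iff coeff_vars_eq by blast
  have "\<forall>i. \<exists>D. \<forall>\<mu>\<in>Poly_Mapping.keys R. row_deg i \<mu> = D" using row_deg_const[OF R] by blast
  from choice[OF this] obtain Dr where Dr: "\<And>i \<mu>. \<mu> \<in> Poly_Mapping.keys R \<Longrightarrow> row_deg i \<mu> = Dr i" by blast
  define D where "D = Dr 1"
  have D: "row_deg i \<mu> = D" if "i \<in> {1..n}" "\<mu> \<in> Poly_Mapping.keys R" for i \<mu>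
  proof -
    have "Dr i = Dr 1" by (rule row_deg_symmetric[OF n e R]) (use that n Dr in auto)
    then show ?thesis using Dr[OF that(2)] by (simp add: D_def)
  qed
  have "\<forall>j. \<exists>w. \<forall>\<mu>\<in>Poly_Mapping.keys R.
    (\<Sum>v\<in>Poly_Mapping.keys \<mu>. Poly_Mapping.lookup (snd v) j * Poly_Mapping.lookup \<mu> v) = w"
    using torus_weight_const[OF R] by blast
  from choice[OF this] obtain W where W: "\<And>j \<mu>. \<mu> \<in> Poly_Mapping.keys R \<Longrightarrow>
    (\<Sum>v\<in>Poly_Mapping.keys \<mu>. Poly_Mapping.lookup (snd v) j * Poly_Mapping.lookup \<mu> v) = W j" by blast
  define \<delta> where "\<delta> i = Poly_Mapping.single i e" for i :: nat
  define Dg where "Dg = (\<lambda>i. (i, \<delta> i)) ` {1..n}"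
  have id_Dg: "id_sys e v = (if v \<in> Dg then 1 else 0)" if "v \<in> {1..n} \<times> monoms n e" for v
    using that by (auto simp: id_sys_def Dg_def \<delta>_def)
  have id_key: "id_sys e v = (if v \<in> Dg then 1 else 0)" if "\<mu> \<in> Poly_Mapping.keys R" "v \<in> Poly_Mapping.keys \<mu>" for \<mu> v
    by (rule id_Dg, rule subsetD[OF RV[OF that(1)] that(2)])
  define \<mu>0 where "\<mu>0 = (\<Sum>i\<in>{1..n}. Poly_Mapping.single (i, \<delta> i) D)"
  have l\<mu>0: "Poly_Mapping.lookup \<mu>0 v = (if v \<in> Dg then D else 0)" for v
  proof -
    obtain i \<alpha> where v: "v = (i, \<alpha>)" by fastforce
    have "Poly_Mapping.lookup \<mu>0 v = (\<Sum>j\<in>{1..n}. if j = i then if \<alpha> = \<delta> i then D else 0 else 0)"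
      unfolding \<mu>0_def lookup_sum by (rule sum.cong) (auto simp: v lookup_single when_def)
    also have "\<dots> = (if v \<in> Dg then D else 0)" by (auto simp: v Dg_def)
    finally show ?thesis .
  qed
  have diag: "\<mu> = \<mu>0" if \<mu>: "\<mu> \<in> Poly_Mapping.keys R" "Poly_Mapping.keys \<mu> \<subseteq> Dg" for \<mu>
  proof (rule poly_mapping_eqI)
    fix v
    show "Poly_Mapping.lookup \<mu> v = Poly_Mapping.lookup \<mu>0 v"
    proof (cases "v \<in> Dg")
      case True
      then obtain i where i: "i \<in> {1..n}" "v = (i, \<delta> i)" by (auto simp: Dg_def)
      have "D = (\<Sum>v\<in>Poly_Mapping.keys \<mu> \<inter> Dg. (if fst v = i then 1 else 0) * Poly_Mapping.lookup \<mu> v)"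
        using D[OF i(1) \<mu>(1)] \<mu>(2) by (simp only: row_deg_eq Int_absorb2)
      also have "\<dots> = (\<Sum>j\<in>{1..n}. (if j = i then 1 else 0) * Poly_Mapping.lookup \<mu> (j, \<delta> j))"
        unfolding Dg_def by (subst sum_keys_diagonal) simp_all
      also have "\<dots> = Poly_Mapping.lookup \<mu> v" using i by (simp only: sum_indicator_mult finite_atLeastAtMost)
      finally show ?thesis using True by (simp add: l\<mu>0)
    next
      case False
      then have "v \<notin> Poly_Mapping.keys \<mu>" using \<mu>(2) by blast
      then show ?thesis using False by (simp add: l\<mu>0 in_keys_iff)
    qed
  qed
  have idm: "monomial_eval (id_sys e) \<mu> = (if Poly_Mapping.keys \<mu> \<subseteq> Dg then 1 else 0)" if \<mu>: "\<mu> \<in> Poly_Mapping.keys R" for \<mu>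
  proof (cases "Poly_Mapping.keys \<mu> \<subseteq> Dg")
    case True
    have "id_sys e v = 1" if "v \<in> Poly_Mapping.keys \<mu>" for v
      unfolding id_key[OF \<mu> that] by (rule if_P, rule subsetD[OF True that])
    then show ?thesis using True by (simp add: monomial_eval_def)
  next
    case False
    then obtain v where v: "v \<in> Poly_Mapping.keys \<mu>" "v \<notin> Dg" by blast
    then have "id_sys e v = 0" by (simp only: id_key[OF \<mu>] if_False)
    then have "id_sys e v ^ Poly_Mapping.lookup \<mu> v = 0" using v(1) by (simp add: in_keys_iff)
    then have "monomial_eval (id_sys e) \<mu> = 0" unfolding monomial_eval_def using v(1) by (intro prod_zero) auto
    then show ?thesis using False by simp
  qed
  define S where "S = {\<mu> \<in> Poly_Mapping.keys R. Poly_Mapping.keys \<mu> \<subseteq> Dg}"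
  have "1 = (\<Sum>\<mu>\<in>Poly_Mapping.keys R. if Poly_Mapping.keys \<mu> \<subseteq> Dg then Poly_Mapping.lookup R \<mu> else 0)"
    using R1 by (simp add: mpoly_eval_def idm if_distrib cong: if_cong)
  also have "\<dots> = (\<Sum>\<mu>\<in>S. Poly_Mapping.lookup R \<mu>)"
    by (simp add: S_def sum.If_cases Int_def)
  finally have S1: "(\<Sum>\<mu>\<in>S. Poly_Mapping.lookup R \<mu>) = 1" by simp
  have "S \<subseteq> {\<mu>0}" using diag unfolding S_def by blast
  moreover have "S \<noteq> {}" using S1 by auto
  ultimately have S: "S = {\<mu>0}" by blast
  then have \<mu>0R: "\<mu>0 \<in> Poly_Mapping.keys R" by (auto simp: S_def)
  have l1: "Poly_Mapping.lookup R \<mu>0 = 1" using S1 S by simp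
  have \<mu>0Dg: "Poly_Mapping.keys \<mu>0 \<subseteq> Dg" using S by (auto simp: S_def)
  \<comment> \<open>The weight is common to all monomials of \<open>R\<close>, so it can be computed
    on the diagonal one.\<close>
  have W_eq: "W i = e * D" if i: "i \<in> {1..n}" for i
  proof -
    have "W i = (\<Sum>v\<in>Poly_Mapping.keys \<mu>0 \<inter> Dg. Poly_Mapping.lookup (snd v) i * Poly_Mapping.lookup \<mu>0 v)"
      using W[OF \<mu>0R, of i] \<mu>0Dg by (simp only: Int_absorb2)
    also have "\<dots> = (\<Sum>j\<in>{1..n}. Poly_Mapping.lookup (\<delta> j) i * Poly_Mapping.lookup \<mu>0 (j, \<delta> j))"
      unfolding Dg_def by (subst sum_keys_diagonal) simp_all
    also have "\<dots> = (\<Sum>j\<in>{1..n}. if j = i then e * D else 0)"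
      by (rule sum.cong) (auto simp: \<delta>_def lookup_single when_def l\<mu>0 Dg_def)
    finally show ?thesis using i by simp
  qed
  define nd where "nd \<mu> = (\<Sum>v\<in>Poly_Mapping.keys \<mu> - Dg. Poly_Mapping.lookup \<mu> v)" for \<mu> :: "coeff_var monomial"
  have nd: "nd \<mu> \<ge> 2" if \<mu>: "\<mu> \<in> Poly_Mapping.keys R" "\<mu> \<noteq> \<mu>0" for \<mu>
  proof (rule ccontr)
    assume less: "\<not> nd \<mu> \<ge> 2"
    obtain v where v: "v \<in> Poly_Mapping.keys \<mu>" "v \<notin> Dg" using diag \<mu> by blast
    have v1: "Poly_Mapping.lookup \<mu> v \<ge> 1" using v(1) by (simp add: in_keys_iff)
    have split: "nd \<mu> = Poly_Mapping.lookup \<mu> v + (\<Sum>u\<in>Poly_Mapping.keys \<mu> - Dg - {v}. Poly_Mapping.lookup \<mu> u)"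
      unfolding nd_def using v by (intro sum.remove) auto
    have "Poly_Mapping.keys \<mu> - Dg - {v} = {}"
    proof (rule ccontr)
      assume "Poly_Mapping.keys \<mu> - Dg - {v} \<noteq> {}"
      then obtain u where u: "u \<in> Poly_Mapping.keys \<mu> - Dg - {v}" by blast
      then have "Poly_Mapping.lookup \<mu> u \<le> (\<Sum>u\<in>Poly_Mapping.keys \<mu> - Dg - {v}. Poly_Mapping.lookup \<mu> u)"
        by (intro member_le_sum) auto
      moreover have "Poly_Mapping.lookup \<mu> u \<ge> 1" using u by (simp add: in_keys_iff)
      ultimately show False using split v1 less by linarith
    qed
    then have K: "Poly_Mapping.keys \<mu> = insert v (Poly_Mapping.keys \<mu> \<inter> Dg)" using v by blast
    have lv: "Poly_Mapping.lookup \<mu> v = 1" using split v1 less by linarith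
    obtain i \<alpha> where v_eq: "v = (i, \<alpha>)" by fastforce
    have i: "i \<in> {1..n}" and \<alpha>: "\<alpha> \<in> monoms n e" using RV[OF \<mu>(1)] v(1) v_eq by auto
    have sum_K: "(\<Sum>u\<in>Poly_Mapping.keys \<mu>. g u * Poly_Mapping.lookup \<mu> u) =
      g v + (\<Sum>j\<in>{1..n}. g (j, \<delta> j) * Poly_Mapping.lookup \<mu> (j, \<delta> j))" for g :: "coeff_var \<Rightarrow> nat"
    proof -
      have "(\<Sum>u\<in>Poly_Mapping.keys \<mu>. g u * Poly_Mapping.lookup \<mu> u) =
        g v * Poly_Mapping.lookup \<mu> v + (\<Sum>u\<in>Poly_Mapping.keys \<mu> \<inter> Dg. g u * Poly_Mapping.lookup \<mu> u)"
        by (subst K, subst sum.insert) (use v in auto)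
      then show ?thesis by (simp add: lv Dg_def sum_keys_diagonal)
    qed
    \<comment> \<open>With a single off-diagonal factor \<open>(i, \<alpha>)\<close>, the row degree
      leaves exponent \<open>D - 1\<close> for the diagonal variable of row \<open>i\<close>. The
      torus weight then reads \<open>e * D = lookup \<alpha> i + e * (D - 1)\<close>, which makes
      \<open>\<alpha>\<close> the pure power after all.\<close>
    have "1 + (\<Sum>j\<in>{1..n}. (if j = i then 1 else 0) * Poly_Mapping.lookup \<mu> (j, \<delta> j)) = D"
      using D[OF i \<mu>(1)] unfolding row_deg_eq sum_K by (simp only: v_eq fst_conv simp_thms if_True)
    then have D_eq: "D = 1 + Poly_Mapping.lookup \<mu> (i, \<delta> i)"
      using sum_indicator_mult[OF _ i, of "\<lambda>j. Poly_Mapping.lookup \<mu> (j, \<delta> j)"] by (metis finite_atLeastAtMost)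
    have "e * D = Poly_Mapping.lookup \<alpha> i + (\<Sum>j\<in>{1..n}. Poly_Mapping.lookup (\<delta> j) i * Poly_Mapping.lookup \<mu> (j, \<delta> j))"
      using W[OF \<mu>(1), of i, symmetric] unfolding W_eq[OF i] sum_K by (simp only: v_eq snd_conv)
    also have "(\<Sum>j\<in>{1..n}. Poly_Mapping.lookup (\<delta> j) i * Poly_Mapping.lookup \<mu> (j, \<delta> j)) =
      (\<Sum>j\<in>{1..n}. if j = i then e * Poly_Mapping.lookup \<mu> (i, \<delta> i) else 0)"
      by (rule sum.cong) (auto simp: \<delta>_def lookup_single when_def)
    also have "\<dots> = e * Poly_Mapping.lookup \<mu> (i, \<delta> i)" using i by simp
    finally have "Poly_Mapping.lookup \<alpha> i = e" by (simp add: D_eq)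
    then have "\<alpha> = \<delta> i" unfolding \<delta>_def by (rule eq_single_if_lookup_eq_degree[OF \<alpha>])
    then show False using v(2) v_eq i by (auto simp: Dg_def)
  qed
  have total: "(\<Sum>v\<in>Poly_Mapping.keys \<mu>. Poly_Mapping.lookup \<mu> v) = n * D" if \<mu>: "\<mu> \<in> Poly_Mapping.keys R" for \<mu>
  proof -
    have "(\<Sum>v\<in>Poly_Mapping.keys \<mu>. Poly_Mapping.lookup \<mu> v) =
      (\<Sum>v\<in>Poly_Mapping.keys \<mu>. \<Sum>i\<in>{1..n}. if fst v = i then Poly_Mapping.lookup \<mu> v else 0)"
      using RV[OF \<mu>] by (intro sum.cong refl) auto
    also have "\<dots> = (\<Sum>i\<in>{1..n}. row_deg i \<mu>)"
      unfolding row_deg_def by (rule sum.swap)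
    also have "\<dots> = n * D" using D \<mu> by simp
    finally show ?thesis .
  qed
  have "\<exists>E. (\<forall>k. n * D \<le> k + 1 \<longrightarrow> coeff E k = 0) \<and>
    (\<forall>z. mpoly_eval (\<lambda>v. c v - z * id_sys e v) R =
      poly ((\<Prod>i\<in>{1..n}. [:c (i, Poly_Mapping.single i e), -1:] ^ D) + E) z)" for c
  proof -
    define q where "q v = [:c v, - id_sys e v:]" for v
    define E where "E = (\<Sum>\<mu>\<in>Poly_Mapping.keys R - {\<mu>0}. Polynomial.smult (Poly_Mapping.lookup R \<mu>) (monomial_eval q \<mu>))"
    have pq: "poly (monomial_eval q \<mu>) z = monomial_eval (\<lambda>v. c v - z * id_sys e v) \<mu>" for \<mu> z
      by (simp add: monomial_eval_def poly_prod q_def)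
    have "monomial_eval q \<mu>0 = (\<Prod>v\<in>Dg. q v ^ Poly_Mapping.lookup \<mu>0 v)"
      by (rule monomial_eval_superset[OF _ \<mu>0Dg]) (simp add: Dg_def)
    also have "\<dots> = (\<Prod>v\<in>Dg. q v ^ D)" by (simp add: l\<mu>0)
    also have "\<dots> = (\<Prod>i\<in>{1..n}. q (i, \<delta> i) ^ D)"
      unfolding Dg_def by (subst prod.reindex) (auto simp: inj_on_def)
    also have "\<dots> = (\<Prod>i\<in>{1..n}. [:c (i, Poly_Mapping.single i e), -1:] ^ D)"
      by (simp add: q_def \<delta>_def id_sys_def)
    finally have m0: "monomial_eval q \<mu>0 = (\<Prod>i\<in>{1..n}. [:c (i, Poly_Mapping.single i e), -1:] ^ D)" .
    have "mpoly_eval (\<lambda>v. c v - z * id_sys e v) R =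
      poly ((\<Prod>i\<in>{1..n}. [:c (i, Poly_Mapping.single i e), -1:] ^ D) + E) z" for z
    proof -
      have "mpoly_eval (\<lambda>v. c v - z * id_sys e v) R =
        poly (\<Sum>\<mu>\<in>Poly_Mapping.keys R. Polynomial.smult (Poly_Mapping.lookup R \<mu>) (monomial_eval q \<mu>)) z"
        by (simp add: mpoly_eval_def poly_sum pq)
      also have "(\<Sum>\<mu>\<in>Poly_Mapping.keys R. Polynomial.smult (Poly_Mapping.lookup R \<mu>) (monomial_eval q \<mu>)) =
        monomial_eval q \<mu>0 + E"
        unfolding E_def using \<mu>0R l1 by (subst sum.remove[of _ \<mu>0]) auto
      finally show ?thesis by (simp only: m0)
    qed
    \<comment> \<open>The bound means \<open>k >= n * D - 1\<close>, written without truncated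
      subtraction. Only diagonal coefficients depend on \<open>z\<close>, and the monomials in
      \<open>E\<close> have at most \<open>n * D - 2\<close> of them.\<close>
    moreover have "coeff E k = 0" if k: "n * D \<le> k + 1" for k
    proof -
      have "coeff (monomial_eval q \<mu>) k = 0" if \<mu>: "\<mu> \<in> Poly_Mapping.keys R - {\<mu>0}" for \<mu>
      proof (rule coeff_eq_0)
        have dq: "degree (q v) \<le> (if v \<in> Dg then 1 else 0)" if "v \<in> Poly_Mapping.keys \<mu>" for v
          using id_key[of \<mu> v] \<mu> that by (simp add: q_def)
        have "degree (monomial_eval q \<mu>) \<le> (\<Sum>v\<in>Poly_Mapping.keys \<mu>. degree (q v ^ Poly_Mapping.lookup \<mu> v))"
          unfolding monomial_eval_def using degree_prod_sum_le[of "Poly_Mapping.keys \<mu>" "\<lambda>v. q v ^ Poly_Mapping.lookup \<mu> v"]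
          by (simp add: o_def)
        also have "\<dots> \<le> (\<Sum>v\<in>Poly_Mapping.keys \<mu>. if v \<in> Dg then Poly_Mapping.lookup \<mu> v else 0)"
        proof (rule sum_mono)
          fix v assume v: "v \<in> Poly_Mapping.keys \<mu>"
          have "degree (q v ^ Poly_Mapping.lookup \<mu> v) \<le> degree (q v) * Poly_Mapping.lookup \<mu> v"
            by (rule degree_power_le)
          also have "\<dots> \<le> (if v \<in> Dg then 1 else 0) * Poly_Mapping.lookup \<mu> v"
            by (rule mult_right_mono[OF dq[OF v]]) simp
          finally show "degree (q v ^ Poly_Mapping.lookup \<mu> v) \<le> (if v \<in> Dg then Poly_Mapping.lookup \<mu> v else 0)"
            by (simp split: if_splits)
        qed
        also have "\<dots> = (\<Sum>v\<in>Poly_Mapping.keys \<mu> \<inter> Dg. Poly_Mapping.lookup \<mu> v)"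
          by (simp add: sum.inter_restrict)
        finally have "degree (monomial_eval q \<mu>) \<le> (\<Sum>v\<in>Poly_Mapping.keys \<mu> \<inter> Dg. Poly_Mapping.lookup \<mu> v)" .
        moreover have "(\<Sum>v\<in>Poly_Mapping.keys \<mu> \<inter> Dg. Poly_Mapping.lookup \<mu> v) + nd \<mu> = n * D"
          unfolding nd_def using total[of \<mu>] \<mu> sum.Int_Diff[of "Poly_Mapping.keys \<mu>" "Poly_Mapping.lookup \<mu>" Dg] by simp
        moreover have "nd \<mu> \<ge> 2" using nd \<mu> by blast
        ultimately show "degree (monomial_eval q \<mu>) < k" using k by linarith
      qed
      then show ?thesis by (simp add: E_def coeff_sum)
    qed
    ultimately show ?thesis by blast
  qed
  then show ?thesis unfolding R_def by blast
qed

section \<open>The two leading coefficients of the characteristic polynomial\<close>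

lemma keys_index_monomial: "Poly_Mapping.keys (index_monomial js) = set js"
proof (induction js)
  case (Cons j js)
  have "index_monomial (j # js) = Poly_Mapping.single j 1 + index_monomial js"
    by (simp add: index_monomial_def)
  moreover have "Poly_Mapping.lookup (index_monomial js) v \<noteq> 0 \<longleftrightarrow> v \<in> set js" for v
    unfolding in_keys_iff[symmetric] Cons.IH ..
  ultimately have "v \<in> Poly_Mapping.keys (index_monomial (j # js)) \<longleftrightarrow> v \<in> set (j # js)" for v
    by (auto simp: in_keys_iff lookup_add lookup_single when_def)
  then show ?case by (rule Set.set_eqI)
qed (simp add: index_monomial_def)

lemma index_monomial_replicate: "index_monomial (replicate e i) = Poly_Mapping.single i e"
  by (induction e) (simp_all add: index_monomial_def flip: single_add)

lemma index_monomial_eq_single: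
  assumes "length js = e" "index_monomial js = Poly_Mapping.single i e"
  shows "js = replicate e i"
proof -
  have "set js \<subseteq> {i}"
    unfolding keys_index_monomial[symmetric] assms(2) by simp
  then show ?thesis using assms(1) by (intro replicate_eqI) auto
qed

lemma identity_tensor_Cons:
  assumes "length js = e"
  shows "identity_tensor (i # js) = (if js = replicate e i then 1 else 0)"
proof -
  have "(\<forall>a\<in>set (i # js). \<forall>b\<in>set (i # js). a = b) \<longleftrightarrow> js = replicate e i"
  proof
    assume "\<forall>a\<in>set (i # js). \<forall>b\<in>set (i # js). a = b"
    then have "b = i" if "b \<in> set js" for b using that by auto
    then show "js = replicate e i" using assms by (intro replicate_eqI)
  next
    assume "js = replicate e i"
    then have "set (i # js) \<subseteq> {i}" by auto
    then show "\<forall>a\<in>set (i # js). \<forall>b\<in>set (i # js). a = b" by blast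
  qed
  then show ?thesis by (simp only: identity_tensor_def)
qed

lemma lookup_tensor_form:
  "Poly_Mapping.lookup (tensor_form n m A i) \<alpha> =
    (\<Sum>js\<in>multi_indices n (m - 1). if index_monomial js = \<alpha> then A (i # js) else 0)"
  unfolding tensor_form_def lookup_sum by (rule sum.cong) (auto simp: lookup_single when_def)

lemma replicate_in_multi_indices: "i \<in> {1..n} \<Longrightarrow> replicate e i \<in> multi_indices n e"
  by (auto simp: multi_indices_def)

lemma lookup_tensor_form_diagonal:
  assumes "i \<in> {1..n}" "m \<ge> 1"
  shows "Poly_Mapping.lookup (tensor_form n m A i) (Poly_Mapping.single i (m - 1)) = A (replicate m i)"
proof -
  have "Poly_Mapping.lookup (tensor_form n m A i) (Poly_Mapping.single i (m - 1)) =
    (\<Sum>js\<in>multi_indices n (m - 1). if js = replicate (m - 1) i then A (i # replicate (m - 1) i) else 0)"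
    unfolding lookup_tensor_form
    by (rule sum.cong) (auto simp: multi_indices_def index_monomial_replicate dest: index_monomial_eq_single)
  also have "\<dots> = A (i # replicate (m - 1) i)"
    using replicate_in_multi_indices[OF assms(1)] by (simp add: finite_multi_indices)
  also have "i # replicate (m - 1) i = replicate m i"
    using assms(2) by (cases m) simp_all
  finally show ?thesis .
qed

text \<open>Among the multi-indices starting with \<open>i\<close>, the identity tensor is supported
  on the constant one, which gives the pure power of \<open>x_i\<close>. So the tensor shift is the
  coefficient shift of \<open>resultant_shift\<close>.\<close>

lemma lookup_tensor_form_shift:
  assumes "i \<in> {1..n}"
  shows "Poly_Mapping.lookup (tensor_form n m (\<lambda>js. A js - z * identity_tensor js) i) \<alpha> =
    Poly_Mapping.lookup (tensor_form n m A i) \<alpha> - z * id_sys (m - 1) (i, \<alpha>)"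
proof -
  have "(\<Sum>js\<in>multi_indices n (m - 1). if index_monomial js = \<alpha> then z * identity_tensor (i # js) else 0) =
    (\<Sum>js\<in>multi_indices n (m - 1). if js = replicate (m - 1) i then z * id_sys (m - 1) (i, \<alpha>) else 0)"
  proof (rule sum.cong[OF refl])
    fix js assume js: "js \<in> multi_indices n (m - 1)"
    then have l: "length js = m - 1" by (simp add: multi_indices_def)
    show "(if index_monomial js = \<alpha> then z * identity_tensor (i # js) else 0) =
      (if js = replicate (m - 1) i then z * id_sys (m - 1) (i, \<alpha>) else 0)"
      unfolding identity_tensor_Cons[OF l] by (auto simp: id_sys_def index_monomial_replicate)
  qed
  also have "\<dots> = z * id_sys (m - 1) (i, \<alpha>)"
    using replicate_in_multi_indices[OF assms] by (simp add: finite_multi_indices)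
  finally have s: "(\<Sum>js\<in>multi_indices n (m - 1). if index_monomial js = \<alpha> then z * identity_tensor (i # js) else 0) =
    z * id_sys (m - 1) (i, \<alpha>)" .
  show ?thesis
    unfolding lookup_tensor_form s[symmetric] sum_subtractf[symmetric] by (rule sum.cong) auto
qed

lemma char_poly_expansion:
  assumes n: "n \<ge> 1" and m: "m \<ge> 2"
  shows "\<exists>D. \<forall>A. \<exists>E. (\<forall>k. n * D \<le> k + 1 \<longrightarrow> coeff E k = 0) \<and>
    char_poly n m A = (\<Prod>i\<in>{1..n}. [:A (replicate m i), -1:] ^ D) + E"
proof -
  let ?e = "m - 1" and ?R = "resultant_mpoly n (\<lambda>_. m - 1)"
  have e: "?e \<ge> 1" using m by simp
  obtain D where D: "\<forall>c. \<exists>E. (\<forall>k. n * D \<le> k + 1 \<longrightarrow> coeff E k = 0) \<and>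
    (\<forall>z. mpoly_eval (\<lambda>v. c v - z * id_sys ?e v) ?R =
      poly ((\<Prod>i\<in>{1..n}. [:c (i, Poly_Mapping.single i ?e), -1:] ^ D) + E) z)"
    using resultant_shift[OF n e] by (elim exE)
  have RV: "?R \<in> polys (coeff_vars n (\<lambda>_. ?e))"
    using resultant_mpoly(1)[OF n e] by (simp add: generates_def vanishing_def)
  have "\<exists>E. (\<forall>k. n * D \<le> k + 1 \<longrightarrow> coeff E k = 0) \<and>
    char_poly n m A = (\<Prod>i\<in>{1..n}. [:A (replicate m i), -1:] ^ D) + E" for A
  proof -
    define c where "c = (\<lambda>(i, \<alpha>). Poly_Mapping.lookup (tensor_form n m A i) \<alpha>)"
    obtain E where E: "\<forall>k. n * D \<le> k + 1 \<longrightarrow> coeff E k = 0"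
      "\<forall>z. mpoly_eval (\<lambda>v. c v - z * id_sys ?e v) ?R =
        poly ((\<Prod>i\<in>{1..n}. [:c (i, Poly_Mapping.single i ?e), -1:] ^ D) + E) z"
      using spec[OF D, of c] by (elim exE conjE)
    have cd: "(\<Prod>i\<in>{1..n}. [:c (i, Poly_Mapping.single i ?e), -1:] ^ D) = (\<Prod>i\<in>{1..n}. [:A (replicate m i), -1:] ^ D)"
    proof (rule prod.cong[OF refl])
      fix i assume "i \<in> {1..n}"
      then have "c (i, Poly_Mapping.single i ?e) = A (replicate m i)"
        using lookup_tensor_form_diagonal m by (simp add: c_def)
      then show "[:c (i, Poly_Mapping.single i ?e), -1:] ^ D = [:A (replicate m i), -1:] ^ D" by simp
    qed
    have "poly (char_poly n m A) z = poly ((\<Prod>i\<in>{1..n}. [:A (replicate m i), -1:] ^ D) + E) z" for z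
    proof -
      have "poly (char_poly n m A) z = mpoly_eval (\<lambda>v. c v - z * id_sys ?e v) ?R"
        unfolding poly_char_poly tensor_det_def resultant_def eval_at_coeffs_def
      proof (rule mpoly_eval_cong[OF RV])
        fix v assume "v \<in> coeff_vars n (\<lambda>_. ?e)"
        then obtain i \<alpha> where v: "v = (i, \<alpha>)" "i \<in> {1..n}" by (auto simp: coeff_vars_eq)
        show "(\<lambda>(i, \<alpha>). Poly_Mapping.lookup (tensor_form n m (\<lambda>js. A js - z * identity_tensor js) i) \<alpha>) v =
          c v - z * id_sys ?e v"
          by (simp only: v(1) c_def case_prod_conv lookup_tensor_form_shift[OF v(2)])
      qed
      then show ?thesis using E(2) by (simp only: cd)
    qed
    then have "char_poly n m A = (\<Prod>i\<in>{1..n}. [:A (replicate m i), -1:] ^ D) + E"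
      by (simp add: poly_eq_poly_eq_iff[symmetric] fun_eq_iff)
    then show ?thesis using E(1) by blast
  qed
  then show ?thesis by blast
qed

text \<open>Vieta's formulas for the two top coefficients. Roots are given as a family so that they
  may repeat, both as eigenvalues and as diagonal entries taken \<open>D\<close> times.\<close>

lemma monic_linear_product:
  fixes f :: "'a \<Rightarrow> 'b::idom"
  assumes "finite S"
  shows "degree (\<Prod>a\<in>S. [:- f a, 1:]) = card S \<and> coeff (\<Prod>a\<in>S. [:- f a, 1:]) (card S) = 1 \<and>
    (S \<noteq> {} \<longrightarrow> coeff (\<Prod>a\<in>S. [:- f a, 1:]) (card S - 1) = - (\<Sum>a\<in>S. f a))"
  using assms
proof (induction S rule: finite_induct)
  case (insert x S)
  define P where "P = (\<Prod>a\<in>S. [:- f a, 1:])"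
  have P: "degree P = card S" "coeff P (card S) = 1" "S \<noteq> {} \<Longrightarrow> coeff P (card S - 1) = - (\<Sum>a\<in>S. f a)"
    using insert.IH by (simp_all add: P_def)
  have P0: "P \<noteq> 0" using P(2) by auto
  have e: "(\<Prod>a\<in>insert x S. [:- f a, 1:]) = [:- f x, 1:] * P"
    unfolding P_def by (rule prod.insert[OF insert.hyps])
  have d: "degree ([:- f x, 1:] * P) = Suc (card S)"
    using P0 P(1) by (subst degree_mult_eq) simp_all
  have c: "coeff ([:- f x, 1:] * P) (Suc k) = coeff P k - f x * coeff P (Suc k)" for k
    by (simp add: coeff_pCons)
  have c0: "coeff ([:- f x, 1:] * P) 0 = - f x * coeff P 0"
    by (simp add: coeff_pCons)
  have "coeff ([:- f x, 1:] * P) (Suc (card S)) = 1"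
    using P(1,2) by (simp only: c) (simp add: coeff_eq_0)
  moreover have "coeff ([:- f x, 1:] * P) (card S) = - (\<Sum>a\<in>insert x S. f a)"
  proof (cases "S = {}")
    case True
    then show ?thesis using P(2) c0 by simp
  next
    case False
    then obtain k where k: "card S = Suc k" using insert.hyps by (metis card_eq_0_iff not0_implies_Suc)
    then show ?thesis using P False insert.hyps by (simp only: c) simp
  qed
  ultimately show ?case unfolding e using d insert.hyps by simp
qed simp

text \<open>The remainder \<open>E\<close> does not reach degree \<open>n * D - 1\<close>, so there
  the coefficients from the eigenvalues and from the diagonal entries can be compared. The product
  of the eigenvalues is the value of the characteristic polynomial at 0.\<close>

theorem eigenvalue_sum_prod:
  fixes lam :: "nat \<Rightarrow> complex"
  assumes n: "n \<ge> 1" and m: "m \<ge> 2" and d: "d = n * (m - 1) ^ (n - 1)"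
    and ev: "tensor_eigenvalues n m A = image_mset lam (mset_set {1..d})"
  shows "(\<Sum>i=1..d. lam i) = of_nat ((m - 1) ^ (n - 1)) * tensor_trace n m A"
    and "(\<Prod>i=1..d. lam i) = tensor_det n m A"
proof -
  obtain D where "\<forall>A. \<exists>E. (\<forall>k. n * D \<le> k + 1 \<longrightarrow> coeff E k = 0) \<and>
    char_poly n m A = (\<Prod>i\<in>{1..n}. [:A (replicate m i), -1:] ^ D) + E"
    using char_poly_expansion[OF n m] by (elim exE)
  from spec[OF this, of A] obtain E where E: "\<forall>k. n * D \<le> k + 1 \<longrightarrow> coeff E k = 0"
    "char_poly n m A = (\<Prod>i\<in>{1..n}. [:A (replicate m i), -1:] ^ D) + E" by (elim exE conjE)
  define p where "p = char_poly n m A"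
  define a where "a i = A (replicate m i)" for i
  define G where "G = (\<Prod>(i, k)\<in>{1..n} \<times> {..<D}. [:- a i, 1:])"
  have d1: "d \<ge> 1" using n m d by simp
  have pr: "proots p = image_mset lam (mset_set {1..d})" using ev by (simp add: p_def tensor_eigenvalues_def)
  \<comment> \<open>The zero polynomial has the empty multiset as \<open>proots\<close>, whereas
    \<open>d >= 1\<close> eigenvalues are given.\<close>
  have p0: "p \<noteq> 0"
  proof
    assume "p = 0"
    then have "size (proots p) = 0" by simp
    then show False using pr d1 by simp
  qed
  have "[:a i, -1:] = Polynomial.smult (-1) [:- a i, 1:]" for i by simp
  then have "(\<Prod>i\<in>{1..n}. [:a i, -1:] ^ D) = (\<Prod>i\<in>{1..n}. Polynomial.smult ((-1) ^ D) ([:- a i, 1:] ^ D))"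
    by (metis smult_power)
  also have "\<dots> = Polynomial.smult ((-1) ^ (n * D)) (\<Prod>i\<in>{1..n}. [:- a i, 1:] ^ D)"
    by (simp add: prod_smult mult.commute flip: power_mult)
  also have "(\<Prod>i\<in>{1..n}. [:- a i, 1:] ^ D) = G"
    by (simp add: G_def prod.cartesian_product[symmetric])
  finally have pG: "p = Polynomial.smult ((-1) ^ (n * D)) G + E" using E(2) by (simp add: p_def a_def)
  have G: "degree G = n * D" "coeff G (n * D) = 1"
    "n * D > 0 \<Longrightarrow> coeff G (n * D - 1) = - (\<Sum>(i, k)\<in>{1..n} \<times> {..<D}. a i)"
    using monic_linear_product[of "{1..n} \<times> {..<D}" "\<lambda>(i, k). a i"]
    by (auto simp: G_def case_prod_unfold)
  have dp: "degree p = n * D"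
  proof (rule antisym)
    show "degree p \<le> n * D"
      unfolding pG by (rule degree_le) (use E(1) G(1) in \<open>auto simp: coeff_eq_0\<close>)
    show "n * D \<le> degree p"
      by (rule le_degree) (use E(1) G(2) in \<open>simp add: pG\<close>)
  qed
  have lcp: "lead_coeff p = (-1) ^ (n * D)"
    unfolding dp using E(1) G(2) by (simp add: pG)
  define L where "L = (\<Prod>i\<in>{1..d}. [:- lam i, 1:])"
  have "p = Polynomial.smult (lead_coeff p) (\<Prod>x\<in>#proots p. [:- x, 1:])"
    by (rule complex_poly_decompose_multiset[symmetric])
  also have "(\<Prod>x\<in>#proots p. [:- x, 1:]) = L"
    by (simp add: pr L_def prod_unfold_prod_mset image_mset.compositionality o_def)
  finally have pL: "p = Polynomial.smult ((-1) ^ (n * D)) L" by (simp only: lcp)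
  have L: "degree L = d" "coeff L (d - 1) = - (\<Sum>i\<in>{1..d}. lam i)"
    using monic_linear_product[of "{1..d}" lam] d1 by (auto simp: L_def)
  \<comment> \<open>Over the complex numbers the degree is the number of roots. This determines the
    row degree \<open>D\<close> of the resultant, which was unknown until here.\<close>
  have dD: "d = n * D" using dp pL L(1) by simp
  then have D_eq: "D = (m - 1) ^ (n - 1)" using d n by simp
  have "coeff p (d - 1) = (-1) ^ (n * D) * - (\<Sum>i\<in>{1..d}. lam i)" by (simp only: pL coeff_smult L(2))
  moreover have "coeff p (d - 1) = (-1) ^ (n * D) * - (\<Sum>(i, k)\<in>{1..n} \<times> {..<D}. a i)"
    using E(1) G(3) d1 unfolding pG dD by simp
  ultimately have "(\<Sum>i\<in>{1..d}. lam i) = (\<Sum>(i, k)\<in>{1..n} \<times> {..<D}. a i)" by simp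
  also have "\<dots> = of_nat D * (\<Sum>i\<in>{1..n}. a i)"
    by (simp add: sum.cartesian_product[symmetric] sum_distrib_left)
  finally show "(\<Sum>i=1..d. lam i) = of_nat ((m - 1) ^ (n - 1)) * tensor_trace n m A"
    by (simp add: D_eq tensor_trace_def a_def)
  have "tensor_det n m A = poly p 0" by (simp add: p_def poly_char_poly)
  also have "\<dots> = (-1) ^ d * (\<Prod>i\<in>{1..d}. - lam i)" by (simp add: pL L_def poly_prod dD)
  also have "(\<Prod>i\<in>{1..d}. - lam i) = (-1) ^ d * (\<Prod>i\<in>{1..d}. lam i)" by (simp add: prod_uminus)
  also have "(-1) ^ d * ((-1) ^ d * (\<Prod>i\<in>{1..d}. lam i)) = (\<Prod>i\<in>{1..d}. lam i)"
    by (simp flip: power_mult_distrib mult.assoc)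
  finally show "(\<Prod>i=1..d. lam i) = tensor_det n m A" by simp
qed

section \<open>The inequalities\<close>

text \<open>The inequality of the means raised to the power \<open>card S\<close>. In this form it
  holds for the empty set too, with \<open>0 ^ 0 = 1\<close>, matching the convention for
  \<open>k = 1\<close>.\<close>

lemma prod_power_le_mean:
  fixes f :: "'a \<Rightarrow> real"
  assumes "finite S" "\<And>i. i \<in> S \<Longrightarrow> 0 < f i" "(\<Sum>i\<in>S. f i) \<le> T" "0 < T"
  shows "(real (card S) / T) ^ card S * (\<Prod>i\<in>S. f i) \<le> 1"
proof (cases "S = {}")
  case False
  let ?c = "card S"
  have c: "?c > 0" using assms(1) False by (simp add: card_gt_0_iff)
  have P: "0 < (\<Prod>i\<in>S. f i)" using assms(2) by (intro prod_pos) auto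
  have "(\<Prod>i\<in>S. f i) powr (1 / real ?c) \<le> (\<Sum>i\<in>S. f i / real ?c)"
    by (rule arith_geom_mean[OF assms(1) False]) (use assms(2) less_imp_le in blast)
  also have "\<dots> \<le> T / real ?c"
    unfolding sum_divide_distrib[symmetric] using assms(3) by (simp add: divide_right_mono)
  finally have "((\<Prod>i\<in>S. f i) powr (1 / real ?c)) ^ ?c \<le> (T / real ?c) ^ ?c"
    by (intro power_mono) simp_all
  moreover have "((\<Prod>i\<in>S. f i) powr (1 / real ?c)) ^ ?c = (\<Prod>i\<in>S. f i)"
    using c P by (simp add: powr_powr flip: powr_realpow)
  ultimately have "(real ?c / T) ^ ?c * (\<Prod>i\<in>S. f i) \<le> (real ?c / T) ^ ?c * (T / real ?c) ^ ?c"
    using assms(4) by (intro mult_left_mono) auto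
  also have "\<dots> = 1" using c assms(4) by (simp flip: power_mult_distrib)
  finally show ?thesis .
qed simp

text \<open>The bound \<open>a <= Suc b\<close> admits an empty first block, which occurs for
  \<open>k = 1\<close>.\<close>

lemma sum_atLeastAtMost_split:
  fixes f :: "nat \<Rightarrow> 'a::comm_monoid_add"
  assumes "a \<le> Suc b" "b \<le> c"
  shows "(\<Sum>i=a..c. f i) = (\<Sum>i=a..b. f i) + (\<Sum>i=Suc b..c. f i)"
proof -
  have "{a..c} = {a..b} \<union> {Suc b..c}" using assms by auto
  then show ?thesis by (simp add: sum.union_disjoint)
qed

lemma prod_atLeastAtMost_split:
  fixes f :: "nat \<Rightarrow> 'a::comm_monoid_mult"
  assumes "a \<le> Suc b" "b \<le> c"
  shows "(\<Prod>i=a..c. f i) = (\<Prod>i=a..b. f i) * (\<Prod>i=Suc b..c. f i)"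
proof -
  have "{a..c} = {a..b} \<union> {Suc b..c}" using assms by auto
  then show ?thesis by (simp add: prod.union_disjoint)
qed

section \<open>Means of blocks of a decreasing positive sequence\<close>

locale decreasing_positive =
  fixes d k l :: nat and f :: "nat \<Rightarrow> real"
  assumes dec: "\<And>i j. 1 \<le> i \<Longrightarrow> i \<le> j \<Longrightarrow> j \<le> d \<Longrightarrow> f j \<le> f i"
    and pos: "\<And>i. 1 \<le> i \<Longrightarrow> i \<le> d \<Longrightarrow> f i > 0"
    and kl: "1 \<le> k" "k \<le> l" "l \<le> d - 1"
begin

definition "T = (\<Sum>i=1..d. f i)"
definition "P = (\<Prod>i=1..d. f i)"

lemma ld: "l < d" using kl by linarith

lemma T_pos: "T > 0"
  unfolding T_def using pos ld by (intro sum_pos) auto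

lemma prod_pos_Icc: "1 \<le> a \<Longrightarrow> b \<le> d \<Longrightarrow> 0 < (\<Prod>i=a..b. f i)"
  using pos by (intro prod_pos) auto

lemma prefix_bound:
  assumes "a \<le> d"
  shows "(real a / T) ^ a * (\<Prod>i=1..a. f i) \<le> 1"
proof -
  have "(\<Sum>i=1..a. f i) \<le> T"
    unfolding T_def using assms pos by (intro sum_mono2) (auto intro: less_imp_le)
  then show ?thesis
    using prod_power_le_mean[of "{1..a}" f T] assms pos T_pos by simp
qed

lemma suffix_bound:
  assumes "a \<le> d"
  shows "(real a / T) ^ a * P \<le> (\<Prod>i=Suc a..d. f i)"
proof -
  have "(real a / T) ^ a * P = ((real a / T) ^ a * (\<Prod>i=1..a. f i)) * (\<Prod>i=Suc a..d. f i)"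
    unfolding P_def using prod_atLeastAtMost_split[of 1 a d f] assms by (simp only: mult.assoc le_add2 plus_1_eq_Suc)
  also have "\<dots> \<le> 1 * (\<Prod>i=Suc a..d. f i)"
    using prefix_bound[OF assms] prod_pos_Icc[of "Suc a" d] by (intro mult_right_mono) auto
  finally show ?thesis by simp
qed

lemma scaled_prod_nonneg: "0 \<le> (real a / T) ^ a * P"
  using T_pos prod_pos_Icc[of 1 d] by (simp add: P_def)

text \<open>The term \<open>f l\<close> is at most the geometric mean of the block
  \<open>k..l\<close> and at least every later term, so appending later terms cannot raise the
  mean.\<close>

lemma geometric_mean_antimono:
  "(\<Prod>i=k..d. f i) powr (1 / real (d - k + 1)) \<le> (\<Prod>i=k..l. f i) powr (1 / real (l - k + 1))"
proof -
  define a b where "a = l - k + 1" and "b = d - l"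
  define P1 P2 where "P1 = (\<Prod>i=k..l. f i)" and "P2 = (\<Prod>i=Suc l..d. f i)"
  have a: "a > 0" and ab: "d - k + 1 = a + b" using kl ld by (auto simp: a_def b_def)
  have P1: "0 < P1" and P2: "0 < P2" using prod_pos_Icc kl ld by (auto simp: P1_def P2_def)
  have fl: "f l > 0" using pos kl ld by simp
  have "f l ^ card {k..l} \<le> P1"
    unfolding P1_def prod_constant[symmetric] using dec kl ld fl by (intro prod_mono) auto
  then have "f l ^ a \<le> P1" using kl by (simp add: a_def Suc_diff_le)
  then have "(f l ^ a) powr (1 / real a) \<le> P1 powr (1 / real a)"
    using fl by (intro powr_mono2) auto
  then have fl_le: "f l \<le> P1 powr (1 / real a)"
    using a fl by (simp add: powr_powr flip: powr_realpow)
  have "P2 \<le> f l ^ card {Suc l..d}"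
    unfolding P2_def prod_constant[symmetric] using dec kl pos by (intro prod_mono) (auto intro: less_imp_le)
  then have "P2 \<le> f l ^ b" by (simp add: b_def)
  also have "\<dots> \<le> (P1 powr (1 / real a)) ^ b" using fl_le fl by (intro power_mono) auto
  finally have "P2 \<le> P1 powr (real b / real a)"
    using P1 by (simp add: powr_powr flip: powr_realpow)
  then have "P1 * P2 \<le> P1 powr 1 * P1 powr (real b / real a)" using P1 by simp
  also have "\<dots> = P1 powr (real (a + b) / real a)"
    unfolding powr_add[symmetric] using a by (simp add: add_divide_distrib)
  finally have "(P1 * P2) powr (1 / real (a + b)) \<le> (P1 powr (real (a + b) / real a)) powr (1 / real (a + b))"
    using P1 P2 by (intro powr_mono2) auto
  also have "\<dots> = P1 powr (1 / real a)" using a by (simp add: powr_powr)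
  finally have "(P1 * P2) powr (1 / real (a + b)) \<le> P1 powr (1 / real a)" .
  moreover have "(\<Prod>i=k..d. f i) = P1 * P2"
    unfolding P1_def P2_def using kl ld by (intro prod_atLeastAtMost_split) auto
  ultimately show ?thesis unfolding ab by (simp add: P1_def a_def)
qed

lemma lower_bound:
  "((real (k - 1) / T) ^ (k - 1) * P) powr (1 / real (d - k + 1)) \<le> (\<Prod>i=k..l. f i) powr (1 / real (l - k + 1))"
proof -
  have "(real (k - 1) / T) ^ (k - 1) * P \<le> (\<Prod>i=k..d. f i)"
    using suffix_bound[of "k - 1"] kl ld by simp
  then have "((real (k - 1) / T) ^ (k - 1) * P) powr (1 / real (d - k + 1)) \<le> (\<Prod>i=k..d. f i) powr (1 / real (d - k + 1))"
    using scaled_prod_nonneg by (intro powr_mono2) auto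
  also note geometric_mean_antimono
  finally show ?thesis .
qed

lemma geometric_le_arithmetic:
  "(\<Prod>i=k..l. f i) powr (1 / real (l - k + 1)) \<le> (\<Sum>i=k..l. f i) / real (l - k + 1)"
proof -
  have "(\<Prod>i=k..l. f i) powr (1 / real (card {k..l})) \<le> (\<Sum>i\<in>{k..l}. f i / real (card {k..l}))"
    using kl ld pos by (intro arith_geom_mean) (auto intro: less_imp_le)
  moreover have "card {k..l} = l - k + 1" using kl by simp
  ultimately show ?thesis by (simp only: sum_divide_distrib)
qed

text \<open>The value \<open>f k\<close> separates the earlier terms from those of the block, so
  putting the earlier terms in front cannot lower the mean.\<close>

lemma mean_antimono: "(\<Sum>i=k..l. f i) / real (l - k + 1) \<le> (\<Sum>i=1..l. f i) / real l"
proof -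
  define a where "a = l - k + 1"
  define S1 S2 where "S1 = (\<Sum>i=1..k - 1. f i)" and "S2 = (\<Sum>i=k..l. f i)"
  have a: "a > 0" and l_eq: "l = a + (k - 1)" using kl by (auto simp: a_def)
  have split: "(\<Sum>i=1..l. f i) = S1 + S2"
    unfolding S1_def S2_def using sum_atLeastAtMost_split[of 1 "k - 1" l f] kl by simp
  have "S1 \<ge> (\<Sum>i=1..k - 1. f k)"
    unfolding S1_def using dec kl ld by (intro sum_mono) auto
  then have S1: "S1 \<ge> real (k - 1) * f k" by simp
  have "S2 \<le> (\<Sum>i=k..l. f k)"
    unfolding S2_def using dec kl ld by (intro sum_mono) auto
  then have S2: "S2 \<le> real a * f k" using kl by (simp add: a_def Suc_diff_le)
  \<comment> \<open>Multiplied out, the comparison also covers \<open>k = 1\<close>, where the first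
    block is empty and has no mean.\<close>
  have "real (k - 1) * S2 \<le> real (k - 1) * (real a * f k)" using S2 by (intro mult_left_mono) auto
  also have "\<dots> = real a * (real (k - 1) * f k)" by simp
  also have "\<dots> \<le> real a * S1" using S1 by (intro mult_left_mono) auto
  finally have "real (k - 1) * S2 \<le> real a * S1" .
  then have "real l * S2 \<le> real a * (S1 + S2)" by (subst l_eq) (simp add: algebra_simps)
  then have "S2 / real a \<le> (S1 + S2) / real l" using a kl by (simp add: field_simps)
  then show ?thesis unfolding split by (simp add: S2_def a_def)
qed

text \<open>The inequality of the means for the terms after \<open>l\<close> bounds their sum from
  below by \<open>(d - l) * X\<close>. What is left of \<open>T\<close> bounds the sum of the first
  \<open>l\<close> terms.\<close>

lemma upper_bound:
  "(\<Sum>i=k..l. f i) / real (l - k + 1) \<le>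
    T / real l - (real d / real l - 1) * ((real l / T) ^ l * P) powr (1 / real (d - l))"
proof -
  define X where "X = ((real l / T) ^ l * P) powr (1 / real (d - l))"
  have c: "card {Suc l..d} = d - l" by simp
  have "X \<le> (\<Prod>i=Suc l..d. f i) powr (1 / real (d - l))"
    unfolding X_def using suffix_bound[of l] ld scaled_prod_nonneg by (intro powr_mono2) auto
  also have "\<dots> \<le> (\<Sum>i\<in>{Suc l..d}. f i / real (d - l))"
    unfolding c[symmetric] using ld pos by (intro arith_geom_mean) (auto intro: less_imp_le)
  finally have "real (d - l) * X \<le> (\<Sum>i=Suc l..d. f i)"
    using ld by (simp add: sum_divide_distrib[symmetric] field_simps)
  moreover have "T = (\<Sum>i=1..l. f i) + (\<Sum>i=Suc l..d. f i)"
    unfolding T_def using ld by (intro sum_atLeastAtMost_split) auto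
  ultimately have "(\<Sum>i=1..l. f i) \<le> T - (real d - real l) * X" using ld by (simp add: of_nat_diff)
  then have "(\<Sum>i=1..l. f i) / real l \<le> (T - (real d - real l) * X) / real l"
    by (intro divide_right_mono) auto
  also have "\<dots> = T / real l - (real d / real l - 1) * X"
    using kl by (simp add: field_simps)
  finally show ?thesis using mean_antimono by (simp add: X_def)
qed

end

theorem theorem3p3:
  fixes n m d k l :: nat and A :: "real tensor" and lam :: "nat \<Rightarrow> real"
  assumes "m \<ge> 2" and "even m" and "n \<ge> 1"
    and "symmetric_tensor n m A"
    and "d = n * (m - 1) ^ (n - 1)"
    and "tensor_eigenvalues n m (complex_tensor A) =
           image_mset (\<lambda>i. complex_of_real (lam i)) (mset_set {1..d})"
    and "\<And>i j. 1 \<le> i \<Longrightarrow> i \<le> j \<Longrightarrow> j \<le> d \<Longrightarrow> lam j \<le> lam i"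
    and "\<And>i. 1 \<le> i \<Longrightarrow> i \<le> d \<Longrightarrow> lam i > 0"
    and "1 \<le> k" and "k \<le> l" and "l \<le> d - 1"
  shows "let T = real ((m - 1) ^ (n - 1)) * tensor_trace n m A;
             D = Re (tensor_det n m (complex_tensor A))
         in ((real (k - 1) / T) ^ (k - 1) * D) powr (1 / real (d - k + 1))
              \<le> (\<Prod>i=k..l. lam i) powr (1 / real (l - k + 1)) \<and>
            (\<Prod>i=k..l. lam i) powr (1 / real (l - k + 1))
              \<le> (\<Sum>i=k..l. lam i) / real (l - k + 1) \<and>
            (\<Sum>i=k..l. lam i) / real (l - k + 1)
              \<le> T / real l
                 - (real d / real l - 1) * ((real l / T) ^ l * D) powr (1 / real (d - l))"
proof -
  interpret decreasing_positive d k l lam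
    by unfold_locales (fact assms)+
  have "complex_of_real (\<Sum>i=1..d. lam i) = complex_of_real (real ((m - 1) ^ (n - 1)) * tensor_trace n m A)"
    using eigenvalue_sum_prod(1)[OF assms(3,1,5,6)]
    by (simp add: tensor_trace_def complex_tensor_def)
  then have T: "real ((m - 1) ^ (n - 1)) * tensor_trace n m A = T"
    unfolding T_def by (simp only: of_real_eq_iff)
  \<comment> \<open>The determinant is a complex number by construction. As the product of real
    eigenvalues it is real, so taking its real part loses nothing.\<close>
  have "complex_of_real (\<Prod>i=1..d. lam i) = tensor_det n m (complex_tensor A)"
    using eigenvalue_sum_prod(2)[OF assms(3,1,5,6)] by simp
  then have D: "Re (tensor_det n m (complex_tensor A)) = P"
    unfolding P_def by (metis Re_complex_of_real)
  show ?thesis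
    unfolding Let_def T D using lower_bound geometric_le_arithmetic upper_bound by blast
qed

end
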